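(* Let $\rho>0$ and $\lambda\in\left[\frac1n,\frac{\rho}{\sqrt k}\right]$. There exist positive universal constants $C_0,C_1,C_2,c_0$ such that, under the sub-Gaussian sampling model with $m>C_2\log n/\lambda^2$, with probability at least $1-C_0\exp(-c_0m)$ the following holds simultaneously for all $x\in\mathbb{R}^n$ satisfying $\|x_\Omega\|_2/\|x_\Omega\|_1\ge\rho$, all $\epsilon_1\ge 0$ and all $\eta\in\mathbb{R}^m$ with $\|\eta\|_1\le\epsilon_1$: letting $y_i=(a_i^\top x)^2+\eta_i$, $i=1,\dots,m$, any minimizer $\hat X$ of $$\min_M\ \operatorname{Tr}(M)+\lambda\|M\|_1\quad\text{subject to}\quad M\succeq0,\ \ \|y-\mathcal A(M)\|_1\le\epsilon_1$$ satisfies $$\|\hat X-xx^\top\|_{\mathrm F}\le C_1\Big\{\|xx^\top-x_\Omega x_\Omega^\top\|_*+\lambda\|xx^\top-x_\Omega x_\Omega^\top\|_1+\frac{\epsilon_1}{m}\Big\}.$$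
   Context: Sub-Gaussian sampling model: $a_1,\dots,a_m\in\mathbb{R}^n$ are i.i.d. copies of $z=(z_1,\dots,z_n)^\top$ with i.i.d. sub-Gaussian entries, $\mathbb{E}[z_j]=0$, $\mathbb{E}[z_j^2]=1$, $\mu_4:=\mathbb{E}[z_j^4]>1$. $\mathcal A(M)=(a_i^\top Ma_i)_{i=1}^m$. $x_\Omega$ denotes a best $k$-sparse approximation of $x$ (keep the $k$ largest-magnitude entries, zero the rest). For a matrix, $\|\cdot\|_1$ is the entrywise $\ell_1$ norm and $\|\cdot\|_*$ the nuclear norm.
   Formalization: The constants C_0, C_1, C_2, c_0 may depend on the law of the entries z_j (but not on n, k, m, ρ, λ, x, η, ε_1); constants independent of the law cannot exist, e.g. for entries equal to 0 with probability 1-1/L^2 and ±L otherwise, L→∞. *)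

theory Defs
  imports "HOL-Probability.Probability"
begin

text \<open>Vectors in R^n are functions nat => real, only indices < n matter;
  n x n matrices are functions nat => nat => real, only indices < n matter.\<close>

definition restrict_vec :: "nat set \<Rightarrow> (nat \<Rightarrow> real) \<Rightarrow> nat \<Rightarrow> real" where
  "restrict_vec \<Omega> x = (\<lambda>i. if i \<in> \<Omega> then x i else 0)"

definition best_k_support :: "nat \<Rightarrow> nat \<Rightarrow> (nat \<Rightarrow> real) \<Rightarrow> nat set \<Rightarrow> bool" where
  "best_k_support n k x \<Omega> \<longleftrightarrow> \<Omega> \<subseteq> {..<n} \<and> card \<Omega> = min k n \<and>
     (\<forall>i\<in>\<Omega>. \<forall>j\<in>{..<n} - \<Omega>. \<bar>x j\<bar> \<le> \<bar>x i\<bar>)"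

definition vnorm1 :: "nat \<Rightarrow> (nat \<Rightarrow> real) \<Rightarrow> real" where
  "vnorm1 n x = (\<Sum>i<n. \<bar>x i\<bar>)"

definition vnorm2 :: "nat \<Rightarrow> (nat \<Rightarrow> real) \<Rightarrow> real" where
  "vnorm2 n x = sqrt (\<Sum>i<n. (x i)\<^sup>2)"

definition outer :: "(nat \<Rightarrow> real) \<Rightarrow> nat \<Rightarrow> nat \<Rightarrow> real" where
  "outer x = (\<lambda>i j. x i * x j)"

definition mtrace :: "nat \<Rightarrow> (nat \<Rightarrow> nat \<Rightarrow> real) \<Rightarrow> real" where
  "mtrace n M = (\<Sum>i<n. M i i)"

definition mnorm1 :: "nat \<Rightarrow> (nat \<Rightarrow> nat \<Rightarrow> real) \<Rightarrow> real" where
  "mnorm1 n M = (\<Sum>i<n. \<Sum>j<n. \<bar>M i j\<bar>)"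

definition frob :: "nat \<Rightarrow> (nat \<Rightarrow> nat \<Rightarrow> real) \<Rightarrow> real" where
  "frob n M = sqrt (\<Sum>i<n. \<Sum>j<n. (M i j)\<^sup>2)"

definition psd :: "nat \<Rightarrow> (nat \<Rightarrow> nat \<Rightarrow> real) \<Rightarrow> bool" where
  "psd n M \<longleftrightarrow> (\<forall>i<n. \<forall>j<n. M i j = M j i) \<and>
     (\<forall>v::nat \<Rightarrow> real. 0 \<le> (\<Sum>i<n. \<Sum>j<n. v i * M i j * v j))"

definition orthonormal_family :: "nat \<Rightarrow> (nat \<Rightarrow> nat \<Rightarrow> real) \<Rightarrow> bool" where
  "orthonormal_family n u \<longleftrightarrow>
     (\<forall>r<n. \<forall>s<n. (\<Sum>j<n. u r j * u s j) = (if r = s then 1 else 0))"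

text \<open>Nuclear norm = sum of the singular values, read off from a singular value
  decomposition A = sum_r sigma_r u_r v_r^T (sigma_r >= 0, u, v orthonormal).\<close>
definition nuclear_norm :: "nat \<Rightarrow> (nat \<Rightarrow> nat \<Rightarrow> real) \<Rightarrow> real" where
  "nuclear_norm n A = (THE s. \<exists>\<sigma> u v. orthonormal_family n u \<and> orthonormal_family n v \<and>
      (\<forall>r<n. 0 \<le> \<sigma> r) \<and>
      (\<forall>i<n. \<forall>j<n. A i j = (\<Sum>r<n. \<sigma> r * u r i * v r j)) \<and>
      s = (\<Sum>r<n. \<sigma> r))"

definition meas_op :: "nat \<Rightarrow> (nat \<Rightarrow> nat \<Rightarrow> real) \<Rightarrow> (nat \<Rightarrow> nat \<Rightarrow> real) \<Rightarrow> nat \<Rightarrow> real" where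
  "meas_op n a M = (\<lambda>i. \<Sum>j<n. \<Sum>l<n. a i j * M j l * a i l)"

definition feasible :: "nat \<Rightarrow> nat \<Rightarrow> (nat \<Rightarrow> nat \<Rightarrow> real) \<Rightarrow> (nat \<Rightarrow> real) \<Rightarrow> real
    \<Rightarrow> (nat \<Rightarrow> nat \<Rightarrow> real) \<Rightarrow> bool" where
  "feasible n m a y eps M \<longleftrightarrow> psd n M \<and> (\<Sum>i<m. \<bar>y i - meas_op n a M i\<bar>) \<le> eps"

definition is_minimizer :: "nat \<Rightarrow> nat \<Rightarrow> real \<Rightarrow> (nat \<Rightarrow> nat \<Rightarrow> real) \<Rightarrow> (nat \<Rightarrow> real) \<Rightarrow> real
    \<Rightarrow> (nat \<Rightarrow> nat \<Rightarrow> real) \<Rightarrow> bool" where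
  "is_minimizer n m lam a y eps X \<longleftrightarrow> feasible n m a y eps X \<and>
     (\<forall>M. feasible n m a y eps M \<longrightarrow>
        mtrace n X + lam * mnorm1 n X \<le> mtrace n M + lam * mnorm1 n M)"

definition subgaussian_entry_law :: "real measure \<Rightarrow> bool" where
  "subgaussian_entry_law D \<longleftrightarrow> prob_space D \<and> sets D = sets borel \<and>
     (\<exists>K>0. (\<integral>\<^sup>+ t. ennreal (exp (t\<^sup>2 / K\<^sup>2)) \<partial>D) \<le> 2) \<and>
     integrable D (\<lambda>t. t) \<and> (\<integral> t. t \<partial>D) = 0 \<and>
     integrable D (\<lambda>t. t\<^sup>2) \<and> (\<integral> t. t\<^sup>2 \<partial>D) = 1 \<and>
     integrable D (\<lambda>t. t ^ 4) \<and> (\<integral> t. t ^ 4 \<partial>D) > 1"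

text \<open>Sample space of the model: all m*n entries a_i j i.i.d. with law D.
  The outcome w gives a_i j = w (i, j).\<close>
definition sample_space :: "nat \<Rightarrow> nat \<Rightarrow> real measure \<Rightarrow> ((nat \<times> nat) \<Rightarrow> real) measure" where
  "sample_space m n D = (\<Pi>\<^sub>M ij\<in>{..<m} \<times> {..<n}. D)"

definition recovery_event :: "nat \<Rightarrow> nat \<Rightarrow> nat \<Rightarrow> real \<Rightarrow> real \<Rightarrow> real
    \<Rightarrow> (nat \<Rightarrow> nat \<Rightarrow> real) \<Rightarrow> bool" where
  "recovery_event n k m \<rho> lam C1 a \<longleftrightarrow>
    (\<forall>x \<Omega> eps1 (\<eta>::nat \<Rightarrow> real) X.
       best_k_support n k x \<Omega> \<longrightarrow>
       vnorm2 n (restrict_vec \<Omega> x) / vnorm1 n (restrict_vec \<Omega> x) \<ge> \<rho> \<longrightarrow>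
       eps1 \<ge> 0 \<longrightarrow> (\<Sum>i<m. \<bar>\<eta> i\<bar>) \<le> eps1 \<longrightarrow>
       is_minimizer n m lam a (\<lambda>i. (\<Sum>j<n. a i j * x j)\<^sup>2 + \<eta> i) eps1 X \<longrightarrow>
       frob n (\<lambda>i j. X i j - outer x i j)
         \<le> C1 * (nuclear_norm n (\<lambda>i j. outer x i j - outer (restrict_vec \<Omega> x) i j)
                 + lam * mnorm1 n (\<lambda>i j. outer x i j - outer (restrict_vec \<Omega> x) i j)
                 + eps1 / real m))"

end

theory Submission
  imports Defs
begin

text \<open>
  Write \<open>p = x\<^sub>\<Omega>\<close>, \<open>q = x - p\<close>, \<open>Z = x x\<^sup>T - p p\<^sup>T\<close>, \<open>H\<close> for the error \<open>X - x x\<^sup>T\<close> of a minimizer and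
  \<open>\<delta> = \<parallel>Z\<parallel>\<^sub>* + \<lambda> \<parallel>Z\<parallel>\<^sub>1\<close>. With \<open>e = p / \<parallel>p\<parallel>\<close> one has \<open>X - p p\<^sup>T = e g\<^sup>T + g e\<^sup>T + Y\<close>, where \<open>Y\<close> is
  positive semidefinite. Since \<open>s s\<^sup>T\<close> (\<open>s\<close> the signs of \<open>p\<close>) pairs nonnegatively with \<open>Y\<close> and
  \<open>\<lambda> \<surd>k \<parallel>p\<parallel>\<^sub>1 \<le> \<parallel>p\<parallel>\<close>, optimality bounds \<open>tr Y\<close> plus \<open>\<lambda>\<close> times the \<open>\<ell>\<^sub>1\<close> norm of \<open>X\<close> off \<open>\<Omega> \<times> \<Omega>\<close> by
  \<open>4 \<parallel>g\<parallel> + \<delta>\<close>. Hence either \<open>\<parallel>H\<parallel>\<^sub>F \<le> \<delta>\<close>, or \<open>H / \<parallel>H\<parallel>\<^sub>F\<close> is bounded in nuclear norm and pairs with any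
  symmetric \<open>W\<close> by at most a constant times \<open>max |W\<^sub>i\<^sub>j| / \<lambda>\<close> plus the \<open>k\<close>-sparse operator norm of \<open>W\<close>.

  For such matrices Mendelson's small-ball method shows that \<open>\<Sum>\<^sub>i |a\<^sub>i\<^sup>T H a\<^sub>i| \<ge> c m \<parallel>H\<parallel>\<^sub>F\<close> uniformly, outside
  an event of probability \<open>exp (- c m)\<close>: the expectation of \<open>min |a\<^sup>T H a| M\<close> is bounded below by the
  second and fourth moments (this uses \<open>\<mu>\<^sub>4 > 1\<close>), truncation at \<open>M\<close> allows a bounded-difference
  inequality, and symmetrization and contraction reduce the mean deviation to the expectation of the
  two norms of \<open>W = \<Sum>\<^sub>i \<epsilon>\<^sub>i a\<^sub>i a\<^sub>i\<^sup>T\<close>. As \<open>\<parallel>\<A>(H)\<parallel>\<^sub>1 \<le> 2 \<epsilon>\<^sub>1\<close> by feasibility, the bound on \<open>\<parallel>H\<parallel>\<^sub>F\<close> follows.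
\<close>

section \<open>Suprema of sums of independent functions\<close>

text \<open>The sample size is dictated by the two test norms of W. The largest of its n^2 entries
  is divided by lam, which costs log n / lam^2 samples; the k-sparse operator norm is controlled on
  a net of logarithmic size k log n, which costs no more as long as k lam^2 <= 1. The latter follows
  from lam sqrt k <= rho once rho <= 1, and a larger rho admits no x because the l2 norm never
  exceeds the l1 norm.

  The class of normalised errors is uncountable, so its suprema raise questions of measurability.
  All probabilistic estimates are therefore made for finite families, with bounds independent of the
  family. Nested finite families then exhaust a countable dense set, and continuity of the truncated
  sums in the matrix reaches the rest.

  To make the result simultaneous in x, an error is described without x or its support, by the two
  properties that the probabilistic part consumes: a sum of squares dominating its quadratic form
  (for the fourth moment) and a bound for its pairing with every symmetric W (for the
  width).\<close>

abbreviation iid :: "nat \<Rightarrow> 'a measure \<Rightarrow> (nat \<Rightarrow> 'a) measure" where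
  "iid m N \<equiv> Pi\<^sub>M {..<m} (\<lambda>_. N)"

lemma integrable_MAX:
  fixes f :: "'h \<Rightarrow> 'a \<Rightarrow> real"
  assumes "finite F" "F \<noteq> {}" "\<And>h. h \<in> F \<Longrightarrow> integrable M (f h)"
  shows "integrable M (\<lambda>x. MAX h\<in>F. f h x)"
  using assms
proof (induction F rule: finite_ne_induct)
  case (insert a F)
  have "integrable M (\<lambda>x. max (f a x) (MAX h\<in>F. f h x))"
    using insert by (intro integrable_max) auto
  then show ?case using insert by simp
qed simp

lemma MAX_mono_real:
  fixes f :: "'h \<Rightarrow> real"
  assumes "finite F" "F \<noteq> {}" "\<And>h. h \<in> F \<Longrightarrow> f h \<le> g h"
  shows "(MAX h\<in>F. f h) \<le> (MAX h\<in>F. g h)"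
  using assms by (subst Max_le_iff) (auto intro: Max_ge_iff[THEN iffD2])

lemma MAX_attained:
  fixes f :: "'h \<Rightarrow> real"
  assumes "finite F" "F \<noteq> {}"
  obtains h where "h \<in> F" "(MAX h\<in>F. f h) = f h"
proof -
  have "Max (f ` F) \<in> f ` F" using assms by (intro Max_in) auto
  then show ?thesis using that by auto
qed

lemma MAX_ge:
  fixes f :: "'h \<Rightarrow> real"
  assumes "finite F" "h \<in> F"
  shows "f h \<le> (MAX h\<in>F. f h)"
  using assms by auto

section \<open>Splitting off one coordinate of a product measure\<close>

lemma distr_PiM_lessThan_Suc:
  assumes "prob_space N"
  shows "distr (N \<Otimes>\<^sub>M iid m N) (iid (Suc m) N) (\<lambda>(y, x). x(m := y))
    = iid (Suc m) N"
proof -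
  interpret prob_space N by fact
  show ?thesis
    using distr_pair_PiM_eq_PiM[of "{..<m}" "\<lambda>_. N" m] assms
    by (simp add: lessThan_Suc)
qed

lemma measurable_PiM_lessThan_Suc [measurable]:
  "(\<lambda>(y, x). x(m := y)) \<in> N \<Otimes>\<^sub>M iid m N \<rightarrow>\<^sub>M iid (Suc m) N"
proof -
  have "(\<lambda>p. (snd p)(m := fst p)) \<in> N \<Otimes>\<^sub>M iid m N \<rightarrow>\<^sub>M Pi\<^sub>M (insert m {..<m}) (\<lambda>_. N)"
    by (rule measurable_fun_upd[where J="{..<m}"]) auto
  then show ?thesis by (simp add: lessThan_Suc case_prod_beta')
qed

lemma
  fixes f :: "(nat \<Rightarrow> 'a) \<Rightarrow> real"
  assumes N: "prob_space N" and f: "integrable (iid (Suc m) N) f"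
  shows integrable_PiM_Suc: "integrable (N \<Otimes>\<^sub>M iid m N) (\<lambda>(y, x). f (x(m := y)))"
    and integral_PiM_Suc: "(\<integral>x. f x \<partial>iid (Suc m) N) = (\<integral>y. (\<integral>x. f (x(m := y)) \<partial>iid m N) \<partial>N)"
    and integral_PiM_Suc': "(\<integral>x. f x \<partial>iid (Suc m) N) = (\<integral>x. (\<integral>y. f (x(m := y)) \<partial>N) \<partial>iid m N)"
proof -
  interpret N: prob_space N by fact
  interpret P: prob_space "iid m N" by (intro prob_space_PiM N)
  interpret NP: pair_prob_space N "iid m N" ..
  have f': "f \<in> borel_measurable (iid (Suc m) N)" using f by auto
  show i: "integrable (N \<Otimes>\<^sub>M iid m N) (\<lambda>(y, x). f (x(m := y)))"
    using f integrable_distr_eq[OF measurable_PiM_lessThan_Suc f']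
    unfolding distr_PiM_lessThan_Suc[OF N] by (simp add: case_prod_beta')
  have "(\<integral>x. f x \<partial>iid (Suc m) N) = (\<integral>(y, x). f (x(m := y)) \<partial>(N \<Otimes>\<^sub>M iid m N))"
    using integral_distr[OF measurable_PiM_lessThan_Suc f']
    unfolding distr_PiM_lessThan_Suc[OF N] by (simp add: case_prod_beta')
  then show e: "(\<integral>x. f x \<partial>iid (Suc m) N) = (\<integral>y. (\<integral>x. f (x(m := y)) \<partial>iid m N) \<partial>N)"
    using NP.integral_fst[OF i] by simp
  show "(\<integral>x. f x \<partial>iid (Suc m) N) = (\<integral>x. (\<integral>y. f (x(m := y)) \<partial>N) \<partial>iid m N)"
    unfolding e using NP.Fubini_integral[OF i] by simp
qed

lemma integrable_PiM_component:
  fixes f :: "'a \<Rightarrow> real"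
  assumes "\<And>i. i \<in> I \<Longrightarrow> prob_space (N i)" "i \<in> I" "integrable (N i) f"
  shows "integrable (Pi\<^sub>M I N) (\<lambda>x. f (x i))"
    and "(\<integral>x. f (x i) \<partial>Pi\<^sub>M I N) = (\<integral>y. f y \<partial>N i)"
proof -
  have [measurable]: "(\<lambda>x. x i) \<in> Pi\<^sub>M I N \<rightarrow>\<^sub>M N i" using assms(2) by measurable
  have f: "f \<in> borel_measurable (N i)" using assms(3) by auto
  have d: "distr (Pi\<^sub>M I N) (N i) (\<lambda>x. x i) = N i" by (rule distr_PiM_component) fact+
  show "integrable (Pi\<^sub>M I N) (\<lambda>x. f (x i))"
    using integrable_distr_eq[of "\<lambda>x. x i" "Pi\<^sub>M I N" "N i" f] assms(3) f d by simp
  show "(\<integral>x. f (x i) \<partial>Pi\<^sub>M I N) = (\<integral>y. f y \<partial>N i)"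
    using integral_distr[of "\<lambda>x. x i" "Pi\<^sub>M I N" "N i" f] f d by simp
qed

lemma
  fixes f :: "'a \<Rightarrow> real" and g :: "'b \<Rightarrow> real"
  assumes "prob_space M" "prob_space N"
  shows integrable_pair_fst: "integrable M f \<Longrightarrow> integrable (M \<Otimes>\<^sub>M N) (\<lambda>p. f (fst p))"
    and integrable_pair_snd: "integrable N g \<Longrightarrow> integrable (M \<Otimes>\<^sub>M N) (\<lambda>p. g (snd p))"
proof -
  interpret M: prob_space M by fact
  interpret N: prob_space N by fact
  interpret MN: pair_prob_space M N ..
  show 1: "integrable (M \<Otimes>\<^sub>M N) (\<lambda>p. f (fst p))" if "integrable M f" for f :: "'a \<Rightarrow> real"
    using integrable_distr_eq[of fst "M \<Otimes>\<^sub>M N" M f] that N.distr_pair_fst[of M] by auto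
  show "integrable (M \<Otimes>\<^sub>M N) (\<lambda>p. g (snd p))" if "integrable N g"
  proof -
    interpret S: pair_prob_space N M ..
    have "integrable (N \<Otimes>\<^sub>M M) (\<lambda>p. g (fst p))"
      using integrable_distr_eq[of fst "N \<Otimes>\<^sub>M M" N g] that M.distr_pair_fst[of N] by auto
    from S.integrable_product_swap[OF this] show ?thesis by (simp add: case_prod_beta')
  qed
qed

lemma integrable_MAX_sum_PiM:
  fixes f :: "'h \<Rightarrow> 'a \<Rightarrow> real"
  assumes "prob_space N" "finite F" "F \<noteq> {}" "\<And>h. h \<in> F \<Longrightarrow> integrable N (f h)"
  shows "integrable (iid m N) (\<lambda>x. MAX h\<in>F. c h + (\<Sum>i<m. f h (x i)))"
proof -
  interpret P: prob_space "iid m N" by (intro prob_space_PiM assms)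
  show ?thesis
    using assms
    by (intro integrable_MAX Bochner_Integration.integrable_add Bochner_Integration.integrable_sum)
       (auto intro!: integrable_PiM_component)
qed

text \<open>Fixing one coordinate only changes the offset \<open>c\<close>. This is why all maxima
  carry an offset: the inductions on \<open>m\<close> run with \<open>c\<close> arbitrary.\<close>

lemma MAX_fun_upd:
  fixes f :: "'h \<Rightarrow> 'a \<Rightarrow> real"
  shows "(MAX h\<in>F. c h + (\<Sum>i<Suc m. f h ((x(m := y)) i)))
    = (MAX h\<in>F. (c h + f h y) + (\<Sum>i<m. f h (x i)))"
  by (intro arg_cong[where f=Max] image_cong) auto

text \<open>The distributions are exchanged one coordinate at a time. With the other coordinates
  fixed their sum is just another offset, so a comparison for a single sample with arbitrary
  offsets, \<open>step\<close>, is enough. It reduces symmetrization and contraction to one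
  sample.\<close>

lemma product_MAX_compare:
  fixes m :: nat and f :: "'h \<Rightarrow> 'a \<Rightarrow> real" and g :: "'h \<Rightarrow> 'b \<Rightarrow> real"
  assumes N: "prob_space N" "prob_space N'" and F: "finite F" "F \<noteq> {}"
    and f: "\<And>h. h \<in> F \<Longrightarrow> integrable N (f h)" and g: "\<And>h. h \<in> F \<Longrightarrow> integrable N' (g h)"
    and step: "\<And>c::'h \<Rightarrow> real. (\<integral>x. (MAX h\<in>F. c h + f h x) \<partial>N) \<le> (\<integral>x. (MAX h\<in>F. c h + g h x) \<partial>N')"
  shows "(\<integral>x. (MAX h\<in>F. c h + (\<Sum>i<m. f h (x i))) \<partial>iid m N)
    \<le> (\<integral>x. (MAX h\<in>F. c h + (\<Sum>i<m. g h (x i))) \<partial>iid m N')"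
proof (induction m arbitrary: c)
  case 0
  then show ?case by (simp add: PiM_empty lebesgue_integral_count_space_finite)
next
  case (Suc m)
  interpret N: prob_space N by fact
  interpret N': prob_space N' by fact
  let ?P = "iid m N" and ?P' = "iid m N'"
  interpret P: prob_space ?P by (intro prob_space_PiM N)
  interpret P': prob_space ?P' by (intro prob_space_PiM N)
  interpret NP: pair_prob_space N ?P ..
  interpret NP': pair_prob_space N ?P' ..
  interpret N'P': pair_prob_space N' ?P' ..
  \<comment> \<open>The hybrid: the last coordinate still uses \<open>f\<close>, the others already
    use \<open>g\<close>. The induction hypothesis leads to it, and after exchanging the integrals
    \<open>step\<close> leads away from it.\<close>
  let ?G = "\<lambda>y x. MAX h\<in>F. (c h + f h y) + (\<Sum>i<m. g h (x i))"
  have iG: "integrable (N \<Otimes>\<^sub>M ?P') (\<lambda>(y, x). ?G y x)"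
    unfolding case_prod_beta'
  proof (intro integrable_MAX F Bochner_Integration.integrable_add)
    fix h assume h: "h \<in> F"
    show "integrable (N \<Otimes>\<^sub>M ?P') (\<lambda>p. f h (fst p))"
      using f h by (intro integrable_pair_fst N P'.prob_space_axioms)
    have "integrable ?P' (\<lambda>x. \<Sum>i<m. g h (x i))"
      using g[OF h] N by (intro Bochner_Integration.integrable_sum) (auto intro!: integrable_PiM_component)
    then show "integrable (N \<Otimes>\<^sub>M ?P') (\<lambda>p. \<Sum>i<m. g h (snd p i))"
      by (rule integrable_pair_snd[OF N(1) P'.prob_space_axioms])
  qed auto
  have iF: "integrable (iid (Suc m) N) (\<lambda>x. MAX h\<in>F. c h + (\<Sum>i<Suc m. f h (x i)))"
    by (intro integrable_MAX_sum_PiM N F f)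
  have ig: "integrable (iid (Suc m) N') (\<lambda>x. MAX h\<in>F. c h + (\<Sum>i<Suc m. g h (x i)))"
    by (intro integrable_MAX_sum_PiM N F g)
  have "(\<integral>x. (MAX h\<in>F. c h + (\<Sum>i<Suc m. f h (x i))) \<partial>iid (Suc m) N)
    = (\<integral>y. (\<integral>x. (MAX h\<in>F. (c h + f h y) + (\<Sum>i<m. f h (x i))) \<partial>?P) \<partial>N)"
    unfolding integral_PiM_Suc[OF N(1) iF] MAX_fun_upd ..
  also have "\<dots> \<le> (\<integral>y. (\<integral>x. ?G y x \<partial>?P') \<partial>N)"
  proof (rule integral_mono)
    show "integrable N (\<lambda>y. \<integral>x. (MAX h\<in>F. (c h + f h y) + (\<Sum>i<m. f h (x i))) \<partial>?P)"
      using NP.integrable_fst'[OF integrable_PiM_Suc[OF N(1) iF]] by (simp only: split MAX_fun_upd)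
    show "integrable N (\<lambda>y. \<integral>x. ?G y x \<partial>?P')"
      using NP'.integrable_fst'[OF iG] by simp
  qed (rule Suc.IH)
  also have "\<dots> = (\<integral>x. (\<integral>y. ?G y x \<partial>N) \<partial>?P')"
    using NP'.Fubini_integral[OF iG] by simp
  also have "\<dots> = (\<integral>x. (\<integral>y. (MAX h\<in>F. (c h + (\<Sum>i<m. g h (x i))) + f h y) \<partial>N) \<partial>?P')"
    by (simp add: algebra_simps)
  also have "\<dots> \<le> (\<integral>x. (\<integral>y. (MAX h\<in>F. (c h + (\<Sum>i<m. g h (x i))) + g h y) \<partial>N') \<partial>?P')"
  proof (rule integral_mono)
    show "integrable ?P' (\<lambda>x. \<integral>y. (MAX h\<in>F. (c h + (\<Sum>i<m. g h (x i))) + f h y) \<partial>N)"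
      using NP'.integrable_snd[OF iG] by (simp add: algebra_simps)
    show "integrable ?P' (\<lambda>x. \<integral>y. (MAX h\<in>F. (c h + (\<Sum>i<m. g h (x i))) + g h y) \<partial>N')"
      using N'P'.integrable_snd[OF integrable_PiM_Suc[OF N(2) ig]]
      by (simp only: split MAX_fun_upd) (simp add: algebra_simps)
  qed (rule step)
  also have "\<dots> = (\<integral>x. (MAX h\<in>F. c h + (\<Sum>i<Suc m. g h (x i))) \<partial>iid (Suc m) N')"
    unfolding integral_PiM_Suc'[OF N(2) ig] MAX_fun_upd by (simp add: algebra_simps)
  finally show ?case .
qed

text \<open>McDiarmid's bounded-difference argument, run one coordinate at a time with Hoeffding's lemma.\<close>

lemma exp_moment_MAX_sum:
  fixes m :: nat and f :: "'h \<Rightarrow> 'a \<Rightarrow> real"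
  assumes N: "prob_space N" and F: "finite F" "F \<noteq> {}"
    and f: "\<And>h. h \<in> F \<Longrightarrow> f h \<in> borel_measurable N"
    and bnd: "\<And>h x. h \<in> F \<Longrightarrow> x \<in> space N \<Longrightarrow> l h \<le> f h x \<and> f h x \<le> l h + M"
    and \<theta>: "\<theta> > 0"
  shows "(\<integral>\<^sup>+x. ennreal (exp (\<theta> * (MAX h\<in>F. c h + (\<Sum>i<m. f h (x i))))) \<partial>iid m N)
    \<le> ennreal (exp (\<theta> * (\<integral>x. (MAX h\<in>F. c h + (\<Sum>i<m. f h (x i))) \<partial>iid m N) + \<theta>\<^sup>2 * M\<^sup>2 / 8 * m))"
proof (induction m arbitrary: c)
  case 0
  then show ?case by (simp add: PiM_empty lebesgue_integral_count_space_finite nn_integral_count_space_finite)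
next
  case (Suc m)
  interpret N: prob_space N by fact
  let ?P = "iid m N" and ?P1 = "iid (Suc m) N"
  interpret P: prob_space ?P by (intro prob_space_PiM N)
  interpret NP: pair_prob_space N ?P ..
  have fi: "integrable N (f h)" if "h \<in> F" for h
    using bnd[OF that] f[OF that]
    by (intro N.integrable_const_bound[where B="\<bar>l h\<bar> + \<bar>l h + M\<bar>"]) force+
  have i1: "integrable ?P1 (\<lambda>x. MAX h\<in>F. c h + (\<Sum>i<Suc m. f h (x i)))"
    by (intro integrable_MAX_sum_PiM N F fi)
  define L where "L y = (\<integral>x. (MAX h\<in>F. (c h + f h y) + (\<Sum>i<m. f h (x i))) \<partial>?P)" for y
  have Li: "integrable N L"
    using NP.integrable_fst'[OF integrable_PiM_Suc[OF N i1]] unfolding L_def by (simp only: split MAX_fun_upd)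
  have EL: "(\<integral>x. (MAX h\<in>F. c h + (\<Sum>i<Suc m. f h (x i))) \<partial>?P1) = (\<integral>y. L y \<partial>N)"
    unfolding integral_PiM_Suc[OF N i1] MAX_fun_upd L_def ..
  \<comment> \<open>Giving the last coordinate its least contribution \<open>l h\<close> bounds
    \<open>L\<close> from below, and raising it by \<open>M\<close> bounds \<open>L\<close> from
    above. So \<open>L\<close> ranges in an interval of length \<open>M\<close>, as Hoeffding's
    lemma requires.\<close>
  define L0 where "L0 = (\<integral>x. (MAX h\<in>F. (c h + l h) + (\<Sum>i<m. f h (x i))) \<partial>?P)"
  have LL: "L0 \<le> L y \<and> L y \<le> L0 + M" if y: "y \<in> space N" for y
  proof
    show "L0 \<le> L y" unfolding L0_def L_def
      using bnd y by (intro integral_mono integrable_MAX_sum_PiM N F fi MAX_mono_real) auto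
    have "L y \<le> (\<integral>x. (MAX h\<in>F. (c h + l h) + (\<Sum>i<m. f h (x i))) + M \<partial>?P)" unfolding L_def
    proof (intro integral_mono integrable_MAX_sum_PiM N F fi Bochner_Integration.integrable_add)
      fix x
      have *: "(c h + f h y) + (\<Sum>i<m. f h (x i)) \<le> (MAX h\<in>F. (c h + l h) + (\<Sum>i<m. f h (x i))) + M" if "h \<in> F" for h
        using MAX_ge[OF F(1) that, of "\<lambda>h. (c h + l h) + (\<Sum>i<m. f h (x i))"] bnd[OF that y] by linarith
      show "(MAX h\<in>F. (c h + f h y) + (\<Sum>i<m. f h (x i))) \<le> (MAX h\<in>F. (c h + l h) + (\<Sum>i<m. f h (x i))) + M"
        using F * by (subst Max_le_iff) auto
    qed auto
    also have "\<dots> = L0 + M" unfolding L0_def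
      by (subst Bochner_Integration.integral_add) (auto intro!: integrable_MAX_sum_PiM N F fi simp: P.prob_space)
    finally show "L y \<le> L0 + M" .
  qed
  interpret I: interval_bounded_random_variable N L L0 "L0 + M"
    using Li LL by unfold_locales auto
  have hm: "(\<integral>\<^sup>+y. ennreal (exp (\<theta> * (L y - (\<integral>y. L y \<partial>N)))) \<partial>N) \<le> ennreal (exp (\<theta>\<^sup>2 * M\<^sup>2 / 8))"
    using I.Hoeffdings_lemma_nn_integral[OF \<theta>] by simp
  have ms: "(\<lambda>x. ennreal (exp (\<theta> * (MAX h\<in>F. c h + (\<Sum>i<Suc m. f h (x i)))))) \<in> borel_measurable ?P1"
    using i1 by (intro measurable_compose[OF _ measurable_ennreal] measurable_compose[OF _ borel_measurable_exp]
      borel_measurable_times borel_measurable_const) auto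
  interpret S: product_sigma_finite "\<lambda>_::nat. N" ..
  have "(\<integral>\<^sup>+x. ennreal (exp (\<theta> * (MAX h\<in>F. c h + (\<Sum>i<Suc m. f h (x i))))) \<partial>?P1)
     = (\<integral>\<^sup>+y. (\<integral>\<^sup>+x. ennreal (exp (\<theta> * (MAX h\<in>F. (c h + f h y) + (\<Sum>i<m. f h (x i))))) \<partial>?P) \<partial>N)"
    unfolding lessThan_Suc using ms
    by (subst S.product_nn_integral_insert_rev) (auto simp: lessThan_Suc[symmetric] algebra_simps)
  also have "\<dots> \<le> (\<integral>\<^sup>+y. ennreal (exp (\<theta> * L y + \<theta>\<^sup>2 * M\<^sup>2 / 8 * m)) \<partial>N)"
    unfolding L_def by (intro nn_integral_mono Suc.IH)
  also have "\<dots> = (\<integral>\<^sup>+y. ennreal (exp (\<theta> * (\<integral>y. L y \<partial>N) + \<theta>\<^sup>2 * M\<^sup>2 / 8 * m)) * ennreal (exp (\<theta> * (L y - (\<integral>y. L y \<partial>N)))) \<partial>N)"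
    by (intro nn_integral_cong) (simp add: ennreal_mult'[symmetric] exp_add[symmetric] algebra_simps)
  also have "\<dots> = ennreal (exp (\<theta> * (\<integral>y. L y \<partial>N) + \<theta>\<^sup>2 * M\<^sup>2 / 8 * m)) * (\<integral>\<^sup>+y. ennreal (exp (\<theta> * (L y - (\<integral>y. L y \<partial>N)))) \<partial>N)"
    using Li by (intro nn_integral_cmult) auto
  also have "\<dots> \<le> ennreal (exp (\<theta> * (\<integral>y. L y \<partial>N) + \<theta>\<^sup>2 * M\<^sup>2 / 8 * m)) * ennreal (exp (\<theta>\<^sup>2 * M\<^sup>2 / 8))"
    by (intro mult_left_mono hm) auto
  also have "\<dots> = ennreal (exp (\<theta> * (\<integral>y. L y \<partial>N) + \<theta>\<^sup>2 * M\<^sup>2 / 8 * Suc m))"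
    by (simp add: ennreal_mult'[symmetric] exp_add[symmetric] algebra_simps)
  finally show ?case unfolding EL .
qed

text \<open>The maximum is dominated by the logarithm of a sum of exponentials over all members and
  both signs, whence the factor 2 with the cardinality.\<close>

lemma expected_MAX_abs_sum:
  fixes m :: nat and g :: "'h \<Rightarrow> 'a \<Rightarrow> real"
  assumes N: "prob_space N" and G: "finite G" "G \<noteq> {}"
    and g: "\<And>h. h \<in> G \<Longrightarrow> integrable N (g h)"
    and mgf: "\<And>h. h \<in> G \<Longrightarrow> (\<integral>\<^sup>+x. ennreal (exp (s * g h x)) \<partial>N) \<le> ennreal (exp v)"
             "\<And>h. h \<in> G \<Longrightarrow> (\<integral>\<^sup>+x. ennreal (exp (- (s * g h x))) \<partial>N) \<le> ennreal (exp v)"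
    and s: "s > 0"
  shows "(\<integral>x. (MAX h\<in>G. \<bar>\<Sum>i<m. g h (x i)\<bar>) \<partial>iid m N) \<le> (ln (2 * real (card G)) + real m * v) / s"
proof -
  interpret N: prob_space N by fact
  let ?P = "iid m N"
  interpret P: prob_space ?P by (intro prob_space_PiM N)
  interpret S: product_sigma_finite "\<lambda>_::nat. N" ..
  define K where "K = 2 * real (card G) * exp (real m * v)"
  have card: "real (card G) > 0" using G by (simp add: card_gt_0_iff)
  then have K: "K > 0" by (simp add: K_def)
  define Y where "Y h x = (\<Sum>i<m. g h (x i))" for h and x :: "nat \<Rightarrow> 'a"
  have Yi: "integrable ?P (Y h)" if "h \<in> G" for h unfolding Y_def
    using g[OF that] N by (intro Bochner_Integration.integrable_sum) (auto intro!: integrable_PiM_component)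
  have pm: "(\<integral>\<^sup>+x. ennreal (exp (t * Y h x)) \<partial>?P) \<le> ennreal (exp (real m * v))"
    if h: "h \<in> G" and t: "t = s \<or> t = - s" for h t
  proof -
    have [measurable]: "g h \<in> borel_measurable N" using g[OF h] by auto
    have "(\<integral>\<^sup>+x. ennreal (exp (t * Y h x)) \<partial>?P) = (\<integral>\<^sup>+x. (\<Prod>i<m. ennreal (exp (t * g h (x i)))) \<partial>?P)"
      by (simp add: Y_def sum_distrib_left exp_sum prod_ennreal)
    also have "\<dots> = (\<Prod>i<m. \<integral>\<^sup>+x. ennreal (exp (t * g h x)) \<partial>N)"
      by (rule S.product_nn_integral_prod) auto
    also have "\<dots> \<le> (\<Prod>i<m. ennreal (exp v))"
      using mgf[OF h] t by (auto intro!: power_mono)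
    also have "\<dots> = ennreal (exp (real m * v))"
      by (simp add: ennreal_power exp_of_nat_mult)
    finally show ?thesis .
  qed
  define X where "X x = (\<Sum>h\<in>G. exp (s * Y h x) + exp (- s * Y h x))" for x
  have Ym: "Y h \<in> borel_measurable ?P" if "h \<in> G" for h using Yi[OF that] by auto
  have Xm: "X \<in> borel_measurable ?P" unfolding X_def using Ym by (intro borel_measurable_sum) auto
  have "(\<integral>\<^sup>+x. ennreal (X x) \<partial>?P) = (\<Sum>h\<in>G. (\<integral>\<^sup>+x. ennreal (exp (s * Y h x)) \<partial>?P) + (\<integral>\<^sup>+x. ennreal (exp (- s * Y h x)) \<partial>?P))"
  proof -
    have "(\<integral>\<^sup>+x. ennreal (X x) \<partial>?P) = (\<integral>\<^sup>+x. (\<Sum>h\<in>G. ennreal (exp (s * Y h x)) + ennreal (exp (- s * Y h x))) \<partial>?P)"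
      unfolding X_def by (intro nn_integral_cong) (simp add: ennreal_plus[symmetric] sum_ennreal del: ennreal_plus)
    also have "\<dots> = (\<Sum>h\<in>G. (\<integral>\<^sup>+x. ennreal (exp (s * Y h x)) + ennreal (exp (- s * Y h x)) \<partial>?P))"
      using Ym by (intro nn_integral_sum) auto
    also have "\<dots> = (\<Sum>h\<in>G. (\<integral>\<^sup>+x. ennreal (exp (s * Y h x)) \<partial>?P) + (\<integral>\<^sup>+x. ennreal (exp (- s * Y h x)) \<partial>?P))"
      using Ym by (intro sum.cong refl nn_integral_add) auto
    finally show ?thesis .
  qed
  also have "\<dots> \<le> (\<Sum>h\<in>G. ennreal (exp (real m * v)) + ennreal (exp (real m * v)))"
    by (intro sum_mono add_mono pm) auto
  also have "\<dots> = ennreal K"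
    by (simp add: K_def ennreal_plus[symmetric] sum_ennreal ennreal_of_nat_eq_real_of_nat ennreal_mult'[symmetric] del: ennreal_plus)
  finally have XK: "(\<integral>\<^sup>+x. ennreal (X x) \<partial>?P) \<le> ennreal K" .
  have X0: "X x \<ge> 0" for x unfolding X_def by (intro sum_nonneg) (simp add: add_nonneg_nonneg)
  have Xi: "integrable ?P X"
    using XK Xm X0 by (intro integrableI_nonneg) (auto intro: le_less_trans[OF XK])
  have EX: "(\<integral>x. X x \<partial>?P) \<le> K"
    using XK X0 K nn_integral_eq_integral[OF Xi] by (auto simp: ennreal_le_iff)
  \<comment> \<open>The logarithm lies below its tangent at \<open>K\<close>: ln X <= X / K + ln K -
    1. Integrating this linear bound takes the place of Jensen's inequality.\<close>
  have pw: "(MAX h\<in>G. \<bar>Y h x\<bar>) \<le> (X x / K + (ln K - 1)) / s" for x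
  proof -
    obtain h where h: "h \<in> G" "(MAX h\<in>G. \<bar>Y h x\<bar>) = \<bar>Y h x\<bar>" using MAX_attained[OF G] .
    have "exp (s * \<bar>Y h x\<bar>) \<le> exp (s * Y h x) + exp (- s * Y h x)"
      by (cases "Y h x \<ge> 0") auto
    also have "\<dots> \<le> X x" unfolding X_def
      by (rule member_le_sum[where f="\<lambda>h. exp (s * Y h x) + exp (- s * Y h x)"]) (use h G in \<open>auto simp: add_nonneg_nonneg\<close>)
    finally have e: "exp (s * \<bar>Y h x\<bar>) \<le> X x" .
    have "s * \<bar>Y h x\<bar> - ln K \<le> exp (s * \<bar>Y h x\<bar> - ln K) - 1"
      using exp_ge_add_one_self[of "s * \<bar>Y h x\<bar> - ln K"] by linarith
    also have "exp (s * \<bar>Y h x\<bar> - ln K) \<le> X x / K"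
      using e K by (simp add: exp_diff divide_right_mono)
    finally have "s * \<bar>Y h x\<bar> \<le> X x / K + (ln K - 1)" by simp
    then show ?thesis using s h by (simp add: field_simps)
  qed
  have "(\<integral>x. (MAX h\<in>G. \<bar>Y h x\<bar>) \<partial>?P) \<le> (\<integral>x. (X x / K + (ln K - 1)) / s \<partial>?P)"
    using Xi Yi G by (intro integral_mono pw integrable_MAX) auto
  also have "\<dots> = ((\<integral>x. X x \<partial>?P) / K + (ln K - 1)) / s"
    using Xi by (simp add: P.prob_space)
  also have "\<dots> \<le> (1 + (ln K - 1)) / s"
    using EX K s by (intro divide_right_mono add_right_mono) (auto simp: divide_le_eq)
  also have "\<dots> = (ln (2 * real (card G)) + real m * v) / s"
    using card by (simp add: K_def ln_mult)
  finally show ?thesis unfolding Y_def .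
qed

section \<open>Random signs, symmetrization and the small-ball method\<close>

definition rsign :: "bool \<Rightarrow> real" where
  "rsign b = (if b then 1 else - 1)"

definition signed :: "'a measure \<Rightarrow> ('a \<times> bool) measure" where
  "signed N = N \<Otimes>\<^sub>M measure_pmf (bernoulli_pmf (1/2))"

lemma measurable_rsign [measurable]: "rsign \<in> borel_measurable (measure_pmf p)"
  by simp

lemma prob_space_signed: "prob_space N \<Longrightarrow> prob_space (signed N)"
  unfolding signed_def by (intro prob_space_pair measure_pmf.prob_space_axioms)

lemma integrable_signed:
  assumes "prob_space N" "integrable N (f :: 'a \<Rightarrow> real)"
  shows "integrable (signed N) (\<lambda>p. rsign (snd p) * f (fst p))"
proof -
  have "integrable (signed N) (\<lambda>p. f (fst p))"
    unfolding signed_def by (intro integrable_pair_fst assms measure_pmf.prob_space_axioms)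
  moreover have "(\<lambda>p. rsign (snd p) * f (fst p)) \<in> borel_measurable (signed N)"
    using assms(2) unfolding signed_def by measurable
  ultimately show ?thesis
    by (rule Bochner_Integration.integrable_bound) (auto simp: rsign_def)
qed

lemma integral_signed:
  assumes N: "prob_space N" and f: "integrable (signed N) (f :: _ \<Rightarrow> real)"
  shows "(\<integral>p. f p \<partial>signed N) = (\<integral>x. (f (x, True) + f (x, False)) / 2 \<partial>N)"
proof -
  interpret N: prob_space N by fact
  interpret S: pair_prob_space N "measure_pmf (bernoulli_pmf (1/2))" ..
  have "(\<integral>p. f p \<partial>signed N) = (\<integral>x. (\<integral>b. f (x, b) \<partial>measure_pmf (bernoulli_pmf (1/2))) \<partial>N)"
    using S.integral_fst'[OF f[unfolded signed_def]] unfolding signed_def by simp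
  then show ?thesis by (simp add: add_divide_distrib)
qed

lemma nn_integral_signed:
  assumes "prob_space N" and f: "f \<in> borel_measurable (signed N)"
  shows "(\<integral>\<^sup>+p. f p \<partial>signed N) = (\<integral>\<^sup>+x. (f (x, True) * ennreal (1/2) + f (x, False) * ennreal (1/2)) \<partial>N)"
proof -
  have "(\<integral>\<^sup>+p. f p \<partial>signed N) = (\<integral>\<^sup>+x. (\<integral>\<^sup>+b. f (x, b) \<partial>measure_pmf (bernoulli_pmf (1/2))) \<partial>N)"
    using sigma_finite_measure.nn_integral_fst[OF prob_space_imp_sigma_finite[OF measure_pmf.prob_space_axioms] f[unfolded signed_def]] unfolding signed_def by simp
  then show ?thesis by simp
qed

text \<open>The independent copy is decoupled by
  \<open>Max (c + u - v) \<le> (Max (c + 2 u) + Max (c - 2 v)) / 2\<close>.\<close>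

lemma symmetrization_contraction_step:
  fixes f :: "'h \<Rightarrow> 'a \<Rightarrow> real" and \<phi> :: "real \<Rightarrow> real"
  assumes N: "prob_space N" and F: "finite F" "F \<noteq> {}"
    and f: "\<And>h. h \<in> F \<Longrightarrow> integrable N (f h)"
    and \<phi>f: "\<And>h. h \<in> F \<Longrightarrow> integrable N (\<lambda>x. \<phi> (f h x))"
    and lip: "\<And>s t. \<bar>\<phi> s - \<phi> t\<bar> \<le> \<bar>s - t\<bar>"
  shows "(\<integral>x. (MAX h\<in>F. c h + ((\<integral>y. \<phi> (f h y) \<partial>N) - \<phi> (f h x))) \<partial>N)
    \<le> (\<integral>p. (MAX h\<in>F. c h + 2 * (rsign (snd p) * f h (fst p))) \<partial>signed N)"
proof -
  interpret N: prob_space N by fact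
  define A where "A x = (MAX h\<in>F. c h + 2 * \<phi> (f h x))" for x
  define B where "B x = (MAX h\<in>F. c h - 2 * \<phi> (f h x))" for x
  have iA: "integrable N A" unfolding A_def using F \<phi>f by (intro integrable_MAX) auto
  have iB: "integrable N B" unfolding B_def using F \<phi>f by (intro integrable_MAX) auto
  have i2: "integrable N (\<lambda>x. MAX h\<in>F. c h + 2 * f h x)" "integrable N (\<lambda>x. MAX h\<in>F. c h - 2 * f h x)"
    using F f by (auto intro!: integrable_MAX)
  have 1: "(MAX h\<in>F. c h + ((\<integral>y. \<phi> (f h y) \<partial>N) - \<phi> (f h x))) \<le> (\<integral>y. (A y + B x) / 2 \<partial>N)" for x
  proof -
    obtain h where h: "h \<in> F" "(MAX h\<in>F. c h + ((\<integral>y. \<phi> (f h y) \<partial>N) - \<phi> (f h x))) = c h + ((\<integral>y. \<phi> (f h y) \<partial>N) - \<phi> (f h x))"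
      using MAX_attained[OF F, of "\<lambda>h. c h + ((\<integral>y. \<phi> (f h y) \<partial>N) - \<phi> (f h x))"] .
    have "c h + ((\<integral>y. \<phi> (f h y) \<partial>N) - \<phi> (f h x)) = (\<integral>y. c h + (\<phi> (f h y) - \<phi> (f h x)) \<partial>N)"
      using \<phi>f[OF h(1)] by (simp add: N.prob_space)
    also have "\<dots> \<le> (\<integral>y. (A y + B x) / 2 \<partial>N)"
    proof (rule integral_mono)
      fix y
      have "c h + 2 * \<phi> (f h y) \<le> A y" unfolding A_def
        using MAX_ge[OF F(1) h(1), of "\<lambda>h. c h + 2 * \<phi> (f h y)"] .
      moreover have "c h - 2 * \<phi> (f h x) \<le> B x" unfolding B_def
        using MAX_ge[OF F(1) h(1), of "\<lambda>h. c h - 2 * \<phi> (f h x)"] .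
      ultimately show "c h + (\<phi> (f h y) - \<phi> (f h x)) \<le> (A y + B x) / 2" by argo
    qed (use iA \<phi>f[OF h(1)] in auto)
    finally show ?thesis using h by simp
  qed
  \<comment> \<open>Contraction: for the maximizers \<open>h1\<close>, \<open>h2\<close> the
    difference of the \<phi>-values is at most the absolute difference of the f-values, and
    assigning \<open>h1\<close>, \<open>h2\<close> to the two maxima on the right in the suitable
    order realises either sign of it.\<close>
  have 2: "A x + B x \<le> (MAX h\<in>F. c h + 2 * f h x) + (MAX h\<in>F. c h - 2 * f h x)" for x
  proof -
    obtain h1 where h1: "h1 \<in> F" "A x = c h1 + 2 * \<phi> (f h1 x)"
      unfolding A_def using MAX_attained[OF F, of "\<lambda>h. c h + 2 * \<phi> (f h x)"] .
    obtain h2 where h2: "h2 \<in> F" "B x = c h2 - 2 * \<phi> (f h2 x)"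
      unfolding B_def using MAX_attained[OF F, of "\<lambda>h. c h - 2 * \<phi> (f h x)"] .
    have "c h + 2 * f h x \<le> (MAX h\<in>F. c h + 2 * f h x)" "c h - 2 * f h x \<le> (MAX h\<in>F. c h - 2 * f h x)" if "h \<in> F" for h
      using MAX_ge[OF F(1) that, of "\<lambda>h. c h + 2 * f h x"] MAX_ge[OF F(1) that, of "\<lambda>h. c h - 2 * f h x"] by auto
    from this[OF h1(1)] this[OF h2(1)] show ?thesis
      using h1 h2 lip[of "f h1 x" "f h2 x"] by linarith
  qed
  have "(\<integral>x. (MAX h\<in>F. c h + ((\<integral>y. \<phi> (f h y) \<partial>N) - \<phi> (f h x))) \<partial>N) \<le> (\<integral>x. (\<integral>y. (A y + B x) / 2 \<partial>N) \<partial>N)"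
    using F \<phi>f iA iB by (intro integral_mono 1 integrable_MAX) (auto simp: add_divide_distrib N.prob_space)
  also have "\<dots> = (\<integral>x. (A x + B x) / 2 \<partial>N)"
    using iA iB by (simp add: N.prob_space add_divide_distrib)
  also have "\<dots> \<le> (\<integral>x. ((MAX h\<in>F. c h + 2 * f h x) + (MAX h\<in>F. c h - 2 * f h x)) / 2 \<partial>N)"
    using iA iB i2 by (intro integral_mono divide_right_mono 2) auto
  also have "\<dots> = (\<integral>p. (MAX h\<in>F. c h + 2 * (rsign (snd p) * f h (fst p))) \<partial>signed N)"
  proof (subst integral_signed[OF N])
    interpret S: prob_space "signed N" by (rule prob_space_signed[OF N])
    show "integrable (signed N) (\<lambda>p. MAX h\<in>F. c h + 2 * (rsign (snd p) * f h (fst p)))"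
      using integrable_signed[OF N f] by (intro integrable_MAX F) auto
  qed (simp add: rsign_def)
  finally show ?thesis .
qed

text \<open>Of the mean \<open>q\<close> per sample one half may be lost: \<open>width\<close>
  bounds the expected loss by \<open>q / 4\<close>, and the exponential moment of the bounded
  differences controls a further \<open>q / 4\<close>. The cardinality of \<open>F\<close> does not
  enter the bound, which is what later allows exhausting an infinite class.\<close>

theorem uniform_small_ball:
  fixes f :: "'h \<Rightarrow> 'a \<Rightarrow> real" and m :: nat and M q :: real
  assumes N: "prob_space N" and F: "finite F" "F \<noteq> {}"
    and f: "\<And>h. h \<in> F \<Longrightarrow> integrable N (f h)" and M: "M > 0" and q: "q > 0"
    and small: "\<And>h. h \<in> F \<Longrightarrow> q \<le> (\<integral>x. min \<bar>f h x\<bar> M \<partial>N)"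
    and width: "(\<integral>p. (MAX h\<in>F. (\<Sum>i<m. 2 * (rsign (snd (p i)) * f h (fst (p i))))) \<partial>iid m (signed N)) \<le> m * q / 4"
  shows "measure (iid m N) {x \<in> space (iid m N). \<exists>h\<in>F. (\<Sum>i<m. min \<bar>f h (x i)\<bar> M) < m * q / 2}
    \<le> exp (- (q\<^sup>2 / (8 * M\<^sup>2)) * m)"
proof -
  interpret N: prob_space N by fact
  let ?P = "iid m N"
  interpret P: prob_space ?P by (intro prob_space_PiM N)
  define \<phi> where "\<phi> t = min \<bar>t\<bar> M" for t
  have fm [measurable]: "f h \<in> borel_measurable N" if "h \<in> F" for h using f[OF that] by auto
  have \<phi>f: "integrable N (\<lambda>x. \<phi> (f h x))" if "h \<in> F" for h
    using M fm[OF that] unfolding \<phi>_def by (intro N.integrable_const_bound[where B=M]) auto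
  define g where "g h x = (\<integral>y. \<phi> (f h y) \<partial>N) - \<phi> (f h x)" for h x
  have gm: "g h \<in> borel_measurable N" if "h \<in> F" for h
    unfolding g_def \<phi>_def using fm[OF that] by measurable
  have gi: "integrable N (g h)" if "h \<in> F" for h unfolding g_def using \<phi>f[OF that] by auto
  let ?\<Phi> = "\<lambda>x. MAX h\<in>F. (\<Sum>i<m. g h (x i))"
  have Phi_m: "?\<Phi> \<in> borel_measurable ?P"
    using integrable_MAX_sum_PiM[OF N F gi, where c="\<lambda>_. 0" and m=m] by auto
  have "(\<integral>x. ?\<Phi> x \<partial>?P) \<le> (\<integral>p. (MAX h\<in>F. (\<Sum>i<m. 2 * (rsign (snd (p i)) * f h (fst (p i))))) \<partial>iid m (signed N))"
    using product_MAX_compare[OF N prob_space_signed[OF N] F gi, where g="\<lambda>h p. 2 * (rsign (snd p) * f h (fst p))" and c="\<lambda>_. 0" and m=m]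
      symmetrization_contraction_step[OF N F f \<phi>f] integrable_signed[OF N f]
    unfolding g_def \<phi>_def by (auto simp: min_def abs_if)
  then have L: "(\<integral>x. ?\<Phi> x \<partial>?P) \<le> m * q / 4" using width by simp
  \<comment> \<open>Minimises the exponent per sample,
    \<open>- \<theta> * q / 4 + \<theta>\<^sup>2 * M\<^sup>2 / 8\<close>.\<close>
  define \<theta> where "\<theta> = q / M\<^sup>2"
  have \<theta>: "\<theta> > 0" using q M by (simp add: \<theta>_def)
  have "(\<integral>\<^sup>+x. ennreal (exp (\<theta> * ?\<Phi> x)) \<partial>?P) \<le> ennreal (exp (\<theta> * (\<integral>x. ?\<Phi> x \<partial>?P) + \<theta>\<^sup>2 * M\<^sup>2 / 8 * m))"
    using exp_moment_MAX_sum[OF N F gm _ \<theta>, where M=M and l="\<lambda>h. (\<integral>y. \<phi> (f h y) \<partial>N) - M" and c="\<lambda>_. 0" and m=m] M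
    unfolding g_def \<phi>_def by auto
  also have "\<dots> \<le> ennreal (exp (\<theta> * (m * q / 4) + \<theta>\<^sup>2 * M\<^sup>2 / 8 * m))"
    using L \<theta> by (intro ennreal_leI) (auto intro!: mult_left_mono)
  finally have E: "(\<integral>\<^sup>+x. ennreal (exp (\<theta> * ?\<Phi> x)) \<partial>?P) \<le> ennreal (exp (\<theta> * (m * q / 4) + \<theta>\<^sup>2 * M\<^sup>2 / 8 * m))" .
  let ?B = "{x \<in> space ?P. \<exists>h\<in>F. (\<Sum>i<m. min \<bar>f h (x i)\<bar> M) < m * q / 2}"
  let ?c = "ennreal (exp (- (\<theta> * (m * q / 2))))"
  let ?B' = "{x \<in> space ?P. 1 \<le> ?c * ennreal (exp (\<theta> * ?\<Phi> x))}"
  have um: "(\<lambda>x. ennreal (exp (\<theta> * ?\<Phi> x))) \<in> borel_measurable ?P" using Phi_m by measurable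
  have BB: "?B \<subseteq> ?B'"
  proof
    fix x assume x: "x \<in> ?B"
    then obtain h where h: "h \<in> F" and *: "(\<Sum>i<m. min \<bar>f h (x i)\<bar> M) < m * q / 2" by blast
    have "m * q / 2 \<le> m * q - (\<Sum>i<m. \<phi> (f h (x i)))" using * unfolding \<phi>_def by argo
    also have "\<dots> \<le> (\<Sum>i<m. g h (x i))"
      using small[OF h] unfolding g_def by (simp add: sum_subtractf \<phi>_def mult_left_mono)
    also have "\<dots> \<le> ?\<Phi> x" using MAX_ge[OF F(1) h, of "\<lambda>h. \<Sum>i<m. g h (x i)"] .
    finally have "\<theta> * (m * q / 2) \<le> \<theta> * ?\<Phi> x" using \<theta> by (intro mult_left_mono) auto
    then have "1 \<le> exp (- (\<theta> * (m * q / 2))) * exp (\<theta> * ?\<Phi> x)" by (simp add: exp_add[symmetric])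
    then have "1 \<le> ?c * ennreal (exp (\<theta> * ?\<Phi> x))"
      by (simp add: ennreal_mult'[symmetric])
    then show "x \<in> ?B'" using x by blast
  qed
  have "emeasure ?P ?B' \<le> ?c * (\<integral>\<^sup>+x. ennreal (exp (\<theta> * ?\<Phi> x)) * indicator (space ?P) x \<partial>?P)"
    using um by (intro nn_integral_Markov_inequality) auto
  also have "\<dots> = ?c * (\<integral>\<^sup>+x. ennreal (exp (\<theta> * ?\<Phi> x)) \<partial>?P)"
    by (intro arg_cong2[where f="(*)"] nn_integral_cong) auto
  also have "\<dots> \<le> ?c * ennreal (exp (\<theta> * (m * q / 4) + \<theta>\<^sup>2 * M\<^sup>2 / 8 * m))"
    by (intro mult_left_mono E) auto
  also have "\<dots> = ennreal (exp (- (\<theta> * (m * q / 2)) + (\<theta> * (m * q / 4) + \<theta>\<^sup>2 * M\<^sup>2 / 8 * m)))"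
    by (simp add: ennreal_mult'[symmetric] exp_add[symmetric])
  also have "- (\<theta> * (m * q / 2)) + (\<theta> * (m * q / 4) + \<theta>\<^sup>2 * M\<^sup>2 / 8 * m) = - (q\<^sup>2 / (8 * M\<^sup>2)) * m"
    using M by (simp add: \<theta>_def field_simps power2_eq_square)
  finally have "emeasure ?P ?B' \<le> ennreal (exp (- (q\<^sup>2 / (8 * M\<^sup>2)) * m))" .
  then have "measure ?P ?B' \<le> exp (- (q\<^sup>2 / (8 * M\<^sup>2)) * m)"
    unfolding P.emeasure_eq_measure by (simp add: ennreal_le_iff)
  moreover have "?B' \<in> sets ?P" using um by measurable
  then have "measure ?P ?B \<le> measure ?P ?B'"
    using BB by (intro P.finite_measure_mono)
  ultimately show ?thesis by linarith
qed

section \<open>Sub-Gaussian linear forms\<close>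

lemma exp_le_second_order: "exp (y::real) \<le> 1 + y + y\<^sup>2 * exp \<bar>y\<bar> / 2"
proof -
  obtain t where t: "\<bar>t\<bar> \<le> \<bar>y\<bar>" "exp y = (\<Sum>m<2. y ^ m / fact m) + exp t / fact 2 * y ^ 2"
    using Maclaurin_exp_le[of y 2] by blast
  have "exp t * y\<^sup>2 \<le> exp \<bar>y\<bar> * y\<^sup>2" using t by (intro mult_right_mono) auto
  then show ?thesis using t(2) by (simp add: numeral_2_eq_2 mult.commute)
qed

lemma power_le_fact_exp: "0 \<le> (x::real) \<Longrightarrow> x ^ n \<le> fact n * exp x"
proof -
  assume x: "0 \<le> x"
  have "x ^ n /\<^sub>R fact n \<le> exp x"
    using sum_le_suminf[OF summable_exp_generic, of "{n}" x] x by (simp add: exp_def)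
  then show ?thesis by (simp add: field_simps)
qed

text \<open>Absorbs the second-order Taylor remainder into the function whose integral the
  sub-Gaussian condition bounds. Half of the exponent pays for \<open>u\<^sup>2\<close>, the other
  half for \<open>exp \<bar>u\<bar>\<close>.\<close>

lemma square_exp_le: "(u::real)\<^sup>2 * exp \<bar>u\<bar> \<le> 4 * exp (u\<^sup>2)"
proof -
  have 1: "u\<^sup>2 \<le> 2 * exp (u\<^sup>2 / 2)"
    using exp_ge_add_one_self[of "u\<^sup>2 / 2"] by linarith
  have "0 \<le> (\<bar>u\<bar> - 1)\<^sup>2" by simp
  then have "\<bar>u\<bar> \<le> u\<^sup>2 / 2 + 1 / 2" by (simp add: power2_diff)
  then have "exp \<bar>u\<bar> \<le> exp (u\<^sup>2 / 2) * exp (1 / 2)" by (simp add: exp_add[symmetric])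
  also have "exp (1 / 2 :: real) \<le> 2" 
    using exp_half_le2 by simp
  finally have 2: "exp \<bar>u\<bar> \<le> exp (u\<^sup>2 / 2) * 2" by simp
  have "u\<^sup>2 * exp \<bar>u\<bar> \<le> (2 * exp (u\<^sup>2 / 2)) * (exp (u\<^sup>2 / 2) * 2)"
    using 1 2 by (intro mult_mono) auto
  also have "\<dots> = 4 * exp (u\<^sup>2)" by (simp add: exp_add[symmetric])
  finally show ?thesis .
qed

text \<open>Two regimes. For small \<theta> the vanishing mean removes the linear Taylor term,
  leaving a quadratic one. For large \<theta> the inequality \<open>2 * (\<theta> * t) \<le>
  \<theta>\<^sup>2 * K\<^sup>2 + t\<^sup>2 / K\<^sup>2\<close> suffices, and the constant 2 of the
  sub-Gaussian condition is absorbed because \<open>\<theta>\<^sup>2 * K\<^sup>2\<close> is at least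
  1.\<close>

lemma subgaussian_mgf:
  fixes D :: "real measure"
  assumes D: "prob_space D" "sets D = sets borel" and K: "K > 0"
    and e: "(\<integral>\<^sup>+ t. ennreal (exp (t\<^sup>2 / K\<^sup>2)) \<partial>D) \<le> 2"
    and m: "integrable D (\<lambda>t. t)" "(\<integral> t. t \<partial>D) = 0"
  shows "(\<integral>\<^sup>+ t. ennreal (exp (\<theta> * t)) \<partial>D) \<le> ennreal (exp (4 * K\<^sup>2 * \<theta>\<^sup>2))"
proof -
  interpret prob_space D by fact
  note [measurable_cong] = D(2)
  have ei: "integrable D (\<lambda>t. exp (t\<^sup>2 / K\<^sup>2))"
    using e by (intro integrableI_nonneg) (auto intro: le_less_trans[OF e])
  have e2: "(\<integral>t. exp (t\<^sup>2 / K\<^sup>2) \<partial>D) \<le> 2"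
    using e nn_integral_eq_integral[OF ei] by (simp add: ennreal_le_iff[of 2, simplified])
  show ?thesis
  proof (cases "\<bar>\<theta>\<bar> * K \<le> 1")
    case True
    have pw: "exp (\<theta> * t) \<le> 1 + \<theta> * t + 2 * \<theta>\<^sup>2 * K\<^sup>2 * exp (t\<^sup>2 / K\<^sup>2)" for t
    proof -
      have "\<bar>\<theta>\<bar> \<le> 1 / K" using True K by (simp add: field_simps)
      then have "\<bar>\<theta> * t\<bar> \<le> \<bar>t / K\<bar>" using K mult_right_mono[of "\<bar>\<theta>\<bar>" "1 / K" "\<bar>t\<bar>"] by (simp add: abs_mult)
      then have "(\<theta> * t)\<^sup>2 * exp \<bar>\<theta> * t\<bar> \<le> (\<theta> * t)\<^sup>2 * exp \<bar>t / K\<bar>" by (intro mult_left_mono) auto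
      also have "\<dots> = \<theta>\<^sup>2 * K\<^sup>2 * ((t / K)\<^sup>2 * exp \<bar>t / K\<bar>)" using K by (simp add: field_simps)
      also have "\<dots> \<le> \<theta>\<^sup>2 * K\<^sup>2 * (4 * exp ((t / K)\<^sup>2))" by (intro mult_left_mono square_exp_le) auto
      finally show ?thesis using exp_le_second_order[of "\<theta> * t"] by (simp add: power_divide algebra_simps)
    qed
    have i: "integrable D (\<lambda>t. 1 + \<theta> * t + 2 * \<theta>\<^sup>2 * K\<^sup>2 * exp (t\<^sup>2 / K\<^sup>2))" using ei m by auto
    have "(\<integral>\<^sup>+ t. ennreal (exp (\<theta> * t)) \<partial>D) \<le> (\<integral>\<^sup>+ t. ennreal (1 + \<theta> * t + 2 * \<theta>\<^sup>2 * K\<^sup>2 * exp (t\<^sup>2 / K\<^sup>2)) \<partial>D)"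
      by (intro nn_integral_mono ennreal_leI pw)
    also have "\<dots> = ennreal (\<integral>t. 1 + \<theta> * t + 2 * \<theta>\<^sup>2 * K\<^sup>2 * exp (t\<^sup>2 / K\<^sup>2) \<partial>D)"
      using i by (rule nn_integral_eq_integral) (use pw exp_ge_zero order_trans in blast)
    also have "(\<integral>t. 1 + \<theta> * t + 2 * \<theta>\<^sup>2 * K\<^sup>2 * exp (t\<^sup>2 / K\<^sup>2) \<partial>D) = 1 + 2 * \<theta>\<^sup>2 * K\<^sup>2 * (\<integral>t. exp (t\<^sup>2 / K\<^sup>2) \<partial>D)"
      using ei m by (simp add: prob_space)
    also have "ennreal \<dots> \<le> ennreal (1 + 2 * \<theta>\<^sup>2 * K\<^sup>2 * 2)"
      by (intro ennreal_leI add_left_mono mult_left_mono e2) auto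
    also have "\<dots> \<le> ennreal (exp (4 * K\<^sup>2 * \<theta>\<^sup>2))"
      using exp_ge_add_one_self[of "4 * K\<^sup>2 * \<theta>\<^sup>2"] by (intro ennreal_leI) (simp add: algebra_simps)
    finally show ?thesis .
  next
    case False
    then have 1: "1 \<le> \<theta>\<^sup>2 * K\<^sup>2"
      using one_le_power[of "\<bar>\<theta>\<bar> * K" 2] by (simp add: power_mult_distrib)
    have pw: "exp (\<theta> * t) \<le> exp (\<theta>\<^sup>2 * K\<^sup>2) * exp (t\<^sup>2 / K\<^sup>2)" for t
    proof -
      have "0 \<le> (\<theta> * K - t / K)\<^sup>2" by simp
      then have "2 * (\<theta> * t) \<le> \<theta>\<^sup>2 * K\<^sup>2 + t\<^sup>2 / K\<^sup>2"
        using K by (simp add: power2_diff power_mult_distrib power_divide)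
      moreover have "0 \<le> \<theta>\<^sup>2 * K\<^sup>2" "0 \<le> t\<^sup>2 / K\<^sup>2" by auto
      ultimately have "\<theta> * t \<le> \<theta>\<^sup>2 * K\<^sup>2 + t\<^sup>2 / K\<^sup>2" by linarith
      then show ?thesis by (simp add: exp_add[symmetric])
    qed
    have "(\<integral>\<^sup>+ t. ennreal (exp (\<theta> * t)) \<partial>D) \<le> (\<integral>\<^sup>+ t. ennreal (exp (\<theta>\<^sup>2 * K\<^sup>2)) * ennreal (exp (t\<^sup>2 / K\<^sup>2)) \<partial>D)"
      using pw by (intro nn_integral_mono) (auto simp: ennreal_mult'[symmetric] intro!: ennreal_leI)
    also have "\<dots> = ennreal (exp (\<theta>\<^sup>2 * K\<^sup>2)) * (\<integral>\<^sup>+ t. ennreal (exp (t\<^sup>2 / K\<^sup>2)) \<partial>D)"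
      by (intro nn_integral_cmult) auto
    also have "\<dots> \<le> ennreal (exp (\<theta>\<^sup>2 * K\<^sup>2)) * 2" by (intro mult_left_mono e) auto
    also have "\<dots> = ennreal (exp (\<theta>\<^sup>2 * K\<^sup>2) * 2)" by (simp add: ennreal_mult)
    also have "\<dots> \<le> ennreal (exp (\<theta>\<^sup>2 * K\<^sup>2) * exp (\<theta>\<^sup>2 * K\<^sup>2))"
      using order_trans[OF _ exp_ge_add_one_self, of 2 "\<theta>\<^sup>2 * K\<^sup>2"] 1 by (intro ennreal_leI mult_left_mono) auto
    also have "\<dots> \<le> ennreal (exp (4 * K\<^sup>2 * \<theta>\<^sup>2))"
      by (intro ennreal_leI) (simp add: exp_add[symmetric])
    finally show ?thesis .
  qed
qed

definition dotp :: "nat \<Rightarrow> (nat \<Rightarrow> real) \<Rightarrow> (nat \<Rightarrow> real) \<Rightarrow> real" where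
  "dotp n u v = (\<Sum>j<n. u j * v j)"

lemma subgaussian_linear_form_mgf:
  fixes D :: "real measure"
  assumes D: "prob_space D" "sets D = sets borel"
    and mgf: "\<And>\<theta>. (\<integral>\<^sup>+ t. ennreal (exp (\<theta> * t)) \<partial>D) \<le> ennreal (exp (c * \<theta>\<^sup>2))"
  shows "(\<integral>\<^sup>+ a. ennreal (exp (\<theta> * dotp n w a)) \<partial>iid n D) \<le> ennreal (exp (c * \<theta>\<^sup>2 * dotp n w w))"
proof -
  interpret prob_space D by fact
  interpret S: product_sigma_finite "\<lambda>_::nat. D" ..
  note [measurable_cong] = D(2)
  have "(\<integral>\<^sup>+ a. ennreal (exp (\<theta> * dotp n w a)) \<partial>iid n D)
      = (\<integral>\<^sup>+ a. (\<Prod>j<n. ennreal (exp (\<theta> * w j * a j))) \<partial>iid n D)"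
    by (simp add: dotp_def sum_distrib_left exp_sum prod_ennreal mult.assoc)
  also have "\<dots> = (\<Prod>j<n. \<integral>\<^sup>+ t. ennreal (exp (\<theta> * w j * t)) \<partial>D)"
    by (rule S.product_nn_integral_prod) auto
  also have "\<dots> \<le> (\<Prod>j<n. ennreal (exp (c * (\<theta> * w j)\<^sup>2)))"
    by (intro prod_mono_ennreal mgf)
  also have "\<dots> = ennreal (exp (c * \<theta>\<^sup>2 * dotp n w w))"
    by (simp add: prod_ennreal exp_sum[symmetric] dotp_def sum_distrib_left power2_eq_square mult_ac)
  finally show ?thesis .
qed

text \<open>Turns the factorial of 2p in the even moments into two factorials of p: the exponential
  series divides by one of them, and \<open>p ^ p\<close> dominates the other.\<close>

lemma central_binomial_fact_le: "(fact (2 * p) :: real) \<le> 4 ^ p * (fact p * fact p)"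
proof -
  have "real ((2 * p) choose p) \<le> 2 ^ (2 * p)"
    using binomial_le_pow2[of "2 * p" p] by (metis of_nat_le_iff of_nat_numeral of_nat_power)
  moreover have "real ((2 * p) choose p) = fact (2 * p) / (fact p * fact p)"
    using binomial_fact[of p "2 * p", where 'a=real] by simp
  ultimately have "fact (2 * p) / (fact p * fact p) \<le> (4 :: real) ^ p" by (simp add: power_mult)
  then show ?thesis by (simp add: divide_le_eq)
qed

lemma even_moment_bound:
  fixes Y :: "'a \<Rightarrow> real"
  assumes Y: "Y \<in> borel_measurable N" and c: "c > 0" and p: "p > 0"
    and mgf: "\<And>\<theta>. (\<integral>\<^sup>+ x. ennreal (exp (\<theta> * Y x)) \<partial>N) \<le> ennreal (exp (c * \<theta>\<^sup>2))"
  shows "(\<integral>\<^sup>+ x. ennreal (Y x ^ (2 * p)) \<partial>N) \<le> ennreal (2 * fact (2 * p) * (c * exp 1 / p) ^ p)"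
proof -
  note [measurable] = Y
  \<comment> \<open>Minimises \<open>exp (c * \<theta>\<^sup>2) / \<theta> ^ (2 * p)\<close>, the
    factor that results from estimating the power of \<open>\<theta> * Y\<close> by an
    exponential.\<close>
  define \<theta> where "\<theta> = sqrt (p / c)"
  have \<theta>: "\<theta>\<^sup>2 = p / c" "\<theta> > 0" using c p by (auto simp: \<theta>_def)
  define A where "A = fact (2 * p) * (c / p) ^ p"
  have A: "A \<ge> 0" using c p by (simp add: A_def)
  have pw: "Y x ^ (2 * p) \<le> A * (exp (\<theta> * Y x) + exp (- \<theta> * Y x))" for x
  proof -
    have "\<bar>\<theta> * Y x\<bar> ^ (2 * p) \<le> fact (2 * p) * exp \<bar>\<theta> * Y x\<bar>" by (rule power_le_fact_exp) simp
    also have "\<dots> \<le> fact (2 * p) * (exp (\<theta> * Y x) + exp (- \<theta> * Y x))"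
      by (intro mult_left_mono) (auto simp: abs_if add_increasing add_increasing2)
    finally have "(p / c) ^ p * Y x ^ (2 * p) \<le> fact (2 * p) * (exp (\<theta> * Y x) + exp (- \<theta> * Y x))"
      unfolding power_even_abs[OF even_mult_iff[THEN iffD2, OF disjI1, OF even_numeral]] power_mult_distrib
      by (simp only: power_mult \<theta>(1))
    then show ?thesis using c p by (simp add: A_def field_simps)
  qed
  have "(\<integral>\<^sup>+ x. ennreal (Y x ^ (2 * p)) \<partial>N) \<le> (\<integral>\<^sup>+ x. ennreal A * (ennreal (exp (\<theta> * Y x)) + ennreal (exp (- \<theta> * Y x))) \<partial>N)"
    using pw A by (intro nn_integral_mono)
      (simp add: ennreal_plus[symmetric] ennreal_mult'[symmetric] ennreal_leI del: ennreal_plus)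
  also have "\<dots> = ennreal A * ((\<integral>\<^sup>+ x. ennreal (exp (\<theta> * Y x)) \<partial>N) + (\<integral>\<^sup>+ x. ennreal (exp (- \<theta> * Y x)) \<partial>N))"
    by (simp add: nn_integral_cmult nn_integral_add)
  also have "\<dots> \<le> ennreal A * (ennreal (exp (c * \<theta>\<^sup>2)) + ennreal (exp (c * (- \<theta>)\<^sup>2)))"
    by (intro mult_left_mono add_mono mgf) auto
  also have "\<dots> = ennreal (A * (2 * exp p))"
    using A \<theta>(1) c by (simp add: ennreal_plus[symmetric] ennreal_mult'[symmetric] del: ennreal_plus)
  also have "A * (2 * exp p) = 2 * fact (2 * p) * (c * exp 1 / p) ^ p"
    by (simp add: A_def power_divide power_mult_distrib exp_of_nat_mult[of p 1, simplified])
  finally show ?thesis .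
qed

text \<open>The exponential is expanded and its terms are bounded by even moments. The scale 8 c e
  makes the term of order p at most 2 / 2^p, and these sum to 4. The term p = 0 is separate because
  the moment bound divides by p.\<close>

lemma square_exp_integrable:
  fixes Y :: "'a \<Rightarrow> real"
  assumes N: "prob_space N" and Y: "Y \<in> borel_measurable N" and c: "c > 0"
    and mgf: "\<And>\<theta>. (\<integral>\<^sup>+ x. ennreal (exp (\<theta> * Y x)) \<partial>N) \<le> ennreal (exp (c * \<theta>\<^sup>2))"
  shows "(\<integral>\<^sup>+ x. ennreal (exp ((Y x)\<^sup>2 / (8 * c * exp 1))) \<partial>N) \<le> 4"
proof -
  interpret prob_space N by fact
  note [measurable] = Y
  define s where "s = 1 / (8 * c * exp 1)"
  have s: "s > 0" using c by (simp add: s_def)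
  have summand: "(\<integral>\<^sup>+ x. ennreal ((s * (Y x)\<^sup>2) ^ p /\<^sub>R fact p) \<partial>N) \<le> ennreal (2 * (1 / 2) ^ p)" for p
  proof (cases "p = 0")
    case True then show ?thesis by (simp add: emeasure_space_1)
  next
    case False
    then have p: "p > 0" by simp
    have "(\<integral>\<^sup>+ x. ennreal ((s * (Y x)\<^sup>2) ^ p /\<^sub>R fact p) \<partial>N) = (\<integral>\<^sup>+ x. ennreal (s ^ p / fact p) * ennreal (Y x ^ (2 * p)) \<partial>N)"
      using s by (intro nn_integral_cong) (simp add: ennreal_mult'[symmetric] power_mult_distrib field_simps flip: power_mult)
    also have "\<dots> = ennreal (s ^ p / fact p) * (\<integral>\<^sup>+ x. ennreal (Y x ^ (2 * p)) \<partial>N)"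
      by (intro nn_integral_cmult) auto
    also have "\<dots> \<le> ennreal (s ^ p / fact p) * ennreal (2 * fact (2 * p) * (c * exp 1 / p) ^ p)"
      by (intro mult_left_mono even_moment_bound Y c p mgf) auto
    also have "\<dots> = ennreal (s ^ p / fact p * (2 * fact (2 * p) * (c * exp 1 / p) ^ p))"
      using s by (simp add: ennreal_mult'[symmetric])
    also have "\<dots> \<le> ennreal (2 * (1 / 2) ^ p)"
    proof (rule ennreal_leI)
      have "s ^ p / fact p * (2 * fact (2 * p) * (c * exp 1 / p) ^ p)
          \<le> s ^ p / fact p * (2 * (4 ^ p * (fact p * fact p)) * (c * exp 1 / p) ^ p)"
        using s c by (intro mult_left_mono mult_right_mono central_binomial_fact_le) auto
      also have "\<dots> = 2 * (4 * s * c * exp 1) ^ p * (fact p / p ^ p)"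
        by (simp add: power_mult_distrib power_divide)
      also have "\<dots> \<le> 2 * (4 * s * c * exp 1) ^ p * 1"
        using s c p fact_le_power[of p, where 'a=real]
        by (intro mult_left_mono) auto
      also have "4 * s * c * exp 1 = 1 / 2" using c by (simp add: s_def)
      finally show "s ^ p / fact p * (2 * fact (2 * p) * (c * exp 1 / p) ^ p) \<le> 2 * (1 / 2) ^ p" by simp
    qed
    finally show ?thesis .
  qed
  have "(\<integral>\<^sup>+ x. ennreal (exp (s * (Y x)\<^sup>2)) \<partial>N) = (\<integral>\<^sup>+ x. (\<Sum>p. ennreal ((s * (Y x)\<^sup>2) ^ p /\<^sub>R fact p)) \<partial>N)"
    unfolding exp_def using s
    by (intro nn_integral_cong suminf_ennreal2[symmetric] summable_exp_generic) auto
  also have "\<dots> = (\<Sum>p. \<integral>\<^sup>+ x. ennreal ((s * (Y x)\<^sup>2) ^ p /\<^sub>R fact p) \<partial>N)"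
    by (intro nn_integral_suminf) auto
  also have "\<dots> \<le> (\<Sum>p. ennreal (2 * (1 / 2) ^ p))"
    by (intro suminf_le summand) auto
  also have "\<dots> = ennreal (\<Sum>p. 2 * (1 / 2) ^ p)"
    by (intro suminf_ennreal2) (auto intro!: summable_mult summable_geometric)
  also have "(\<Sum>p. 2 * (1 / 2 :: real) ^ p) = 4"
    by (subst suminf_mult) (auto intro!: summable_geometric simp: suminf_geometric)
  finally show ?thesis by (simp add: s_def)
qed

text \<open>The random sign replaces centring: averaging over it cancels the linear terms.
  Restricting \<open>s\<close> to half of \<open>s0\<close> leaves the other half of the available
  exponential moment to absorb the quadratic factor.\<close>

lemma signed_mgf:
  fixes f :: "'a \<Rightarrow> real"
  assumes N: "prob_space N" and f: "f \<in> borel_measurable N" and s0: "s0 > 0"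
    and e: "(\<integral>\<^sup>+ x. ennreal (exp (s0 * \<bar>f x\<bar>)) \<partial>N) \<le> 4" and s: "\<bar>s\<bar> \<le> s0 / 2"
  shows "(\<integral>\<^sup>+ p. ennreal (exp (s * (rsign (snd p) * f (fst p)))) \<partial>signed N) \<le> ennreal (exp (16 * s\<^sup>2 / s0\<^sup>2))"
proof -
  interpret prob_space N by fact
  note [measurable] = f
  have m: "(\<lambda>p. ennreal (exp (s * (rsign (snd p) * f (fst p))))) \<in> borel_measurable (signed N)"
    unfolding signed_def by measurable
  have pw: "(exp (s * f x) + exp (- (s * f x))) / 2 \<le> 1 + 4 * s\<^sup>2 / s0\<^sup>2 * exp (s0 * \<bar>f x\<bar>)" for x
  proof -
    define y where "y = s * f x"
    define z where "z = s0 * \<bar>f x\<bar>"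
    have z: "z \<ge> 0" using s0 by (simp add: z_def)
    have yz: "\<bar>y\<bar> \<le> z / 2" using mult_right_mono[OF s, of "\<bar>f x\<bar>"] by (simp add: y_def z_def abs_mult)
    have "(exp y + exp (- y)) / 2 \<le> 1 + y\<^sup>2 * exp \<bar>y\<bar> / 2"
      using exp_le_second_order[of y] exp_le_second_order[of "- y"] by simp
    also have "y\<^sup>2 * exp \<bar>y\<bar> = s\<^sup>2 / s0\<^sup>2 * (z\<^sup>2 * exp \<bar>y\<bar>)"
      using s0 by (simp add: y_def z_def power_mult_distrib)
    also have "z\<^sup>2 * exp \<bar>y\<bar> \<le> (8 * exp (z / 2)) * exp (z / 2)"
      using power_le_fact_exp[of "z / 2" 2] z yz by (intro mult_mono) (auto simp: power_divide)
    also have "\<dots> = 8 * exp z" by (simp add: exp_add[symmetric])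
    finally show ?thesis by (simp add: y_def z_def mult_left_mono divide_right_mono)
  qed
  have "(\<integral>\<^sup>+ p. ennreal (exp (s * (rsign (snd p) * f (fst p)))) \<partial>signed N)
      = (\<integral>\<^sup>+ x. ennreal ((exp (s * f x) + exp (- (s * f x))) / 2) \<partial>N)"
    unfolding nn_integral_signed[OF N m]
    by (intro nn_integral_cong)
      (simp add: rsign_def ennreal_plus[symmetric] ennreal_mult'[symmetric] add_divide_distrib mult.commute[of _ "ennreal (1/2)"]
        del: ennreal_plus ennreal_half ennreal_divide_numeral)
  also have "\<dots> \<le> (\<integral>\<^sup>+ x. ennreal 1 + ennreal (4 * s\<^sup>2 / s0\<^sup>2) * ennreal (exp (s0 * \<bar>f x\<bar>)) \<partial>N)"
    using pw by (intro nn_integral_mono) (simp add: ennreal_plus[symmetric] ennreal_mult'[symmetric] ennreal_leI del: ennreal_plus ennreal_1)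
  also have "\<dots> = 1 + ennreal (4 * s\<^sup>2 / s0\<^sup>2) * (\<integral>\<^sup>+ x. ennreal (exp (s0 * \<bar>f x\<bar>)) \<partial>N)"
    by (simp add: nn_integral_add nn_integral_cmult emeasure_space_1)
  also have "\<dots> \<le> 1 + ennreal (4 * s\<^sup>2 / s0\<^sup>2) * 4"
    by (intro add_left_mono mult_left_mono e) auto
  also have "\<dots> = ennreal (1 + 16 * s\<^sup>2 / s0\<^sup>2)"
    by (simp add: ennreal_mult'[symmetric] ennreal_plus[symmetric] ennreal_1[symmetric] ennreal_numeral[symmetric] del: ennreal_plus ennreal_1 ennreal_numeral)
  also have "\<dots> \<le> ennreal (exp (16 * s\<^sup>2 / s0\<^sup>2))"
    using exp_ge_add_one_self by (intro ennreal_leI)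
  finally show ?thesis .
qed

section \<open>Moments of quadratic forms\<close>

definition qf :: "nat \<Rightarrow> (nat \<Rightarrow> nat \<Rightarrow> real) \<Rightarrow> (nat \<Rightarrow> real) \<Rightarrow> real" where
  "qf n H a = (\<Sum>j<n. \<Sum>l<n. a j * H j l * a l)"

lemma dotp_upd: "dotp (Suc n) w (x(n := y)) = dotp n w x + w n * y"
  unfolding dotp_def by simp

lemma qf_upd:
  assumes "\<And>j. j < n \<Longrightarrow> H n j = H j n"
  shows "qf (Suc n) H (x(n := y)) = qf n H x + 2 * y * dotp n (\<lambda>j. H j n) x + H n n * y\<^sup>2"
proof -
  have "(\<Sum>l<n. y * H n l * x l) = y * dotp n (\<lambda>j. H j n) x"
    using assms by (simp add: dotp_def sum_distrib_left mult_ac)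
  moreover have "(\<Sum>j<n. x j * H j n * y) = y * dotp n (\<lambda>j. H j n) x"
    by (simp add: dotp_def sum_distrib_left mult_ac)
  ultimately show ?thesis
    by (simp add: qf_def sum.distrib power2_eq_square)
qed

locale entry_law =
  fixes D :: "real measure"
  assumes prob: "prob_space D" and sets_D [measurable_cong]: "sets D = sets borel"
    and i1: "integrable D (\<lambda>t. t)" and m1: "(\<integral>t. t \<partial>D) = 0"
    and i2: "integrable D (\<lambda>t. t\<^sup>2)" and m2: "(\<integral>t. t\<^sup>2 \<partial>D) = 1"
    and i4: "integrable D (\<lambda>t. t ^ 4)"
begin

abbreviation N :: "nat \<Rightarrow> (nat \<Rightarrow> real) measure" where
  "N n \<equiv> iid n D"

lemma prob_N: "prob_space (N n)"
  by (intro prob_space_PiM prob)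

lemma i3: "integrable D (\<lambda>t. t ^ 3)"
proof (rule Bochner_Integration.integrable_bound)
  show "integrable D (\<lambda>t. t\<^sup>2 + t ^ 4)" using i2 i4 by auto
  have "\<bar>t ^ 3\<bar> \<le> t\<^sup>2 + t ^ 4" for t :: real
  proof -
    have "0 \<le> (\<bar>t\<bar> - 1)\<^sup>2" by simp
    then have "\<bar>t\<bar> \<le> 1 + t\<^sup>2" by (simp add: power2_diff)
    then have "\<bar>t\<bar> * t\<^sup>2 \<le> (1 + t\<^sup>2) * t\<^sup>2" by (rule mult_right_mono) simp
    then show ?thesis by (simp add: abs_mult power2_eq_square power3_eq_cube power4_eq_xxxx algebra_simps)
  qed
  then show "AE t in D. norm (t ^ 3) \<le> norm (t\<^sup>2 + t ^ 4)" by (auto simp: order_trans)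
qed measurable

lemma integrable_coord:
  assumes "j < n"
  shows "integrable (N n) (\<lambda>a. a j)" "integrable (N n) (\<lambda>a. (a j)\<^sup>2)" "integrable (N n) (\<lambda>a. (a j) ^ 4)"
  using assms i1 i2 i4 integrable_PiM_component(1)[of "{..<n}" "\<lambda>_. D" j] prob by auto

lemma integrable_coord2:
  assumes "j < n" "l < n"
  shows "integrable (N n) (\<lambda>a. a j * a l)"
proof (rule Bochner_Integration.integrable_bound)
  show "integrable (N n) (\<lambda>a. (a j)\<^sup>2 + (a l)\<^sup>2)" using assms integrable_coord by auto
  have "\<bar>s * t\<bar> \<le> \<bar>s\<^sup>2 + t\<^sup>2\<bar>" for s t :: real
  proof -
    have "2 * \<bar>s * t\<bar> \<le> s\<^sup>2 + t\<^sup>2" using sum_squares_bound[of "\<bar>s\<bar>" "\<bar>t\<bar>"] by (simp add: abs_mult)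
    then show ?thesis by linarith
  qed
  then show "AE a in N n. norm (a j * a l) \<le> norm ((a j)\<^sup>2 + (a l)\<^sup>2)" by auto
next
  show "(\<lambda>a. a j * a l) \<in> borel_measurable (N n)"
    using assms integrable_coord(1)[THEN borel_measurable_integrable] by (intro borel_measurable_times) auto
qed

lemma measurable_dotp [measurable]: "dotp n w \<in> borel_measurable (N n)"
  unfolding dotp_def by measurable

lemma measurable_qf [measurable]: "qf n H \<in> borel_measurable (N n)"
  unfolding qf_def by measurable

lemma integrable_qf: "integrable (N n) (qf n H)"
proof -
  have "integrable (N n) (\<lambda>a. \<Sum>j<n. \<Sum>l<n. H j l * (a j * a l))"
    by (intro Bochner_Integration.integrable_sum integrable_mult_right) (auto intro!: integrable_coord2)
  then show ?thesis by (simp add: qf_def[abs_def] mult_ac)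
qed

lemma integrable_dotp: "integrable (N n) (dotp n w)"
  unfolding dotp_def[abs_def]
  by (intro Bochner_Integration.integrable_sum integrable_mult_right) (auto intro!: integrable_coord)

lemma integrable_dotp2: "integrable (N n) (\<lambda>a. (dotp n w a)\<^sup>2)"
proof -
  have "(\<lambda>a. (dotp n w a)\<^sup>2) = qf n (\<lambda>i j. w i * w j)"
    by (simp add: fun_eq_iff dotp_def qf_def power2_eq_square sum_product mult_ac)
  then show ?thesis using integrable_qf by simp
qed

lemma integrable_qf2: "integrable (N n) (\<lambda>a. (qf n H a)\<^sup>2)"
proof (rule Bochner_Integration.integrable_bound)
  define B where "B = (\<Sum>j<n. \<Sum>l<n. \<bar>H j l\<bar>)"
  show "integrable (N n) (\<lambda>a. B\<^sup>2 * (real n * (\<Sum>j<n. (a j) ^ 4)))"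
    by (intro integrable_mult_right Bochner_Integration.integrable_sum integrable_coord) auto
  have "(qf n H a)\<^sup>2 \<le> B\<^sup>2 * (real n * (\<Sum>j<n. (a j) ^ 4))" for a
  proof -
    define S where "S = (\<Sum>j<n. (a j)\<^sup>2)"
    have aS: "\<bar>a j * a l\<bar> \<le> S" if "j < n" "l < n" for j l
    proof -
      have "(a j)\<^sup>2 \<le> S" "(a l)\<^sup>2 \<le> S" unfolding S_def using that by (auto intro!: member_le_sum)
      moreover have "2 * \<bar>a j * a l\<bar> \<le> (a j)\<^sup>2 + (a l)\<^sup>2"
        using sum_squares_bound[of "\<bar>a j\<bar>" "\<bar>a l\<bar>"] by (simp add: abs_mult)
      ultimately show ?thesis by linarith
    qed
    have "\<bar>qf n H a\<bar> \<le> (\<Sum>j<n. \<Sum>l<n. \<bar>H j l\<bar> * S)" unfolding qf_def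
    proof (intro order_trans[OF sum_abs] sum_mono)
      fix j l assume "j \<in> {..<n}" "l \<in> {..<n}"
      then have "\<bar>H j l\<bar> * \<bar>a j * a l\<bar> \<le> \<bar>H j l\<bar> * S" using aS by (intro mult_left_mono) auto
      then show "\<bar>a j * H j l * a l\<bar> \<le> \<bar>H j l\<bar> * S" by (simp add: abs_mult mult_ac)
    qed
    then have "\<bar>qf n H a\<bar> \<le> B * S" by (simp add: B_def sum_distrib_right)
    then have "(qf n H a)\<^sup>2 \<le> (B * S)\<^sup>2" by (rule abs_le_square_iff[THEN iffD1, OF order_trans]) simp
    also have "\<dots> \<le> B\<^sup>2 * (real n * (\<Sum>j<n. (a j) ^ 4))"
      using sum_squared_le_sum_of_squares[of "\<lambda>j. (a j)\<^sup>2" "{..<n}"]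
      by (simp add: power_mult_distrib S_def mult_left_mono mult.commute flip: power_mult)
    finally show ?thesis .
  qed
  then show "AE a in N n. norm ((qf n H a)\<^sup>2) \<le> norm (B\<^sup>2 * (real n * (\<Sum>j<n. (a j) ^ 4)))"
    by (intro AE_I2) (simp add: order_trans[OF _ abs_ge_self])
qed measurable

lemma expectation_dotp: "(\<integral>a. dotp n w a \<partial>N n) = 0"
  unfolding dotp_def using integrable_coord
  by (subst Bochner_Integration.integral_sum)
     (auto simp: integrable_PiM_component(2)[OF prob, where f="\<lambda>t. t"] i1 m1)

lemma expectation_dotp2: "(\<integral>a. (dotp n w a)\<^sup>2 \<partial>N n) = dotp n w w"
proof (induction n)
  case 0
  then show ?case by (simp add: dotp_def)
next
  case (Suc n)
  interpret D: prob_space D by (rule prob)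
  interpret P: prob_space "N n" by (rule prob_N)
  have "(\<integral>y. (dotp n w x + w n * y)\<^sup>2 \<partial>D) = (dotp n w x)\<^sup>2 + (w n)\<^sup>2" for x
  proof -
    have "(\<integral>y. (dotp n w x + w n * y)\<^sup>2 \<partial>D) = (\<integral>y. (dotp n w x)\<^sup>2 + 2 * dotp n w x * w n * y + (w n)\<^sup>2 * y\<^sup>2 \<partial>D)"
      by (simp add: power2_sum power_mult_distrib algebra_simps)
    also have "\<dots> = (dotp n w x)\<^sup>2 + (w n)\<^sup>2" using i1 i2 m1 m2 by (simp add: D.prob_space)
    finally show ?thesis .
  qed
  then have "(\<integral>a. (dotp (Suc n) w a)\<^sup>2 \<partial>N (Suc n)) = (\<integral>x. (dotp n w x)\<^sup>2 + (w n)\<^sup>2 \<partial>N n)"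
    unfolding integral_PiM_Suc'[OF prob integrable_dotp2] dotp_upd by simp
  also have "\<dots> = dotp (Suc n) w w"
    using Suc integrable_dotp2 by (simp add: P.prob_space) (simp add: dotp_def power2_eq_square)
  finally show ?case .
qed

lemma expectation_qf:
  assumes "\<And>i j. i < n \<Longrightarrow> j < n \<Longrightarrow> H i j = H j i"
  shows "(\<integral>a. qf n H a \<partial>N n) = mtrace n H"
  using assms
proof (induction n)
  case 0
  then show ?case by (simp add: qf_def mtrace_def)
next
  case (Suc n)
  interpret D: prob_space D by (rule prob)
  interpret P: prob_space "N n" by (rule prob_N)
  have sym: "\<And>j. j < n \<Longrightarrow> H n j = H j n" using Suc.prems by auto
  have upd: "qf (Suc n) H (x(n := y)) = qf n H x + 2 * y * dotp n (\<lambda>j. H j n) x + H n n * y\<^sup>2" for x y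
    by (rule qf_upd) (rule sym)
  have "(\<integral>a. qf (Suc n) H a \<partial>N (Suc n)) = (\<integral>x. (\<integral>y. qf n H x + 2 * y * dotp n (\<lambda>j. H j n) x + H n n * y\<^sup>2 \<partial>D) \<partial>N n)"
    unfolding integral_PiM_Suc'[OF prob integrable_qf] upd by simp
  also have "\<dots> = (\<integral>x. qf n H x + H n n \<partial>N n)"
    using i1 i2 m1 m2 by (simp add: D.prob_space)
  also have "\<dots> = mtrace (Suc n) H"
    using Suc integrable_qf by (simp add: P.prob_space mtrace_def)
  finally show ?case .
qed

text \<open>Beyond the squared trace, an off-diagonal entry contributes twice its square and a
  diagonal one the fourth moment minus 1 times its square. For random signs, with fourth moment 1, a
  traceless diagonal matrix would be invisible; this is the role of the condition on the fourth
  moment. The third moment drops out because it multiplies the mean of a linear form.\<close>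

lemma second_moment_qf:
  assumes sym: "\<And>i j. i < n \<Longrightarrow> j < n \<Longrightarrow> H i j = H j i"
    and \<kappa>: "\<kappa> \<le> 2" "\<kappa> \<le> (\<integral>t. t ^ 4 \<partial>D) - 1"
  shows "(mtrace n H)\<^sup>2 + \<kappa> * (\<Sum>i<n. \<Sum>j<n. (H i j)\<^sup>2) \<le> (\<integral>a. (qf n H a)\<^sup>2 \<partial>N n)"
  using sym
proof (induction n)
  case 0
  then show ?case by (simp add: qf_def mtrace_def)
next
  case (Suc n)
  interpret D: prob_space D by (rule prob)
  interpret P: prob_space "N n" by (rule prob_N)
  define \<mu>3 \<mu>4 where "\<mu>3 = (\<integral>t. t ^ 3 \<partial>D)" and "\<mu>4 = (\<integral>t. t ^ 4 \<partial>D)"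
  have sym: "\<And>j. j < n \<Longrightarrow> H n j = H j n" using Suc.prems by auto
  have upd: "qf (Suc n) H (x(n := y)) = qf n H x + 2 * y * dotp n (\<lambda>j. H j n) x + H n n * y\<^sup>2" for x y
    by (rule qf_upd) (rule sym)
  define h where "h = (\<lambda>j. H j n)"
  define c where "c = H n n"
  have inner: "(\<integral>y. (qf n H x + 2 * y * dotp n h x + c * y\<^sup>2)\<^sup>2 \<partial>D)
      = (qf n H x)\<^sup>2 + 4 * (dotp n h x)\<^sup>2 + 2 * c * qf n H x + 4 * c * \<mu>3 * dotp n h x + c\<^sup>2 * \<mu>4" for x
  proof -
    let ?Q = "qf n H x" and ?L = "dotp n h x"
    have "(?Q + 2 * y * ?L + c * y\<^sup>2)\<^sup>2
      = ?Q\<^sup>2 + 4 * ?Q * ?L * y + (4 * ?L\<^sup>2 + 2 * c * ?Q) * y\<^sup>2 + 4 * c * ?L * y ^ 3 + c\<^sup>2 * y ^ 4" for y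
      by (simp add: power2_eq_square power3_eq_cube power4_eq_xxxx algebra_simps)
    then have "(\<integral>y. (?Q + 2 * y * ?L + c * y\<^sup>2)\<^sup>2 \<partial>D)
      = (\<integral>y. ?Q\<^sup>2 + 4 * ?Q * ?L * y + (4 * ?L\<^sup>2 + 2 * c * ?Q) * y\<^sup>2 + 4 * c * ?L * y ^ 3 + c\<^sup>2 * y ^ 4 \<partial>D)"
      by simp
    also have "\<dots> = ?Q\<^sup>2 + (4 * ?L\<^sup>2 + 2 * c * ?Q) + 4 * c * ?L * \<mu>3 + c\<^sup>2 * \<mu>4"
      using i1 i2 i3 i4 m1 m2 by (simp add: D.prob_space \<mu>3_def \<mu>4_def)
    finally show ?thesis by simp
  qed
  have "(\<integral>a. (qf (Suc n) H a)\<^sup>2 \<partial>N (Suc n))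
     = (\<integral>x. (qf n H x)\<^sup>2 + 4 * (dotp n h x)\<^sup>2 + 2 * c * qf n H x + 4 * c * \<mu>3 * dotp n h x + c\<^sup>2 * \<mu>4 \<partial>N n)"
    unfolding integral_PiM_Suc'[OF prob integrable_qf2] upd h_def[symmetric] c_def[symmetric] inner by simp
  also have "\<dots> = (\<integral>x. (qf n H x)\<^sup>2 \<partial>N n) + 4 * dotp n h h + 2 * c * mtrace n H + c\<^sup>2 * \<mu>4"
    using Suc.prems integrable_qf integrable_qf2 integrable_dotp integrable_dotp2
    by (simp add: P.prob_space expectation_dotp expectation_dotp2 expectation_qf)
  finally have e: "(\<integral>a. (qf (Suc n) H a)\<^sup>2 \<partial>N (Suc n))
     = (\<integral>x. (qf n H x)\<^sup>2 \<partial>N n) + 4 * dotp n h h + 2 * c * mtrace n H + c\<^sup>2 * \<mu>4" .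
  have IH: "(mtrace n H)\<^sup>2 + \<kappa> * (\<Sum>i<n. \<Sum>j<n. (H i j)\<^sup>2) \<le> (\<integral>a. (qf n H a)\<^sup>2 \<partial>N n)"
    using Suc by auto
  have F: "(\<Sum>i<Suc n. \<Sum>j<Suc n. (H i j)\<^sup>2) = (\<Sum>i<n. \<Sum>j<n. (H i j)\<^sup>2) + 2 * dotp n h h + c\<^sup>2"
    using sym by (simp add: sum.distrib dotp_def h_def c_def power2_eq_square)
  have "\<kappa> * (2 * dotp n h h) \<le> 2 * (2 * dotp n h h)"
    using \<kappa> by (intro mult_right_mono) (auto simp: dotp_def sum_nonneg)
  moreover have "\<kappa> * c\<^sup>2 \<le> (\<mu>4 - 1) * c\<^sup>2" using \<kappa> by (intro mult_right_mono) (auto simp: \<mu>4_def)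
  moreover have "(mtrace (Suc n) H)\<^sup>2 = (mtrace n H)\<^sup>2 + 2 * c * mtrace n H + c\<^sup>2"
    by (simp add: mtrace_def c_def power2_sum)
  ultimately show ?case unfolding e F using IH by (simp add: algebra_simps)
qed

end

section \<open>A net for sparse vectors\<close>

definition bf :: "nat \<Rightarrow> (nat \<Rightarrow> nat \<Rightarrow> real) \<Rightarrow> (nat \<Rightarrow> real) \<Rightarrow> (nat \<Rightarrow> real) \<Rightarrow> real" where
  "bf n W u v = (\<Sum>j<n. \<Sum>l<n. u j * W j l * v l)"

lemma qf_eq_bf: "qf n W u = bf n W u u"
  by (simp add: qf_def bf_def)

lemma bf_linear:
  "bf n W (\<lambda>i. u i + v i) w = bf n W u w + bf n W v w"
  "bf n W (\<lambda>i. u i - v i) w = bf n W u w - bf n W v w"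
  "bf n W (\<lambda>i. c * u i) w = c * bf n W u w"
  "bf n W w (\<lambda>i. u i + v i) = bf n W w u + bf n W w v"
  "bf n W w (\<lambda>i. u i - v i) = bf n W w u - bf n W w v"
  "bf n W w (\<lambda>i. c * u i) = c * bf n W w u"
  by (simp_all add: bf_def algebra_simps sum.distrib sum_subtractf sum_distrib_left)

lemma bf_commute:
  assumes "\<And>i j. i < n \<Longrightarrow> j < n \<Longrightarrow> W i j = W j i"
  shows "bf n W u v = bf n W v u"
  unfolding bf_def by (subst sum.swap) (use assms in \<open>auto intro!: sum.cong simp: mult_ac\<close>)

lemma dotp_linear:
  "dotp n (\<lambda>i. u i + v i) w = dotp n u w + dotp n v w"
  "dotp n (\<lambda>i. u i - v i) w = dotp n u w - dotp n v w"
  "dotp n (\<lambda>i. c * u i) w = c * dotp n u w"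
  "dotp n w (\<lambda>i. u i + v i) = dotp n w u + dotp n w v"
  "dotp n w (\<lambda>i. u i - v i) = dotp n w u - dotp n w v"
  "dotp n w (\<lambda>i. c * u i) = c * dotp n w u"
  by (simp_all add: dotp_def algebra_simps sum.distrib sum_subtractf sum_distrib_left)

lemma dotp_commute: "dotp n u v = dotp n v u"
  by (simp add: dotp_def mult.commute)

lemma dotp_self_nonneg [simp]: "0 \<le> dotp n u u"
  by (simp add: dotp_def sum_nonneg)

lemma square_le_dotp: "i < n \<Longrightarrow> (u i)\<^sup>2 \<le> dotp n u u"
  unfolding dotp_def power2_eq_square by (rule member_le_sum[where f="\<lambda>i. u i * u i"]) auto

lemma dotp_add_le: "dotp n (\<lambda>i. u i + v i) (\<lambda>i. u i + v i) \<le> 2 * dotp n u u + 2 * dotp n v v"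
proof -
  have "0 \<le> dotp n (\<lambda>i. u i - v i) (\<lambda>i. u i - v i)" by simp
  then show ?thesis by (simp add: dotp_linear dotp_commute[of n v u])
qed

text \<open>Sums and differences of vectors supported in \<Omega> stay supported in \<Omega>, so
  polarization passes from the quadratic to the bilinear form without doubling the sparsity.\<close>

lemma bf_polarization_bound:
  assumes sym: "\<And>i j. i < n \<Longrightarrow> j < n \<Longrightarrow> W i j = W j i"
    and b: "\<And>u. (\<forall>i. i \<notin> \<Omega> \<longrightarrow> u i = 0) \<Longrightarrow> \<bar>qf n W u\<bar> \<le> \<beta> * dotp n u u"
    and u: "\<forall>i. i \<notin> \<Omega> \<longrightarrow> u i = 0" and v: "\<forall>i. i \<notin> \<Omega> \<longrightarrow> v i = 0"
  shows "\<bar>bf n W u v\<bar> \<le> \<beta> * (dotp n u u + dotp n v v) / 2"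
proof -
  let ?s = "\<lambda>i. u i + v i" and ?d = "\<lambda>i. u i - v i"
  have "bf n W v u = bf n W u v" using sym by (rule bf_commute)
  then have 1: "4 * bf n W u v = qf n W ?s - qf n W ?d"
    by (simp add: qf_eq_bf bf_linear)
  have 2: "\<bar>qf n W ?s\<bar> \<le> \<beta> * dotp n ?s ?s" "\<bar>qf n W ?d\<bar> \<le> \<beta> * dotp n ?d ?d"
    using u v by (auto intro!: b)
  have "dotp n ?s ?s + dotp n ?d ?d = 2 * (dotp n u u + dotp n v v)"
    by (simp add: dotp_linear dotp_commute[of n v u])
  then have "\<beta> * (dotp n ?s ?s + dotp n ?d ?d) = \<beta> * (2 * (dotp n u u + dotp n v v))" by simp
  then have 3: "\<beta> * dotp n ?s ?s + \<beta> * dotp n ?d ?d = 2 * (\<beta> * (dotp n u u + dotp n v v))"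
    by (simp only: distrib_left mult.left_commute[of \<beta> 2])
  have "\<bar>x\<bar> \<le> z / 2" if "4 * x = a - b" "\<bar>a\<bar> \<le> p" "\<bar>b\<bar> \<le> q" "p + q = 2 * z" for x z a b p q :: real
    using that by linarith
  from this[OF 1 2 3] show ?thesis .
qed

lemma qf_scale: "qf n W (\<lambda>i. c * u i) = c\<^sup>2 * qf n W u"
  by (simp add: qf_def sum_distrib_left power2_eq_square mult_ac)

lemma dotp_scale: "dotp n (\<lambda>i. c * u i) (\<lambda>i. c * u i) = c\<^sup>2 * dotp n u u"
  by (simp add: dotp_def sum_distrib_left power2_eq_square mult_ac)

lemma qf_bound_homogeneous:
  assumes b: "\<And>u. (\<forall>i. i \<notin> \<Omega> \<longrightarrow> u i = 0) \<Longrightarrow> dotp n u u \<le> 1 \<Longrightarrow> \<bar>qf n W u\<bar> \<le> \<beta>"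
    and u: "\<forall>i. i \<notin> \<Omega> \<longrightarrow> u i = 0"
  shows "\<bar>qf n W u\<bar> \<le> \<beta> * dotp n u u"
proof (cases "dotp n u u = 0")
  case True
  then have "u i = 0" if "i < n" for i using square_le_dotp[OF that, of u] by simp
  then have "qf n W u = 0" by (simp add: qf_def)
  then show ?thesis using True by simp
next
  case False
  then have p: "dotp n u u > 0" using dotp_self_nonneg[of n u] by linarith
  define c where "c = 1 / sqrt (dotp n u u)"
  have c: "c\<^sup>2 * dotp n u u = 1" using p by (simp add: c_def power_divide)
  have "\<bar>qf n W (\<lambda>i. c * u i)\<bar> \<le> \<beta>"
    using u c by (intro b) (auto simp: dotp_scale)
  then have "c\<^sup>2 * \<bar>qf n W u\<bar> \<le> \<beta>" by (simp add: qf_scale abs_mult)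
  then have "c\<^sup>2 * \<bar>qf n W u\<bar> * dotp n u u \<le> \<beta> * dotp n u u" using p by (intro mult_right_mono) auto
  moreover have "c\<^sup>2 * \<bar>qf n W u\<bar> * dotp n u u = \<bar>qf n W u\<bar> * (c\<^sup>2 * dotp n u u)" by (simp only: mult_ac)
  ultimately show ?thesis using c by simp
qed

section \<open>A lattice net and its approximation property\<close>

definition ksparse :: "nat \<Rightarrow> nat \<Rightarrow> (nat \<Rightarrow> real) \<Rightarrow> bool" where
  "ksparse n k u \<longleftrightarrow> (\<exists>\<Omega>\<subseteq>{..<n}. card \<Omega> = k \<and> (\<forall>i. i \<notin> \<Omega> \<longrightarrow> u i = 0))"

text \<open>A lattice of mesh 1 / (8 k) instead of a volumetric covering. Its count per support is
  coarser, but its logarithm is of order k log n, like that of the choice of the support.\<close>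

definition grid_vec :: "nat \<Rightarrow> nat set \<Rightarrow> (nat \<Rightarrow> int) \<Rightarrow> nat \<Rightarrow> real" where
  "grid_vec k \<Omega> z = (\<lambda>i. if i \<in> \<Omega> then real_of_int (z i) / (8 * real k) else 0)"

text \<open>Rounding can push a unit vector out of the unit ball. The cut-off 3 leaves room for
  this, as 2 + 2 / 64 <= 3, and keeps all net points of bounded norm.\<close>

definition grid_net :: "nat \<Rightarrow> nat \<Rightarrow> (nat \<Rightarrow> real) set" where
  "grid_net n k = {u \<in> (\<Union>\<Omega>\<in>{\<Omega>. \<Omega> \<subseteq> {..<n} \<and> card \<Omega> = k}.
      grid_vec k \<Omega> ` (\<Omega> \<rightarrow>\<^sub>E {- (8 * int k)..8 * int k})). dotp n u u \<le> 3}"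

lemma finite_supports: "finite {\<Omega>. \<Omega> \<subseteq> {..<n::nat} \<and> card \<Omega> = k}"
  by (rule finite_subset[of _ "Pow {..<n}"]) auto

lemma finite_PiE_support:
  "\<Omega> \<in> {\<Omega>. \<Omega> \<subseteq> {..<n::nat} \<and> card \<Omega> = k} \<Longrightarrow> finite (\<Omega> \<rightarrow>\<^sub>E {- (8 * int k)..8 * int k})"
  using finite_subset[of \<Omega> "{..<n}"] by (intro finite_PiE) auto

lemma finite_grid_net: "finite (grid_net n k)"
  unfolding grid_net_def
  by (rule finite_subset[OF Collect_restrict]) (intro finite_UN_I finite_supports finite_imageI finite_PiE_support)

lemma card_grid_net:
  assumes "k \<ge> 1" "k \<le> n"
  shows "card (grid_net n k) \<le> (17 * n\<^sup>2) ^ k"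
proof -
  let ?S = "{\<Omega>. \<Omega> \<subseteq> {..<n} \<and> card \<Omega> = k}"
  let ?G = "\<lambda>\<Omega>. grid_vec k \<Omega> ` (\<Omega> \<rightarrow>\<^sub>E {- (8 * int k)..8 * int k})"
  have "card (grid_net n k) \<le> card (\<Union>\<Omega>\<in>?S. ?G \<Omega>)"
    unfolding grid_net_def
    by (rule card_mono[OF _ Collect_restrict]) (intro finite_UN_I finite_supports finite_imageI finite_PiE_support)
  also have "\<dots> \<le> (\<Sum>\<Omega>\<in>?S. card (?G \<Omega>))"
    by (intro card_UN_le finite_supports)
  also have "\<dots> \<le> (\<Sum>\<Omega>\<in>?S. (17 * n) ^ k)"
  proof (rule sum_mono)
    fix \<Omega> assume O: "\<Omega> \<in> ?S"
    have "card (?G \<Omega>) \<le> card (\<Omega> \<rightarrow>\<^sub>E {- (8 * int k)..8 * int k})"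
      by (rule card_image_le[OF finite_PiE_support[OF O]])
    also have "\<dots> = (16 * k + 1) ^ k"
    proof -
      have c: "card {- (8 * int k)..8 * int k} = 16 * k + 1" unfolding card_atLeastAtMost_int by linarith
      have f: "finite \<Omega>" "card \<Omega> = k" using O finite_subset[of \<Omega> "{..<n}"] by auto
      show ?thesis unfolding card_PiE[OF f(1)] c prod_constant f(2) ..
    qed
    also have "\<dots> \<le> (17 * n) ^ k" using assms by (intro power_mono) auto
    finally show "card (?G \<Omega>) \<le> (17 * n) ^ k" .
  qed
  also have "\<dots> = (n choose k) * (17 * n) ^ k"
    using n_subsets[of "{..<n}" k] by simp
  also have "\<dots> \<le> n ^ k * (17 * n) ^ k"
    using binomial_le_pow[of k n] assms by (intro mult_right_mono) auto
  also have "\<dots> = (n * (17 * n)) ^ k" by (rule power_mult_distrib[symmetric])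
  also have "n * (17 * n) = 17 * n\<^sup>2" by (simp add: power2_eq_square)
  finally show ?thesis .
qed

lemma zero_in_grid_net:
  assumes "k \<le> n"
  shows "(\<lambda>_. 0) \<in> grid_net n k"
proof -
  have "grid_vec k {..<k} (restrict (\<lambda>_. 0) {..<k}) = (\<lambda>_. 0)" by (auto simp: grid_vec_def)
  moreover have "restrict (\<lambda>_. 0) {..<k} \<in> {..<k} \<rightarrow>\<^sub>E {- (8 * int k)..8 * int k}" by auto
  moreover have "{..<k} \<in> {\<Omega>. \<Omega> \<subseteq> {..<n} \<and> card \<Omega> = k}" using assms by auto
  ultimately have "(\<lambda>_. 0) \<in> (\<Union>\<Omega>\<in>{\<Omega>. \<Omega> \<subseteq> {..<n} \<and> card \<Omega> = k}.
      grid_vec k \<Omega> ` (\<Omega> \<rightarrow>\<^sub>E {- (8 * int k)..8 * int k}))"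
    by (intro UN_I[of "{..<k}"] image_eqI[of _ _ "restrict (\<lambda>_. 0) {..<k}"]) simp_all
  then show ?thesis by (simp add: grid_net_def dotp_def)
qed

lemma grid_net_approx:
  assumes \<Omega>: "\<Omega> \<subseteq> {..<n}" "card \<Omega> = k" and k: "k \<ge> 1"
    and u: "\<forall>i. i \<notin> \<Omega> \<longrightarrow> u i = 0" and u1: "dotp n u u \<le> 1"
  obtains v where "v \<in> grid_net n k" "\<forall>i. i \<notin> \<Omega> \<longrightarrow> v i = 0"
    "dotp n (\<lambda>i. u i - v i) (\<lambda>i. u i - v i) \<le> 1 / 64"
proof -
  have fin: "finite \<Omega>" using \<Omega>(1) finite_subset by blast
  define z where "z = restrict (\<lambda>i. \<lfloor>8 * real k * u i\<rfloor>) \<Omega>"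
  define v where "v = grid_vec k \<Omega> z"
  have v0: "\<forall>i. i \<notin> \<Omega> \<longrightarrow> v i = 0" by (auto simp: v_def grid_vec_def)
  have d: "(u i - v i)\<^sup>2 \<le> 1 / (64 * real k)" if "i \<in> \<Omega>" for i
  proof -
    let ?t = "8 * real k * u i"
    have "\<bar>?t - of_int \<lfloor>?t\<rfloor>\<bar> \<le> 1" by linarith
    then have "(?t - of_int \<lfloor>?t\<rfloor>)\<^sup>2 \<le> 1" using abs_square_le_1 by blast
    moreover have "u i - v i = (?t - of_int \<lfloor>?t\<rfloor>) / (8 * real k)"
      using that k by (simp add: v_def grid_vec_def z_def field_simps)
    ultimately have "(u i - v i)\<^sup>2 \<le> 1 / (8 * real k)\<^sup>2"
      using k by (simp add: power_divide divide_right_mono)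
    also have "\<dots> \<le> 1 / (64 * real k)"
      using k by (simp add: power2_eq_square field_simps)
    finally show ?thesis .
  qed
  have "dotp n (\<lambda>i. u i - v i) (\<lambda>i. u i - v i) = (\<Sum>i\<in>\<Omega>. (u i - v i)\<^sup>2)"
    unfolding dotp_def power2_eq_square using \<Omega>(1) u v0
    by (intro sum.mono_neutral_right) auto
  also have "\<dots> \<le> (\<Sum>i\<in>\<Omega>. 1 / (64 * real k))" by (intro sum_mono d)
  also have "\<dots> = 1 / 64" using \<Omega> k by simp
  finally have dd: "dotp n (\<lambda>i. u i - v i) (\<lambda>i. u i - v i) \<le> 1 / 64" .
  have zr: "z \<in> \<Omega> \<rightarrow>\<^sub>E {- (8 * int k)..8 * int k}"
  proof -
    have "- (8 * int k) \<le> \<lfloor>8 * real k * u i\<rfloor> \<and> \<lfloor>8 * real k * u i\<rfloor> \<le> 8 * int k" if "i \<in> \<Omega>" for i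
    proof -
      have "(u i)\<^sup>2 \<le> 1" using square_le_dotp[of i n u] \<Omega> that u1 by fastforce
      then have "\<bar>u i\<bar> \<le> 1" using abs_square_le_1 by blast
      then have "\<bar>8 * real k * u i\<bar> \<le> 8 * real k" using k by (simp add: abs_mult mult_left_le)
      then have "of_int (- (8 * int k)) \<le> 8 * real k * u i" "8 * real k * u i \<le> of_int (8 * int k)" by auto
      then show ?thesis by (metis floor_mono floor_of_int)
    qed
    then show ?thesis by (auto simp: z_def)
  qed
  have "dotp n v v \<le> 2 * dotp n u u + 2 * dotp n (\<lambda>i. v i - u i) (\<lambda>i. v i - u i)"
    using dotp_add_le[of n u "\<lambda>i. v i - u i"] by simp
  also have "dotp n (\<lambda>i. v i - u i) (\<lambda>i. v i - u i) = dotp n (\<lambda>i. u i - v i) (\<lambda>i. u i - v i)"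
    by (simp add: dotp_linear)
  finally have "dotp n v v \<le> 3" using dd u1 by simp
  moreover have "v \<in> (\<Union>\<Omega>\<in>{\<Omega>. \<Omega> \<subseteq> {..<n} \<and> card \<Omega> = k}.
      grid_vec k \<Omega> ` (\<Omega> \<rightarrow>\<^sub>E {- (8 * int k)..8 * int k}))"
    unfolding v_def using zr \<Omega> by (intro UN_I[of \<Omega>] imageI) simp_all
  ultimately have "v \<in> grid_net n k" unfolding grid_net_def by simp
  then show ?thesis using that v0 dd by blast
qed

text \<open>The standard absorption: on one support the supremum \<beta> over the unit ball exceeds
  the maximum over the net by at most \<beta> / 2, because the rounding error is supported there
  too.\<close>

lemma grid_net_controls_sparse:
  assumes sym: "\<And>i j. i < n \<Longrightarrow> j < n \<Longrightarrow> W i j = W j i" and k: "k \<ge> 1"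
    and b: "\<And>u. u \<in> grid_net n k \<Longrightarrow> \<bar>qf n W u\<bar> \<le> b"
    and u: "ksparse n k u"
  shows "\<bar>qf n W u\<bar> \<le> 2 * b * dotp n u u"
proof -
  obtain \<Omega> where \<Omega>: "\<Omega> \<subseteq> {..<n}" "card \<Omega> = k" "\<forall>i. i \<notin> \<Omega> \<longrightarrow> u i = 0"
    using u unfolding ksparse_def by blast
  define S where "S = {\<bar>qf n W u\<bar> | u. (\<forall>i. i \<notin> \<Omega> \<longrightarrow> u i = 0) \<and> dotp n u u \<le> 1}"
  define \<beta> where "\<beta> = Sup S"
  \<comment> \<open>Boundedness makes \<open>\<beta>\<close> a genuine supremum, so that \<beta> / 2
    can be absorbed at the end.\<close>
  have bd: "bdd_above S"
  proof (rule bdd_aboveI)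
    fix s assume "s \<in> S"
    then obtain u where u: "dotp n u u \<le> 1" "s = \<bar>qf n W u\<bar>" unfolding S_def by blast
    have u1: "\<bar>u i\<bar> \<le> 1" if "i < n" for i
      using square_le_dotp[OF that, of u] u(1) abs_square_le_1[of "u i"] by linarith
    show "s \<le> (\<Sum>j<n. \<Sum>l<n. \<bar>W j l\<bar>)" unfolding u(2) qf_def
    proof (intro order_trans[OF sum_abs] sum_mono)
      fix j l assume jl: "j \<in> {..<n}" "l \<in> {..<n}"
      have "\<bar>u j\<bar> * \<bar>W j l\<bar> * \<bar>u l\<bar> \<le> 1 * \<bar>W j l\<bar> * 1" using jl u1 by (intro mult_mono) auto
      then show "\<bar>u j * W j l * u l\<bar> \<le> \<bar>W j l\<bar>" by (simp add: abs_mult)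
    qed
  qed
  have up: "\<bar>qf n W u\<bar> \<le> \<beta>" if "\<forall>i. i \<notin> \<Omega> \<longrightarrow> u i = 0" "dotp n u u \<le> 1" for u
    unfolding \<beta>_def using that by (intro cSup_upper bd) (auto simp: S_def)
  have hom: "\<bar>qf n W u\<bar> \<le> \<beta> * dotp n u u" if "\<forall>i. i \<notin> \<Omega> \<longrightarrow> u i = 0" for u
    by (rule qf_bound_homogeneous[of \<Omega>]) (use up that in auto)
  have \<beta>0: "\<beta> \<ge> 0" using up[of "\<lambda>_. 0"] by (simp add: dotp_def qf_def)
  have step: "\<bar>qf n W u\<bar> \<le> b + \<beta> / 2" if u: "\<forall>i. i \<notin> \<Omega> \<longrightarrow> u i = 0" "dotp n u u \<le> 1" for u
  proof -
    obtain v where v: "v \<in> grid_net n k" "\<forall>i. i \<notin> \<Omega> \<longrightarrow> v i = 0"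
      "dotp n (\<lambda>i. u i - v i) (\<lambda>i. u i - v i) \<le> 1 / 64"
      using grid_net_approx[OF \<Omega>(1,2) k u] .
    define d where "d = (\<lambda>i. u i - v i)"
    have "bf n W v u = bf n W u v" using sym by (rule bf_commute)
    then have "qf n W u - qf n W v = bf n W d (\<lambda>i. u i + v i)"
      by (simp add: qf_eq_bf bf_linear d_def)
    \<comment> \<open>Polarization bounds by the sum of the squared norms, so the short vector
      \<open>d\<close> is lengthened first: the squared norms become at most 256 / 64 = 4 and 12,
      and (4 + 12) / 2 / 16 = 1 / 2.\<close>
    also have "\<dots> = bf n W (\<lambda>i. 16 * d i) (\<lambda>i. u i + v i) / 16" by (simp add: bf_linear)
    finally have e: "qf n W u - qf n W v = bf n W (\<lambda>i. 16 * d i) (\<lambda>i. u i + v i) / 16" .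
    have "\<bar>bf n W (\<lambda>i. 16 * d i) (\<lambda>i. u i + v i)\<bar>
      \<le> \<beta> * (dotp n (\<lambda>i. 16 * d i) (\<lambda>i. 16 * d i) + dotp n (\<lambda>i. u i + v i) (\<lambda>i. u i + v i)) / 2"
      by (rule bf_polarization_bound[where \<Omega>=\<Omega>]) (use sym hom u v in \<open>auto simp: d_def\<close>)
    also have "\<dots> \<le> \<beta> * (4 + 12) / 2"
    proof (intro divide_right_mono mult_left_mono add_mono \<beta>0)
      show "dotp n (\<lambda>i. 16 * d i) (\<lambda>i. 16 * d i) \<le> 4" using v(3) unfolding d_def[symmetric] dotp_scale by simp
      have "dotp n v v \<le> 3" using v(1) by (simp add: grid_net_def)
      then show "dotp n (\<lambda>i. u i + v i) (\<lambda>i. u i + v i) \<le> 12" using dotp_add_le[of n u v] u(2) by linarith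
    qed simp
    finally have "\<bar>qf n W u - qf n W v\<bar> \<le> \<beta> / 2" unfolding e by simp
    then show ?thesis using b[OF v(1)] by linarith
  qed
  have "Sup S \<le> b + \<beta> / 2"
  proof (rule cSup_least)
    have "\<bar>qf n W (\<lambda>_. 0)\<bar> \<in> S" unfolding S_def by (auto simp: dotp_def intro!: exI[of _ "\<lambda>_. 0"])
    then show "S \<noteq> {}" by blast
  qed (use step in \<open>auto simp: S_def\<close>)
  then have "\<beta> \<le> 2 * b" by (simp add: \<beta>_def)
  then show ?thesis using hom[OF \<Omega>(3)] mult_right_mono[of \<beta> "2 * b" "dotp n u u"] by simp
qed

section \<open>The uniform lower bound\<close>

text \<open>Jensen's inequality for the fourth power with unnormalised weights, obtained by applying
  Cauchy-Schwarz twice.\<close>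

lemma weighted_sum_power4:
  fixes v z :: "'i \<Rightarrow> real"
  assumes "\<And>r. r \<in> I \<Longrightarrow> 0 \<le> v r"
  shows "(\<Sum>r\<in>I. v r * z r) ^ 4 \<le> (\<Sum>r\<in>I. v r) ^ 3 * (\<Sum>r\<in>I. v r * z r ^ 4)"
proof -
  have cs: "(\<Sum>r\<in>I. v r * y r)\<^sup>2 \<le> (\<Sum>r\<in>I. v r) * (\<Sum>r\<in>I. v r * (y r)\<^sup>2)" for y
  proof -
    have "(\<Sum>r\<in>I. sqrt (v r) * (sqrt (v r) * y r))\<^sup>2 \<le> (\<Sum>r\<in>I. (sqrt (v r))\<^sup>2) * (\<Sum>r\<in>I. (sqrt (v r) * y r)\<^sup>2)"
      by (rule Cauchy_Schwarz_ineq_sum)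
    moreover have "(\<Sum>r\<in>I. sqrt (v r) * (sqrt (v r) * y r)) = (\<Sum>r\<in>I. v r * y r)"
      using assms by (intro sum.cong) (auto simp: mult.assoc[symmetric])
    ultimately show ?thesis using assms by (simp add: power_mult_distrib)
  qed
  have V: "0 \<le> (\<Sum>r\<in>I. v r)" using assms by (intro sum_nonneg)
  have "(\<Sum>r\<in>I. v r * z r) ^ 4 = ((\<Sum>r\<in>I. v r * z r)\<^sup>2)\<^sup>2" by simp
  also have "\<dots> \<le> ((\<Sum>r\<in>I. v r) * (\<Sum>r\<in>I. v r * (z r)\<^sup>2))\<^sup>2" by (intro power_mono cs) auto
  also have "\<dots> = (\<Sum>r\<in>I. v r)\<^sup>2 * (\<Sum>r\<in>I. v r * (z r)\<^sup>2)\<^sup>2" by (simp add: power_mult_distrib)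
  also have "\<dots> \<le> (\<Sum>r\<in>I. v r)\<^sup>2 * ((\<Sum>r\<in>I. v r) * (\<Sum>r\<in>I. v r * ((z r)\<^sup>2)\<^sup>2))" by (intro mult_left_mono cs) auto
  also have "\<dots> = (\<Sum>r\<in>I. v r) ^ 3 * (\<Sum>r\<in>I. v r * z r ^ 4)" by (simp add: power2_eq_square power3_eq_cube power4_eq_xxxx mult_ac)
  finally show ?thesis .
qed

text \<open>A polynomial minorant of the truncation, so that its expectation is bounded below by
  second and fourth moments alone, in the manner of Paley and Zygmund.\<close>

lemma min_abs_ge:
  fixes t M :: real
  assumes M: "M > 0"
  shows "(t\<^sup>2 - t ^ 4 / M\<^sup>2) / M \<le> min \<bar>t\<bar> M"
proof (cases "\<bar>t\<bar> \<le> M")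
  case True
  have "t\<^sup>2 - t ^ 4 / M\<^sup>2 \<le> t\<^sup>2" by simp
  also have "\<dots> = \<bar>t\<bar> * \<bar>t\<bar>" by (simp add: power2_eq_square)
  also have "\<dots> \<le> \<bar>t\<bar> * M" using True by (intro mult_left_mono) auto
  finally show ?thesis using True M by (simp add: divide_le_eq)
next
  case False
  then have "M\<^sup>2 \<le> t\<^sup>2" using M abs_le_square_iff[of M t] by simp
  then have "M\<^sup>2 * t\<^sup>2 \<le> t\<^sup>2 * t\<^sup>2" by (intro mult_right_mono) auto
  then have "t\<^sup>2 - t ^ 4 / M\<^sup>2 \<le> 0" using M by (simp add: field_simps power2_eq_square power4_eq_xxxx)
  then have "(t\<^sup>2 - t ^ 4 / M\<^sup>2) / M \<le> 0" using M by (simp add: divide_le_0_iff)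
  also have "0 \<le> min \<bar>t\<bar> M" using M by simp
  finally show ?thesis .
qed

text \<open>Nuclear norm control appears as domination of the form by squares of linear forms, and the bound
  on the Gaussian-type width as an estimate against arbitrary test matrices \<open>W\<close>.\<close>

definition good_matrices :: "nat \<Rightarrow> nat \<Rightarrow> real \<Rightarrow> real \<Rightarrow> real \<Rightarrow> (nat \<Rightarrow> nat \<Rightarrow> real) set" where
  "good_matrices n k lam T A = {H.
     (\<forall>i<n. \<forall>j<n. H i j = H j i) \<and> (\<Sum>i<n. \<Sum>j<n. (H i j)\<^sup>2) = 1 \<and>
     (\<exists>(R::nat) w. (\<forall>a. \<bar>qf n H a\<bar> \<le> (\<Sum>r<R. (dotp n (w r) a)\<^sup>2)) \<and> (\<Sum>r<R. dotp n (w r) (w r)) \<le> T) \<and>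
     (\<forall>W w b. (\<forall>i<n. \<forall>j<n. W i j = W j i) \<longrightarrow> (\<forall>i<n. \<forall>j<n. \<bar>W i j\<bar> \<le> w) \<longrightarrow>
        (\<forall>u. ksparse n k u \<longrightarrow> \<bar>qf n W u\<bar> \<le> b * dotp n u u) \<longrightarrow>
        \<bar>\<Sum>i<n. \<Sum>j<n. W i j * H i j\<bar> \<le> A * (w / lam + b))}"

text \<open>One \<open>s0\<close> serves all \<open>n\<close>, which is what makes the later
  constants independent of the dimension. The squared norm 3 admits the unit vectors and all points
  of \<open>grid_net\<close>.\<close>

locale subgaussian_law = entry_law +
  fixes s0 :: real
  assumes s0: "s0 > 0"
    and sq_exp: "\<And>n w. dotp n w w \<le> 3 \<Longrightarrow> (\<integral>\<^sup>+ a. ennreal (exp (s0 * (dotp n w a)\<^sup>2)) \<partial>N n) \<le> 4"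
begin

text \<open>The dominating linear forms are normalised, and their squared norms become weights of
  total mass at most \<open>T\<close>. The weighted power inequality then yields a bound in
  \<open>T\<close> alone, whatever \<open>n\<close> and \<open>R\<close> are.\<close>

lemma fourth_moment_qf:
  fixes R :: nat
  assumes w: "\<And>a. \<bar>qf n H a\<bar> \<le> (\<Sum>r<R. (dotp n (w r) a)\<^sup>2)" "(\<Sum>r<R. dotp n (w r) (w r)) \<le> T"
  shows "(\<integral>\<^sup>+ a. ennreal ((qf n H a) ^ 4) \<partial>N n) \<le> ennreal (96 * T ^ 4 / s0 ^ 4)"
proof -
  define v where "v r = dotp n (w r) (w r)" for r
  \<comment> \<open>For \<open>v r = 0\<close> the convention 1 / 0 = 0 makes \<open>u r\<close> the
    zero vector, so the norm bound for \<open>u r\<close> holds in this case as well.\<close>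
  define u where "u r = (\<lambda>j. 1 / sqrt (v r) * w r j)" for r
  define z where "z r a = (dotp n (u r) a)\<^sup>2" for r a
  have v0: "0 \<le> v r" for r by (simp add: v_def)
  have "0 \<le> (\<Sum>r<R. dotp n (w r) (w r))" by (intro sum_nonneg) simp
  then have T0: "0 \<le> T" using w(2) by linarith
  have vz: "(dotp n (w r) a)\<^sup>2 = v r * z r a" for r a
  proof (cases "v r = 0")
    case True
    then have "w r j = 0" if "j < n" for j using square_le_dotp[OF that, of "w r"] by (simp add: v_def)
    then show ?thesis using True by (simp add: dotp_def)
  next
    case False
    then have "v r > 0" using v0[of r] by linarith
    moreover have "dotp n (u r) a = 1 / sqrt (v r) * dotp n (w r) a" unfolding u_def by (rule dotp_linear(3))
    ultimately show ?thesis by (simp add: z_def power_divide)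
  qed
  have u1: "dotp n (u r) (u r) \<le> 3" for r
  proof -
    have "dotp n (u r) (u r) = (1 / sqrt (v r))\<^sup>2 * v r" unfolding u_def v_def by (rule dotp_scale)
    also have "\<dots> \<le> 1" using v0[of r] by (simp add: power_divide)
    finally show ?thesis by simp
  qed
  \<comment> \<open>The 24 is the factorial of 4; with the bound 4 of \<open>sq_exp\<close> it gives
    the constant 96.\<close>
  have z4: "(z r a) ^ 4 \<le> 24 / s0 ^ 4 * exp (s0 * (dotp n (u r) a)\<^sup>2)" for r a
  proof -
    have "(s0 * z r a) ^ 4 \<le> fact 4 * exp (s0 * z r a)" using s0 by (intro power_le_fact_exp) (simp add: z_def)
    then show ?thesis using s0 by (simp add: z_def field_simps power_mult_distrib fact_numeral)
  qed
  have pw: "(qf n H a) ^ 4 \<le> (\<Sum>r<R. T ^ 3 * v r * (24 / s0 ^ 4) * exp (s0 * (dotp n (u r) a)\<^sup>2))" for a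
  proof -
    have "(qf n H a) ^ 4 = \<bar>qf n H a\<bar> ^ 4" by simp
    also have "\<dots> \<le> (\<Sum>r<R. v r * z r a) ^ 4" using w(1)[of a] by (intro power_mono) (auto simp: vz)
    also have "\<dots> \<le> (\<Sum>r<R. v r) ^ 3 * (\<Sum>r<R. v r * z r a ^ 4)" by (intro weighted_sum_power4 v0)
    also have "\<dots> \<le> T ^ 3 * (\<Sum>r<R. v r * (24 / s0 ^ 4 * exp (s0 * (dotp n (u r) a)\<^sup>2)))"
      using w(2) v0 z4 by (intro mult_mono power_mono sum_mono mult_left_mono)
        (auto simp: v_def[symmetric] intro!: sum_nonneg mult_nonneg_nonneg T0)
    also have "\<dots> = (\<Sum>r<R. T ^ 3 * v r * (24 / s0 ^ 4) * exp (s0 * (dotp n (u r) a)\<^sup>2))"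
      by (simp add: sum_distrib_left mult_ac)
    finally show ?thesis .
  qed
  define c where "c r = T ^ 3 * v r * (24 / s0 ^ 4)" for r
  have c0: "0 \<le> c r" for r using T0 v0 s0 by (simp add: c_def)
  have "(\<integral>\<^sup>+ a. ennreal ((qf n H a) ^ 4) \<partial>N n) \<le> (\<integral>\<^sup>+ a. (\<Sum>r<R. ennreal (c r) * ennreal (exp (s0 * (dotp n (u r) a)\<^sup>2))) \<partial>N n)"
  proof (rule nn_integral_mono)
    fix a
    have "(\<Sum>r<R. ennreal (c r) * ennreal (exp (s0 * (dotp n (u r) a)\<^sup>2))) = ennreal (\<Sum>r<R. c r * exp (s0 * (dotp n (u r) a)\<^sup>2))"
      using c0 by (simp add: ennreal_mult'[symmetric])
    then show "ennreal ((qf n H a) ^ 4) \<le> (\<Sum>r<R. ennreal (c r) * ennreal (exp (s0 * (dotp n (u r) a)\<^sup>2)))"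
      using pw[of a] by (simp add: c_def ennreal_leI)
  qed
  also have "\<dots> = (\<Sum>r<R. ennreal (c r) * (\<integral>\<^sup>+ a. ennreal (exp (s0 * (dotp n (u r) a)\<^sup>2)) \<partial>N n))"
    by (subst nn_integral_sum) (auto intro!: sum.cong nn_integral_cmult)
  also have "\<dots> \<le> (\<Sum>r<R. ennreal (c r) * 4)"
    by (intro sum_mono mult_left_mono sq_exp u1) auto
  also have "\<dots> = ennreal (\<Sum>r<R. c r * 4)"
    using c0 by (subst sum_ennreal[symmetric]) (auto simp: ennreal_mult)
  also have "(\<Sum>r<R. c r * 4) = T ^ 3 * (\<Sum>r<R. v r) * (96 / s0 ^ 4)"
    by (simp add: c_def sum_distrib_left sum_distrib_right sum_divide_distrib mult_ac)
  also have "ennreal \<dots> \<le> ennreal (96 * T ^ 4 / s0 ^ 4)"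
  proof (rule ennreal_leI)
    have "T ^ 3 * (\<Sum>r<R. v r) * (96 / s0 ^ 4) \<le> T ^ 3 * T * (96 / s0 ^ 4)"
      using w(2) T0 s0 by (intro mult_right_mono mult_left_mono) (auto simp: v_def)
    then show "T ^ 3 * (\<Sum>r<R. v r) * (96 / s0 ^ 4) \<le> 96 * T ^ 4 / s0 ^ 4"
      by (simp add: power4_eq_xxxx power3_eq_cube mult_ac)
  qed
  finally show ?thesis .
qed

text \<open>The second moment is at least \<kappa> because the Frobenius norm is 1. The condition on
  \<open>M\<close> ensures that the fourth-moment correction for truncation consumes at most half of
  it.\<close>

lemma small_ball_expectation:
  assumes H: "H \<in> good_matrices n k lam T A"
    and \<kappa>: "0 < \<kappa>" "\<kappa> \<le> 2" "\<kappa> \<le> (\<integral>t. t ^ 4 \<partial>D) - 1"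
    and M: "M > 0" "96 * T ^ 4 / s0 ^ 4 / M\<^sup>2 \<le> \<kappa> / 2"
  shows "\<kappa> / (2 * M) \<le> (\<integral>a. min \<bar>qf n H a\<bar> M \<partial>N n)"
proof -
  interpret P: prob_space "N n" by (rule prob_N)
  obtain R :: nat and w where w: "\<And>a. \<bar>qf n H a\<bar> \<le> (\<Sum>r<R. (dotp n (w r) a)\<^sup>2)" "(\<Sum>r<R. dotp n (w r) (w r)) \<le> T"
    using H unfolding good_matrices_def by blast
  let ?C = "96 * T ^ 4 / s0 ^ 4"
  have C0: "0 \<le> ?C" by simp
  note f4 = fourth_moment_qf[OF w]
  have i4: "integrable (N n) (\<lambda>a. (qf n H a) ^ 4)"
    by (intro integrableI_nonneg) (auto intro: le_less_trans[OF f4])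
  have e4: "(\<integral>a. (qf n H a) ^ 4 \<partial>N n) \<le> ?C"
    using f4 nn_integral_eq_integral[OF i4] C0 by (simp add: ennreal_le_iff)
  have "\<kappa> * 1 \<le> (mtrace n H)\<^sup>2 + \<kappa> * (\<Sum>i<n. \<Sum>j<n. (H i j)\<^sup>2)"
    using H by (simp add: good_matrices_def)
  also have "\<dots> \<le> (\<integral>a. (qf n H a)\<^sup>2 \<partial>N n)"
    using H \<kappa> by (intro second_moment_qf) (auto simp: good_matrices_def)
  finally have e2: "\<kappa> \<le> (\<integral>a. (qf n H a)\<^sup>2 \<partial>N n)" by simp
  have "(\<kappa> - \<kappa> / 2) / M \<le> ((\<integral>a. (qf n H a)\<^sup>2 \<partial>N n) - (\<integral>a. (qf n H a) ^ 4 \<partial>N n) / M\<^sup>2) / M"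
  proof (intro divide_right_mono diff_mono e2)
    have "(\<integral>a. (qf n H a) ^ 4 \<partial>N n) / M\<^sup>2 \<le> ?C / M\<^sup>2" by (intro divide_right_mono e4) simp
    then show "(\<integral>a. (qf n H a) ^ 4 \<partial>N n) / M\<^sup>2 \<le> \<kappa> / 2" using M(2) by linarith
  qed (use M in simp)
  also have "\<dots> = (\<integral>a. ((qf n H a)\<^sup>2 - (qf n H a) ^ 4 / M\<^sup>2) / M \<partial>N n)"
    using i4 integrable_qf2 by simp
  also have "\<dots> \<le> (\<integral>a. min \<bar>qf n H a\<bar> M \<partial>N n)"
    using i4 integrable_qf2 integrable_qf by (intro integral_mono min_abs_ge M) auto
  finally show ?thesis by simp
qed

lemma signed_entry_mgf:
  assumes jl: "j < n" "l < n" and s: "\<bar>s\<bar> \<le> s0 / 2"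
  shows "(\<integral>\<^sup>+ p. ennreal (exp (s * (rsign (snd p) * (fst p j * fst p l)))) \<partial>signed (N n)) \<le> ennreal (exp (16 * s\<^sup>2 / s0\<^sup>2))"
proof (rule signed_mgf[OF prob_N _ s0 _ s])
  show m: "(\<lambda>a. a j * a l) \<in> borel_measurable (N n)" using integrable_coord2[OF jl] by auto
  define e where "e j = (\<lambda>i::nat. if i = j then 1 else (0::real))" for j
  have e: "dotp n (e j) a = a j" if "j < n" for j a
    using that by (simp add: dotp_def e_def if_distrib[of "\<lambda>x. x * _"] cong: if_cong)
  have sq: "(\<integral>\<^sup>+ a. ennreal (exp (s0 * (a j)\<^sup>2)) \<partial>N n) \<le> 4" if "j < n" for j
    using sq_exp[of n "e j"] e[OF that] by (simp add: e_def)
  have ms: "(\<lambda>a. ennreal (exp (s0 * (a j)\<^sup>2))) \<in> borel_measurable (N n)" if "j < n" for j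
    using integrable_coord(2)[OF that] by auto
  have pw: "exp (s0 * \<bar>x * y\<bar>) \<le> (exp (s0 * x\<^sup>2) + exp (s0 * y\<^sup>2)) / 2" for x y :: real
  proof -
    have "2 * \<bar>x * y\<bar> \<le> x\<^sup>2 + y\<^sup>2" using sum_squares_bound[of "\<bar>x\<bar>" "\<bar>y\<bar>"] by (simp add: abs_mult)
    then have "s0 * \<bar>x * y\<bar> \<le> s0 * ((x\<^sup>2 + y\<^sup>2) / 2)" using s0 by (intro mult_left_mono) auto
    then have "exp (s0 * \<bar>x * y\<bar>) \<le> exp (s0 * x\<^sup>2 / 2) * exp (s0 * y\<^sup>2 / 2)"
      by (simp add: exp_add[symmetric] algebra_simps add_divide_distrib)
    also have "2 * \<dots> \<le> (exp (s0 * x\<^sup>2 / 2))\<^sup>2 + (exp (s0 * y\<^sup>2 / 2))\<^sup>2"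
      using sum_squares_bound[of "exp (s0 * x\<^sup>2 / 2)" "exp (s0 * y\<^sup>2 / 2)"] by simp
    finally show ?thesis by (simp add: power2_eq_square exp_add[symmetric])
  qed
  have "(\<integral>\<^sup>+ a. ennreal (exp (s0 * \<bar>a j * a l\<bar>)) \<partial>N n)
     \<le> (\<integral>\<^sup>+ a. ennreal (1/2) * (ennreal (exp (s0 * (a j)\<^sup>2)) + ennreal (exp (s0 * (a l)\<^sup>2))) \<partial>N n)"
    using pw by (intro nn_integral_mono)
      (simp add: ennreal_plus[symmetric] ennreal_mult'[symmetric] ennreal_leI del: ennreal_plus ennreal_half ennreal_divide_numeral)
  also have "\<dots> = ennreal (1/2) * ((\<integral>\<^sup>+ a. ennreal (exp (s0 * (a j)\<^sup>2)) \<partial>N n) + (\<integral>\<^sup>+ a. ennreal (exp (s0 * (a l)\<^sup>2)) \<partial>N n))"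
    using ms jl by (simp add: nn_integral_cmult nn_integral_add)
  also have "\<dots> \<le> ennreal (1/2) * (4 + 4)"
    using sq jl by (intro mult_left_mono add_mono) auto
  also have "\<dots> = ennreal (1/2 * 8)" by (subst ennreal_mult) auto
  also have "\<dots> = 4" by simp
  finally show "(\<integral>\<^sup>+ a. ennreal (exp (s0 * \<bar>a j * a l\<bar>)) \<partial>N n) \<le> 4" .
qed

lemma signed_square_mgf:
  assumes u: "dotp n u u \<le> 3" and s: "\<bar>s\<bar> \<le> s0 / 2"
  shows "(\<integral>\<^sup>+ p. ennreal (exp (s * (rsign (snd p) * (dotp n u (fst p))\<^sup>2))) \<partial>signed (N n)) \<le> ennreal (exp (16 * s\<^sup>2 / s0\<^sup>2))"
  using sq_exp[OF u] by (intro signed_mgf[OF prob_N _ s0 _ s]) auto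

text \<open>For fixed samples and signs the left side is twice the pairing of \<open>H\<close> with
  W, the signed sum of the a a^T, so the last clause in \<open>good_matrices\<close> applies. The
  sparse operator norm of W is replaced by twice its maximum over the net. The bound no longer
  involves the individual \<open>H\<close>.\<close>

lemma width_pointwise:
  fixes p :: "nat \<Rightarrow> (nat \<Rightarrow> real) \<times> bool"
  assumes H: "H \<in> good_matrices n k lam T A" and n: "n \<ge> 1" and k: "k \<ge> 1" "k \<le> n"
  shows "(\<Sum>i<m. 2 * (rsign (snd (p i)) * qf n H (fst (p i)))) \<le>
    2 * A * ((MAX jl\<in>{..<n} \<times> {..<n}. \<bar>\<Sum>i<m. rsign (snd (p i)) * (fst (p i) (fst jl) * fst (p i) (snd jl))\<bar>) / lam
      + 2 * (MAX u\<in>grid_net n k. \<bar>\<Sum>i<m. rsign (snd (p i)) * (dotp n u (fst (p i)))\<^sup>2\<bar>))"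
proof -
  define W where "W j l = (\<Sum>i<m. rsign (snd (p i)) * (fst (p i) j * fst (p i) l))" for j l
  define w where "w = (MAX jl\<in>{..<n} \<times> {..<n}. \<bar>\<Sum>i<m. rsign (snd (p i)) * (fst (p i) (fst jl) * fst (p i) (snd jl))\<bar>)"
  define b where "b = (MAX u\<in>grid_net n k. \<bar>\<Sum>i<m. rsign (snd (p i)) * (dotp n u (fst (p i)))\<^sup>2\<bar>)"
  have sym: "W i j = W j i" for i j by (simp add: W_def mult.commute)
  have W: "\<bar>W j l\<bar> \<le> w" if "j < n" "l < n" for j l
    using MAX_ge[of "{..<n} \<times> {..<n}" "(j, l)" "\<lambda>jl. \<bar>\<Sum>i<m. rsign (snd (p i)) * (fst (p i) (fst jl) * fst (p i) (snd jl))\<bar>"] that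
    unfolding W_def w_def by simp
  have qfW: "qf n W u = (\<Sum>i<m. rsign (snd (p i)) * (dotp n u (fst (p i)))\<^sup>2)" for u
  proof -
    have "qf n W u = (\<Sum>j<n. \<Sum>l<n. \<Sum>i<m. rsign (snd (p i)) * ((u j * fst (p i) j) * (u l * fst (p i) l)))"
      by (simp add: qf_def W_def sum_distrib_left sum_distrib_right mult_ac)
    also have "\<dots> = (\<Sum>i<m. \<Sum>j<n. \<Sum>l<n. rsign (snd (p i)) * ((u j * fst (p i) j) * (u l * fst (p i) l)))"
      by (simp only: sum.swap[where A="{..<n}" and B="{..<m}"])
    also have "\<dots> = (\<Sum>i<m. rsign (snd (p i)) * (dotp n u (fst (p i)))\<^sup>2)"
    proof -
      have "(dotp n u (fst (p i)))\<^sup>2 = (\<Sum>j<n. \<Sum>l<n. (u j * fst (p i) j) * (u l * fst (p i) l))" for i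
        by (simp add: dotp_def power2_eq_square sum_product)
      then show ?thesis by (simp only: sum_distrib_left)
    qed
    finally show ?thesis .
  qed
  have net: "\<bar>qf n W u\<bar> \<le> b" if "u \<in> grid_net n k" for u
    using MAX_ge[OF finite_grid_net that, of "\<lambda>u. \<bar>\<Sum>i<m. rsign (snd (p i)) * (dotp n u (fst (p i)))\<^sup>2\<bar>"]
    unfolding qfW b_def by simp
  have sp: "\<bar>qf n W u\<bar> \<le> (2 * b) * dotp n u u" if "ksparse n k u" for u
    by (rule grid_net_controls_sparse[OF _ k(1) net that]) (rule sym)
  have "(\<Sum>i<m. rsign (snd (p i)) * qf n H (fst (p i))) = (\<Sum>i<m. \<Sum>j<n. \<Sum>l<n. rsign (snd (p i)) * (fst (p i) j * fst (p i) l) * H j l)"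
    by (simp add: qf_def sum_distrib_left mult_ac)
  also have "\<dots> = (\<Sum>j<n. \<Sum>l<n. \<Sum>i<m. rsign (snd (p i)) * (fst (p i) j * fst (p i) l) * H j l)"
    by (simp only: sum.swap[where A="{..<m}" and B="{..<n}"])
  also have "\<dots> = (\<Sum>j<n. \<Sum>l<n. W j l * H j l)" by (simp add: W_def sum_distrib_right)
  also have "\<dots> \<le> A * (w / lam + 2 * b)"
  proof -
    have "\<forall>W w b. (\<forall>i<n. \<forall>j<n. W i j = W j i) \<longrightarrow> (\<forall>i<n. \<forall>j<n. \<bar>W i j\<bar> \<le> w) \<longrightarrow>
        (\<forall>u. ksparse n k u \<longrightarrow> \<bar>qf n W u\<bar> \<le> b * dotp n u u) \<longrightarrow>
        \<bar>\<Sum>i<n. \<Sum>j<n. W i j * H i j\<bar> \<le> A * (w / lam + b)"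
      using H unfolding good_matrices_def by blast
    from this[rule_format, of W w "2 * b"] have "\<bar>\<Sum>j<n. \<Sum>l<n. W j l * H j l\<bar> \<le> A * (w / lam + 2 * b)"
      using sym W sp by blast
    then show ?thesis by linarith
  qed
  finally have "2 * (\<Sum>i<m. rsign (snd (p i)) * qf n H (fst (p i))) \<le> 2 * (A * (w / lam + 2 * b))" by simp
  then show ?thesis unfolding w_def[symmetric] b_def[symmetric] by (simp only: sum_distrib_left mult.assoc)
qed

text \<open>The summand 1 keeps both bounds valid for n = 1, where the logarithm vanishes.\<close>

lemma log_net_bounds:
  fixes n k :: nat
  assumes "n \<ge> 1" "k \<ge> 1" "k \<le> n"
  shows "ln (2 * real (card ({..<n} \<times> {..<n}))) \<le> 2 * (1 + ln n)"
    and "ln (2 * real (card (grid_net n k))) \<le> 6 * k * (1 + ln n)"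
proof -
  have ln2: "ln 2 \<le> (1::real)" using ln_le_minus_one[of "2::real"] by simp
  have lnn: "0 \<le> ln (real n)" using assms by simp
  show "ln (2 * real (card ({..<n} \<times> {..<n}))) \<le> 2 * (1 + ln n)"
    using assms ln2 by (simp add: card_cartesian_product ln_mult)
  have g: "card (grid_net n k) > 0" using zero_in_grid_net[OF assms(3)] finite_grid_net by (auto simp: card_gt_0_iff)
  have "real (card (grid_net n k)) \<le> (17 * (real n)\<^sup>2) ^ k"
  proof -
    have "real (card (grid_net n k)) \<le> real ((17 * n\<^sup>2) ^ k)"
      using card_grid_net[OF assms(2,3)] by (simp only: of_nat_le_iff)
    then show ?thesis by simp
  qed
  then have "ln (2 * real (card (grid_net n k))) \<le> ln (2 * (17 * (real n)\<^sup>2) ^ k)"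
    using g by (intro ln_mono) auto
  also have "\<dots> = ln 2 + k * (ln 17 + 2 * ln n)"
    using assms by (simp add: ln_mult ln_realpow distrib_left)
  also have "\<dots> \<le> real k + real k * (5 + 2 * ln n)"
  proof (intro add_mono mult_left_mono)
    have "ln (17::real) \<le> ln (2 ^ 5)" by (intro ln_mono) auto
    also have "\<dots> = 5 * ln 2" by (subst ln_realpow) auto
    finally show "ln (17::real) \<le> 5" using ln2 by simp
    have "1 \<le> real k" using assms by simp
    then show "ln 2 \<le> real k" using ln2 by simp
  qed auto
  also have "\<dots> \<le> 6 * k * (1 + ln n)"
  proof -
    have "real k * ln n \<ge> 0" using lnn by simp
    then show ?thesis by (simp add: algebra_simps)
  qed
  finally show "ln (2 * real (card (grid_net n k))) \<le> 6 * k * (1 + ln n)" .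
qed

text \<open>The entries are tested with the exponential parameter \<theta> lam and the net with
  \<theta>. After division of the entry maximum by lam both variance terms equal
  \<open>16 * m * \<theta> / s0\<^sup>2\<close>, and both logarithmic terms are of order (1 + ln n)
  / (\<theta> lam^2), for the net because k lam^2 <= 1.\<close>

lemma width_bound:
  fixes m :: nat and lam T A \<theta> :: real
  assumes F: "finite F" "F \<noteq> {}" "F \<subseteq> good_matrices n k lam T A"
    and n: "n \<ge> 1" and k: "k \<ge> 1" "k \<le> n" and lam: "0 < lam" "lam \<le> 1" "real k * lam\<^sup>2 \<le> 1" and A: "A > 0"
    and \<theta>: "0 < \<theta>" "\<theta> \<le> s0 / 2"
  shows "(\<integral>p. (MAX H\<in>F. (\<Sum>i<m. 2 * (rsign (snd (p i)) * qf n H (fst (p i))))) \<partial>iid m (signed (N n)))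
    \<le> 28 * A * (1 + ln n) / (\<theta> * lam\<^sup>2) + 96 * A * m * \<theta> / s0\<^sup>2"
proof -
  let ?S = "signed (N n)"
  let ?P = "iid m ?S"
  have S: "prob_space ?S" by (rule prob_space_signed[OF prob_N])
  interpret P: prob_space ?P by (intro prob_space_PiM S)
  let ?I = "{..<n} \<times> {..<n}"
  define e where "e jl q = rsign (snd q) * (fst q (fst jl) * fst q (snd jl))" for jl :: "nat \<times> nat" and q :: "(nat \<Rightarrow> real) \<times> bool"
  define g where "g u q = rsign (snd q) * (dotp n u (fst q))\<^sup>2" for u and q :: "(nat \<Rightarrow> real) \<times> bool"
  define f where "f H q = 2 * (rsign (snd q) * qf n H (fst q))" for H and q :: "(nat \<Rightarrow> real) \<times> bool"
  have ei: "integrable ?S (e jl)" if "jl \<in> ?I" for jl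
    unfolding e_def using that by (intro integrable_signed[OF prob_N] integrable_coord2) auto
  have gi: "integrable ?S (g u)" for u
    unfolding g_def by (intro integrable_signed[OF prob_N] integrable_dotp2)
  have fi: "integrable ?S (f H)" for H
    unfolding f_def by (intro integrable_mult_right integrable_signed[OF prob_N] integrable_qf)
  have I: "finite ?I" "?I \<noteq> {}" using n by (auto simp: lessThan_empty_iff)
  have G: "finite (grid_net n k)" "grid_net n k \<noteq> {}" using finite_grid_net zero_in_grid_net[OF k(2)] by auto
  define E1 where "E1 p = (MAX jl\<in>?I. \<bar>\<Sum>i<m. e jl (p i)\<bar>)" for p
  define E2 where "E2 p = (MAX u\<in>grid_net n k. \<bar>\<Sum>i<m. g u (p i)\<bar>)" for p
  have iE1: "integrable ?P E1" unfolding E1_def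
    using ei S by (intro integrable_MAX I integrable_abs Bochner_Integration.integrable_sum) (auto intro!: integrable_PiM_component)
  have iE2: "integrable ?P E2" unfolding E2_def
    using gi S by (intro integrable_MAX G integrable_abs Bochner_Integration.integrable_sum) (auto intro!: integrable_PiM_component)
  have l1: "\<bar>\<theta> * lam\<bar> \<le> s0 / 2"
    using \<theta> lam mult_mono[of \<theta> "s0/2" lam 1] by (simp add: abs_mult)
  have b1: "(\<integral>p. E1 p \<partial>?P) \<le> (ln (2 * real (card ?I)) + m * (16 * (\<theta> * lam)\<^sup>2 / s0\<^sup>2)) / (\<theta> * lam)"
    unfolding E1_def
  proof (rule expected_MAX_abs_sum[OF S I ei])
    fix jl assume "jl \<in> ?I"
    then have jl: "fst jl < n" "snd jl < n" by auto
    show "(\<integral>\<^sup>+x. ennreal (exp (\<theta> * lam * e jl x)) \<partial>?S) \<le> ennreal (exp (16 * (\<theta> * lam)\<^sup>2 / s0\<^sup>2))"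
      unfolding e_def by (rule signed_entry_mgf[OF jl l1])
    have "\<bar>- (\<theta> * lam)\<bar> \<le> s0 / 2" using l1 by simp
    from signed_entry_mgf[OF jl this]
    show "(\<integral>\<^sup>+x. ennreal (exp (- (\<theta> * lam * e jl x))) \<partial>?S) \<le> ennreal (exp (16 * (\<theta> * lam)\<^sup>2 / s0\<^sup>2))"
      unfolding e_def by simp
  qed (use \<theta> lam in auto)
  have b2: "(\<integral>p. E2 p \<partial>?P) \<le> (ln (2 * real (card (grid_net n k))) + m * (16 * \<theta>\<^sup>2 / s0\<^sup>2)) / \<theta>"
    unfolding E2_def
  proof (rule expected_MAX_abs_sum[OF S G gi])
    fix u assume "u \<in> grid_net n k"
    then have u: "dotp n u u \<le> 3" by (simp add: grid_net_def)
    have l: "\<bar>\<theta>\<bar> \<le> s0 / 2" "\<bar>- \<theta>\<bar> \<le> s0 / 2" using \<theta> by auto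
    show "(\<integral>\<^sup>+x. ennreal (exp (\<theta> * g u x)) \<partial>?S) \<le> ennreal (exp (16 * \<theta>\<^sup>2 / s0\<^sup>2))"
      unfolding g_def by (rule signed_square_mgf[OF u l(1)])
    show "(\<integral>\<^sup>+x. ennreal (exp (- (\<theta> * g u x))) \<partial>?S) \<le> ennreal (exp (16 * \<theta>\<^sup>2 / s0\<^sup>2))"
      using signed_square_mgf[OF u l(2)] unfolding g_def by simp
  qed (use \<theta> in auto)
  have L: "0 \<le> 1 + ln (real n)" using n by (simp add: add_nonneg_nonneg)
  have c1: "(ln (2 * real (card ?I)) + m * (16 * (\<theta> * lam)\<^sup>2 / s0\<^sup>2)) / (\<theta> * lam) / lam
    \<le> 2 * (1 + ln n) / (\<theta> * lam\<^sup>2) + 16 * m * \<theta> / s0\<^sup>2"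
  proof -
    have "(ln (2 * real (card ?I)) + m * (16 * (\<theta> * lam)\<^sup>2 / s0\<^sup>2)) / (\<theta> * lam) / lam
      \<le> (2 * (1 + ln n) + m * (16 * (\<theta> * lam)\<^sup>2 / s0\<^sup>2)) / (\<theta> * lam) / lam"
      using \<theta> lam by (intro divide_right_mono add_right_mono log_net_bounds(1)[OF n k]) auto
    also have "\<dots> = 2 * (1 + ln n) / (\<theta> * lam\<^sup>2) + 16 * m * \<theta> / s0\<^sup>2"
      using \<theta> lam s0 by (simp add: add_divide_distrib power2_eq_square mult_ac)
    finally show ?thesis .
  qed
  have c2: "(ln (2 * real (card (grid_net n k))) + m * (16 * \<theta>\<^sup>2 / s0\<^sup>2)) / \<theta>
    \<le> 6 * (1 + ln n) / (\<theta> * lam\<^sup>2) + 16 * m * \<theta> / s0\<^sup>2"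
  proof -
    have kl: "real k \<le> 1 / lam\<^sup>2" using lam by (simp add: field_simps)
    have "ln (2 * real (card (grid_net n k))) \<le> 6 * k * (1 + ln n)" by (rule log_net_bounds) (use n k in auto)
    also have "\<dots> \<le> 6 * (1 / lam\<^sup>2) * (1 + ln n)" using kl L by (intro mult_right_mono mult_left_mono) auto
    finally have "(ln (2 * real (card (grid_net n k))) + m * (16 * \<theta>\<^sup>2 / s0\<^sup>2)) / \<theta>
      \<le> (6 * (1 / lam\<^sup>2) * (1 + ln n) + m * (16 * \<theta>\<^sup>2 / s0\<^sup>2)) / \<theta>"
      using \<theta> by (intro divide_right_mono add_right_mono) auto
    also have "\<dots> = 6 * (1 + ln n) / (\<theta> * lam\<^sup>2) + 16 * m * \<theta> / s0\<^sup>2"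
      using \<theta> lam s0 by (simp add: add_divide_distrib power2_eq_square mult_ac)
    finally show ?thesis .
  qed
  have "(\<integral>p. (MAX H\<in>F. (\<Sum>i<m. f H (p i))) \<partial>?P) \<le> (\<integral>p. 2 * A * (E1 p / lam + 2 * E2 p) \<partial>?P)"
  proof (rule integral_mono)
    show "integrable ?P (\<lambda>p. MAX H\<in>F. (\<Sum>i<m. f H (p i)))"
      using integrable_MAX_sum_PiM[OF S F(1,2) fi, where c="\<lambda>_. 0" and m=m] by simp
    show "integrable ?P (\<lambda>p. 2 * A * (E1 p / lam + 2 * E2 p))" using iE1 iE2 by auto
    fix p
    show "(MAX H\<in>F. (\<Sum>i<m. f H (p i))) \<le> 2 * A * (E1 p / lam + 2 * E2 p)"
      unfolding E1_def E2_def f_def e_def g_def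
      using F width_pointwise[OF _ n k, of _ lam T A p m] by (subst Max_le_iff) auto
  qed
  also have "\<dots> = 2 * A * ((\<integral>p. E1 p \<partial>?P) / lam + 2 * (\<integral>p. E2 p \<partial>?P))"
    using iE1 iE2 by simp
  also have "\<dots> \<le> 2 * A * ((2 * (1 + ln n) / (\<theta> * lam\<^sup>2) + 16 * m * \<theta> / s0\<^sup>2) + 2 * (6 * (1 + ln n) / (\<theta> * lam\<^sup>2) + 16 * m * \<theta> / s0\<^sup>2))"
    using A lam by (intro mult_left_mono add_mono order_trans[OF divide_right_mono[OF b1] c1] order_trans[OF b2 c2]) auto
  \<comment> \<open>The constants are 28 = 2 (2 + 2 * 6) and 96 = 2 (16 + 2 * 16).\<close>
  also have "\<dots> = 28 * A * (1 + ln n) / (\<theta> * lam\<^sup>2) + 96 * A * m * \<theta> / s0\<^sup>2"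
  proof -
    have g: "2 * A * ((2 * X + 16 * Y) + 2 * (6 * X + 16 * Y)) = 28 * A * X + 96 * A * Y" for X Y :: real by algebra
    have "2 * A * ((2 * x / d + 16 * y * \<theta> / s) + 2 * (6 * x / d + 16 * y * \<theta> / s)) = 28 * A * x / d + 96 * A * y * \<theta> / s"
      for x d y s :: real
      using g[of "x / d" "y * \<theta> / s"] by (simp only: times_divide_eq_right mult.assoc)
    then show ?thesis by (simp only: of_nat_mult of_nat_numeral)
  qed
  finally show ?thesis unfolding f_def .
qed

end

context subgaussian_law
begin

theorem uniform_lower_bound:
  assumes \<mu>4: "(\<integral>t. t ^ 4 \<partial>D) > 1" and T: "T > 0" and A: "A > 0"
  obtains q c0 C3 :: real where "q > 0" "c0 > 0" "C3 > 0"
    "\<forall>n k m lam. n \<ge> 1 \<longrightarrow> k \<ge> 1 \<longrightarrow> k \<le> n \<longrightarrow> 0 < lam \<longrightarrow> lam \<le> 1 \<longrightarrow> real k * lam\<^sup>2 \<le> 1 \<longrightarrow>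
       C3 * (1 + ln (real n)) / lam\<^sup>2 \<le> real m \<longrightarrow>
       (\<exists>E\<in>sets (iid m (N n)). 1 - exp (- c0 * m) \<le> measure (iid m (N n)) E \<and>
         (\<forall>x\<in>E. \<forall>H\<in>good_matrices n k lam T A. q * m \<le> (\<Sum>i<m. \<bar>qf n H (x i)\<bar>)))"
proof -
  define \<kappa> where "\<kappa> = min 2 ((\<integral>t. t ^ 4 \<partial>D) - 1)"
  define C4 where "C4 = 96 * T ^ 4 / s0 ^ 4"
  \<comment> \<open>Makes \<open>C4 / M\<^sup>2\<close> equal to \<kappa> / 2.\<close>
  define M where "M = sqrt (2 * C4 / \<kappa>)"
  define q where "q = \<kappa> / (2 * M)"
  \<comment> \<open>The width may be q / 4 per sample. This \<theta> keeps its variance part below q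
    / 8 (96 * 8 = 768), and \<open>C3\<close> keeps its logarithmic part below q / 8 (28 * 8 =
    224).\<close>
  define \<theta> where "\<theta> = min (s0 / 2) (q * s0\<^sup>2 / (768 * A))"
  define C3 where "C3 = 224 * A / (\<theta> * q)"
  define c0 where "c0 = q\<^sup>2 / (8 * M\<^sup>2)"
  have \<kappa>: "0 < \<kappa>" "\<kappa> \<le> 2" "\<kappa> \<le> (\<integral>t. t ^ 4 \<partial>D) - 1" using \<mu>4 by (auto simp: \<kappa>_def)
  have C4: "C4 > 0" using T s0 by (simp add: C4_def)
  have M: "M > 0" using C4 \<kappa> by (simp add: M_def)
  have M2: "96 * T ^ 4 / s0 ^ 4 / M\<^sup>2 \<le> \<kappa> / 2"
    unfolding C4_def[symmetric] using C4 \<kappa> by (simp add: M_def)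
  have q: "q > 0" using \<kappa> M by (simp add: q_def)
  have \<theta>: "0 < \<theta>" "\<theta> \<le> s0 / 2" "\<theta> \<le> q * s0\<^sup>2 / (768 * A)" using s0 q A by (auto simp: \<theta>_def)
  have C3: "C3 > 0" using A \<theta> q by (simp add: C3_def)
  have c0: "c0 > 0" using q M by (simp add: c0_def)
  show ?thesis
  proof (rule that[of "q / 2" c0 C3])
    show "\<forall>n k m lam. n \<ge> 1 \<longrightarrow> k \<ge> 1 \<longrightarrow> k \<le> n \<longrightarrow> 0 < lam \<longrightarrow> lam \<le> 1 \<longrightarrow> real k * lam\<^sup>2 \<le> 1 \<longrightarrow>
       C3 * (1 + ln (real n)) / lam\<^sup>2 \<le> real m \<longrightarrow>
       (\<exists>E\<in>sets (iid m (N n)). 1 - exp (- c0 * m) \<le> measure (iid m (N n)) E \<and>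
         (\<forall>x\<in>E. \<forall>H\<in>good_matrices n k lam T A. q / 2 * m \<le> (\<Sum>i<m. \<bar>qf n H (x i)\<bar>)))"
    proof (intro allI impI)
    fix n k m :: nat and lam :: real
    assume n: "n \<ge> 1" and k: "k \<ge> 1" "k \<le> n" and lam: "0 < lam" "lam \<le> 1" "real k * lam\<^sup>2 \<le> 1"
      and m: "C3 * (1 + ln (real n)) / lam\<^sup>2 \<le> real m"
    let ?P = "iid m (N n)"
    let ?G = "good_matrices n k lam T A"
    interpret P: prob_space ?P by (intro prob_space_PiM prob_N)
    have width: "(\<integral>p. (MAX H\<in>F. (\<Sum>i<m. 2 * (rsign (snd (p i)) * qf n H (fst (p i))))) \<partial>iid m (signed (N n))) \<le> m * q / 4"
      if F: "finite F" "F \<noteq> {}" "F \<subseteq> ?G" for F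
    proof -
      have "28 * A * (1 + ln n) / (\<theta> * lam\<^sup>2) = (\<theta> * q / 224 * 28 / \<theta>) * (C3 * (1 + ln (real n)) / lam\<^sup>2)"
        using \<theta> q lam A by (simp add: C3_def)
      also have "\<theta> * q / 224 * 28 / \<theta> = q / 8" using \<theta> by simp
      also have "q / 8 * (C3 * (1 + ln (real n)) / lam\<^sup>2) \<le> q / 8 * m" using q m by (intro mult_left_mono) auto
      finally have 1: "28 * A * (1 + ln n) / (\<theta> * lam\<^sup>2) \<le> q / 8 * m" .
      have "96 * A * m * \<theta> / s0\<^sup>2 = (96 * A * m / s0\<^sup>2) * \<theta>" by simp
      also have "\<dots> \<le> (96 * A * m / s0\<^sup>2) * (q * s0\<^sup>2 / (768 * A))" using A by (intro mult_left_mono \<theta>) auto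
      also have "\<dots> = q / 8 * m" using A s0 by simp
      finally have 2: "96 * A * m * \<theta> / s0\<^sup>2 \<le> q / 8 * m" .
      have "q / 8 * m + q / 8 * m = m * q / 4" by simp
      then show ?thesis using order_trans[OF width_bound[OF F n k lam A \<theta>(1,2), of m] add_mono[OF 1 2]] by (simp add: mult.commute)
    qed
    define good where "good H x \<longleftrightarrow> m * q / 2 \<le> (\<Sum>i<m. min \<bar>qf n H (x i)\<bar> M)" for H x
    have fin: "1 - exp (- c0 * m) \<le> measure ?P {x \<in> space ?P. \<forall>H\<in>F. good H x}"
      and finm: "{x \<in> space ?P. \<forall>H\<in>F. good H x} \<in> sets ?P"
      if F: "finite F" "F \<noteq> {}" "F \<subseteq> ?G" for F
    proof -
      let ?B = "{x \<in> space ?P. \<exists>h\<in>F. (\<Sum>i<m. min \<bar>qf n h (x i)\<bar> M) < m * q / 2}"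
      have gm: "{x \<in> space ?P. good H x} \<in> sets ?P" for H
        unfolding good_def by measurable
      show s: "{x \<in> space ?P. \<forall>H\<in>F. good H x} \<in> sets ?P"
        using F gm by (intro sets.sets_Collect_finite_All) auto
      have c: "{x \<in> space ?P. \<forall>H\<in>F. good H x} = space ?P - ?B" by (auto simp: good_def not_less)
      have B: "?B = space ?P - {x \<in> space ?P. \<forall>H\<in>F. good H x}" by (auto simp: good_def not_le)
      have Bm: "?B \<in> sets ?P" unfolding B using s by blast
      have "measure ?P ?B \<le> exp (- (q\<^sup>2 / (8 * M\<^sup>2)) * m)"
        using F \<kappa> M M2 q
        by (intro uniform_small_ball prob_N integrable_qf width) (auto simp: q_def intro!: small_ball_expectation)
      then show "1 - exp (- c0 * m) \<le> measure ?P {x \<in> space ?P. \<forall>H\<in>F. good H x}"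
        unfolding c P.prob_compl[OF Bm] c0_def by simp
    qed
    show "\<exists>E\<in>sets ?P. 1 - exp (- c0 * m) \<le> measure ?P E \<and> (\<forall>x\<in>E. \<forall>H\<in>?G. q / 2 * m \<le> (\<Sum>i<m. \<bar>qf n H (x i)\<bar>))"
    proof (cases "?G = {}")
      case True
      then show ?thesis by (intro bexI[of _ "space ?P"]) (auto simp: P.prob_space)
    next
      case False
      \<comment> \<open>The events of the finite initial segments of an enumeration of
        \<open>Q\<close> decrease, and each has the same lower bound on its probability, so their
        intersection inherits it.\<close>
      obtain Q where Q: "countable Q" "Q \<subseteq> ?G" "?G \<subseteq> closure Q" using separable[of ?G] by blast
      then have Q0: "Q \<noteq> {}" using False by auto
      define f where "f = from_nat_into Q"
      have f: "range f = Q" unfolding f_def using Q0 Q(1) by (rule range_from_nat_into)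
      define E where "E j = {x \<in> space ?P. \<forall>H\<in>f ` {..j}. good H x}" for j :: nat
      have sub: "f ` {..j} \<subseteq> ?G" for j using f Q(2) by blast
      have Em: "E j \<in> sets ?P" for j unfolding E_def by (intro finm sub) auto
      have Ep: "1 - exp (- c0 * m) \<le> measure ?P (E j)" for j unfolding E_def by (intro fin sub) auto
      have "decseq E" unfolding decseq_def E_def by auto
      then have "(\<lambda>j. measure ?P (E j)) \<longlonglongrightarrow> measure ?P (\<Inter>j. E j)"
        using Em by (intro P.finite_Lim_measure_decseq) auto
      then have 1: "1 - exp (- c0 * m) \<le> measure ?P (\<Inter>j. E j)"
        by (rule LIMSEQ_le_const) (use Ep in auto)
      have 2: "q / 2 * m \<le> (\<Sum>i<m. \<bar>qf n H (x i)\<bar>)" if x: "x \<in> (\<Inter>j. E j)" and H: "H \<in> ?G" for x H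
      proof -
        have "good (f j) x" for j using x unfolding E_def by auto
        then have "Q \<subseteq> {H. good H x}" using f by auto
        \<comment> \<open>The topology is that of entrywise convergence, and for fixed
          \<open>x\<close> the truncated sum depends continuously on finitely many entries of
          \<open>H\<close>.\<close>
        moreover have "closed {H. good H x}" unfolding good_def
        proof (rule closed_Collect_le)
          have c: "continuous_on UNIV (\<lambda>H::nat \<Rightarrow> nat \<Rightarrow> real. H j l)" for j l
            by (rule continuous_on_product_then_coordinatewise[OF continuous_on_product_coordinates])
          show "continuous_on UNIV (\<lambda>H. \<Sum>i<m. min \<bar>qf n H (x i)\<bar> M)"
            unfolding qf_def by (intro continuous_intros continuous_on_min c)
        qed (rule continuous_on_const)
        ultimately have "closure Q \<subseteq> {H. good H x}" by (rule closure_minimal)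
        then have "good H x" using H Q(3) by blast
        then have "m * q / 2 \<le> (\<Sum>i<m. min \<bar>qf n H (x i)\<bar> M)" by (simp add: good_def)
        also have "\<dots> \<le> (\<Sum>i<m. \<bar>qf n H (x i)\<bar>)" by (intro sum_mono) auto
        finally show ?thesis by (simp add: mult.commute)
      qed
      show ?thesis using Em 1 2 by (intro bexI[of _ "\<Inter>j. E j"]) auto
    qed
    qed
  qed (use q c0 C3 in auto)
qed

end

section \<open>From independent entries to independent rows\<close>

definition sample_rows :: "nat \<Rightarrow> nat \<Rightarrow> (nat \<times> nat \<Rightarrow> real) \<Rightarrow> nat \<Rightarrow> nat \<Rightarrow> real" where
  "sample_rows m n w = (\<lambda>i\<in>{..<m}. \<lambda>j\<in>{..<n}. w (i, j))"

lemma measurable_sample_rows [measurable]: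
  "sample_rows m n \<in> sample_space m n D \<rightarrow>\<^sub>M iid m (iid n D)"
  unfolding sample_rows_def sample_space_def
  by (intro measurable_restrict measurable_component_singleton) auto

text \<open>Grouping independent variables into disjoint blocks gives independent rows, and
  reindexing one block identifies the law of a row. Positive \<open>m\<close> and \<open>n\<close>
  make the index sets nonempty, as the characterisation of independence by the joint law
  requires.\<close>

lemma distr_sample_rows:
  assumes D: "prob_space D" and m: "m \<ge> 1" "n \<ge> 1"
  shows "distr (sample_space m n D) (iid m (iid n D)) (sample_rows m n)
    = iid m (iid n D)"
proof -
  let ?I = "{..<m} \<times> {..<n}"
  let ?S = "Pi\<^sub>M ?I (\<lambda>_. D)" and ?N = "iid n D"
  interpret S: prob_space ?S by (intro prob_space_PiM D)
  have ind: "S.indep_vars (\<lambda>_. D) (\<lambda>ij w. w ij) ?I"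
  proof -
    have ne: "?I \<noteq> {}" using m by (auto simp: lessThan_empty_iff)
    have "distr ?S ?S (\<lambda>x. \<lambda>ij\<in>?I. x ij) = distr ?S ?S (\<lambda>x. x)"
      by (intro distr_cong refl) (auto simp: space_PiM PiE_def extensional_restrict)
    also have "\<dots> = ?S" by (rule distr_id)
    also have "\<dots> = Pi\<^sub>M ?I (\<lambda>ij. distr ?S D (\<lambda>w. w ij))"
      by (intro PiM_cong refl distr_PiM_component[symmetric] D)
    finally show ?thesis
      using ne by (subst S.indep_vars_iff_distr_eq_PiM') auto
  qed
  have "S.indep_vars (\<lambda>i. Pi\<^sub>M ({i} \<times> {..<n}) (\<lambda>_. D)) (\<lambda>i w. \<lambda>ij\<in>{i} \<times> {..<n}. w ij) {..<m}"
    by (rule S.indep_vars_restrict[OF ind]) (auto simp: disjoint_family_on_def)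
  then have "S.indep_vars (\<lambda>_. ?N) (\<lambda>i w. (\<lambda>v. \<lambda>j\<in>{..<n}. v (i, j)) (\<lambda>ij\<in>{i} \<times> {..<n}. w ij)) {..<m}"
    by (rule S.indep_vars_compose2) (intro measurable_restrict measurable_component_singleton, auto)
  also have "(\<lambda>i w. (\<lambda>v. \<lambda>j\<in>{..<n}. v (i, j)) (\<lambda>ij\<in>{i} \<times> {..<n}. w ij)) = (\<lambda>i w. \<lambda>j\<in>{..<n}. w (i, j))"
    by (auto simp: fun_eq_iff restrict_def)
  finally have ind': "S.indep_vars (\<lambda>_. ?N) (\<lambda>i w. \<lambda>j\<in>{..<n}. w (i, j)) {..<m}" .
  have marg: "distr ?S ?N (\<lambda>w. \<lambda>j\<in>{..<n}. w (i, j)) = ?N" if "i < m" for i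
    using distr_PiM_reindex[of ?I "\<lambda>_. D" "\<lambda>j. (i, j)" "{..<n}"] D that by (auto simp: inj_on_def)
  have rv: "(\<lambda>w. \<lambda>j\<in>{..<n}. w (i, j)) \<in> ?S \<rightarrow>\<^sub>M ?N" if "i < m" for i
    using that by (intro measurable_restrict measurable_component_singleton) auto
  have "distr ?S (iid m ?N) (\<lambda>w. \<lambda>i\<in>{..<m}. \<lambda>j\<in>{..<n}. w (i, j))
    = Pi\<^sub>M {..<m} (\<lambda>i. distr ?S ?N (\<lambda>w. \<lambda>j\<in>{..<n}. w (i, j)))"
    using ind' m rv by (subst (asm) S.indep_vars_iff_distr_eq_PiM') (auto simp: lessThan_empty_iff)
  also have "\<dots> = iid m ?N" by (intro PiM_cong refl marg) auto
  finally show ?thesis unfolding sample_space_def sample_rows_def .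
qed

lemma subgaussian_entry_law_imp:
  assumes "subgaussian_entry_law D"
  obtains s0 where "subgaussian_law D s0" "(\<integral>t. t ^ 4 \<partial>D) > 1"
proof -
  from assms obtain K where D: "prob_space D" "sets D = sets borel" and K: "K > 0"
    and e: "(\<integral>\<^sup>+ t. ennreal (exp (t\<^sup>2 / K\<^sup>2)) \<partial>D) \<le> 2"
    and m: "integrable D (\<lambda>t. t)" "(\<integral> t. t \<partial>D) = 0" "integrable D (\<lambda>t. t\<^sup>2)" "(\<integral> t. t\<^sup>2 \<partial>D) = 1"
      "integrable D (\<lambda>t. t ^ 4)" and m4: "(\<integral> t. t ^ 4 \<partial>D) > 1"
    unfolding subgaussian_entry_law_def by blast
  interpret entry_law D by (rule entry_law.intro) fact+
  \<comment> \<open>The constant 4 of \<open>subgaussian_mgf\<close> times the bound 3 on the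
    squared norm.\<close>
  define c where "c = 12 * K\<^sup>2"
  have c: "c > 0" using K by (simp add: c_def)
  have "subgaussian_law D (1 / (8 * c * exp 1))"
  proof (rule subgaussian_law.intro[OF entry_law_axioms], rule subgaussian_law_axioms.intro)
    show "1 / (8 * c * exp 1) > 0" using c by simp
    fix n w assume w: "dotp n w w \<le> 3"
    have mgf: "(\<integral>\<^sup>+ a. ennreal (exp (\<theta> * dotp n w a)) \<partial>N n) \<le> ennreal (exp (c * \<theta>\<^sup>2))" for \<theta>
    proof -
      have "(\<integral>\<^sup>+ a. ennreal (exp (\<theta> * dotp n w a)) \<partial>N n) \<le> ennreal (exp (4 * K\<^sup>2 * \<theta>\<^sup>2 * dotp n w w))"
        using subgaussian_mgf[OF D K e m(1,2)] by (intro subgaussian_linear_form_mgf D)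
      also have "\<dots> \<le> ennreal (exp (4 * K\<^sup>2 * \<theta>\<^sup>2 * 3))"
        by (intro ennreal_leI exp_le_cancel_iff[THEN iffD2] mult_left_mono w) auto
      finally show ?thesis by (simp add: c_def mult_ac)
    qed
    show "(\<integral>\<^sup>+ a. ennreal (exp (1 / (8 * c * exp 1) * (dotp n w a)\<^sup>2)) \<partial>N n) \<le> 4"
      using square_exp_integrable[OF prob_N measurable_dotp c mgf] by simp
  qed
  then show ?thesis using that m4 by blast
qed

section \<open>Positive semidefinite factorization and the nuclear norm\<close>

lemma psd_qf: "psd n M \<Longrightarrow> 0 \<le> qf n M v"
  by (simp add: psd_def qf_def)

lemma linear_nonneg_imp_zero:
  fixes Q L :: real
  assumes "\<And>y. 0 \<le> Q + 2 * y * L"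
  shows "L = 0"
proof (rule ccontr)
  assume L: "L \<noteq> 0"
  have "0 \<le> Q + 2 * (- (Q + 1) / (2 * L)) * L" by (rule assms)
  also have "\<dots> = -1" using L by (simp add: field_simps)
  finally show False by simp
qed

text \<open>A Cholesky step: the Schur complement of the last diagonal entry is again positive
  semidefinite. If that entry is 0, its column vanishes and division by 0 turns the correction into
  0, so the same formulas remain valid.\<close>

lemma psd_factorization:
  assumes "psd n M"
  shows "\<exists>y::nat \<Rightarrow> nat \<Rightarrow> real. \<forall>i<n. \<forall>j<n. M i j = (\<Sum>r<n. y r i * y r j)"
  using assms
proof (induction n arbitrary: M)
  case 0
  then show ?case by simp
next
  case (Suc n)
  define c where "c = M n n"
  define h where "h = (\<lambda>j. M j n)"
  have sym: "M i j = M j i" if "i < Suc n" "j < Suc n" for i j using Suc.prems that by (auto simp: psd_def)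
  have nn: "0 \<le> qf n M x + 2 * y * dotp n h x + c * y\<^sup>2" for x y
    using psd_qf[OF Suc.prems, of "x(n := y)"] qf_upd[of n M x y] sym unfolding h_def c_def by simp
  have c0: "0 \<le> c" using nn[of "\<lambda>_. 0" 1] by (simp add: qf_def dotp_def)
  have Q0: "0 \<le> qf n M x" for x using nn[of x 0] by simp
  \<comment> \<open>With a vanishing diagonal entry the form is affine in the last coordinate; being
    nonnegative it has slope 0.\<close>
  have hz: "h i = 0" if "c = 0" "i < n" for i
  proof -
    have "dotp n h (\<lambda>j. if j = i then 1 else 0) = 0"
      by (rule linear_nonneg_imp_zero) (use nn that in auto)
    then show ?thesis using that by (simp add: dotp_def if_distrib[of "\<lambda>x. _ * x"] cong: if_cong)
  qed
  define M' where "M' i j = M i j - h i * h j / c" for i j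
  have qM': "qf n M' x = qf n M x - (dotp n h x)\<^sup>2 / c" for x
  proof -
    have "(dotp n h x)\<^sup>2 = (\<Sum>i<n. \<Sum>j<n. x i * (h i * h j) * x j)"
      by (simp add: dotp_def power2_eq_square sum_product mult_ac)
    then show ?thesis
      by (simp add: qf_def M'_def algebra_simps sum_subtractf sum_divide_distrib)
  qed
  have "psd n M'" unfolding psd_def
  proof (intro conjI allI impI)
    fix i j assume "i < n" "j < n" then show "M' i j = M' j i" using sym by (simp add: M'_def mult.commute)
  next
    fix v
    have "0 \<le> qf n M' v"
    proof (cases "c = 0")
      case True then show ?thesis using Q0 by (simp add: qM')
    next
      case False
      \<comment> \<open>The last coordinate that minimises the form; the minimum is the value of the
        Schur complement at \<open>v\<close>.\<close>
      then show ?thesis using nn[of v "- dotp n h v / c"]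
        by (simp add: qM' power2_eq_square field_simps)
    qed
    then show "0 \<le> (\<Sum>i<n. \<Sum>j<n. v i * M' i j * v j)" by (simp add: qf_def)
  qed
  from Suc.IH[OF this] obtain y where y: "\<And>i j. i < n \<Longrightarrow> j < n \<Longrightarrow> M' i j = (\<Sum>r<n. y r i * y r j)" by blast
  \<comment> \<open>The factors of the Schur complement are extended by 0, and the normalised last
    column is added.\<close>
  define z where "z r = (if r < n then (y r)(n := 0) else (\<lambda>i. M i n / sqrt c))" for r
  have "M i j = (\<Sum>r<Suc n. z r i * z r j)" if ij: "i < Suc n" "j < Suc n" for i j
  proof -
    have zn: "z n i * z n j = M i n * M j n / c" using c0 by (simp add: z_def)
    have "(\<Sum>r<n. z r i * z r j) = (if i < n \<and> j < n then M' i j else 0)"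
      using y[of i j] ij by (auto simp: z_def less_Suc_eq intro!: sum.cong)
    then have e: "(\<Sum>r<Suc n. z r i * z r j) = (if i < n \<and> j < n then M' i j else 0) + M i n * M j n / c"
      using zn by simp
    show ?thesis
    proof (cases "i < n \<and> j < n")
      case True
      then show ?thesis unfolding e by (simp add: M'_def h_def)
    next
      case False
      then consider "i = n" | "j = n" using ij by linarith
      then have "M i n * M j n / c = M i j"
      proof cases
        case 1
        then show ?thesis using hz[of j] ij sym[of n j] c0 unfolding h_def c_def
          by (cases "M n n = 0") (auto simp: less_Suc_eq)
      next
        case 2
        then show ?thesis using hz[of i] ij sym[of n i] c0 unfolding h_def c_def
          by (cases "M n n = 0") (auto simp: less_Suc_eq)
      qed
      then show ?thesis unfolding e if_not_P[OF False] by simp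
    qed
  qed
  then show ?case by blast
qed

section \<open>Singular value decompositions and the nuclear norm of a rank-two matrix\<close>

lemma orthonormal_family_dotp:
  "orthonormal_family n u \<longleftrightarrow> (\<forall>r<n. \<forall>s<n. dotp n (u r) (u s) = (if r = s then 1 else 0))"
  by (simp add: orthonormal_family_def dotp_def)

lemma dotp_sum_right: "dotp n w (\<lambda>i. \<Sum>r\<in>I. c r * u r i) = (\<Sum>r\<in>I. c r * dotp n w (u r))"
proof -
  have "dotp n w (\<lambda>i. \<Sum>r\<in>I. c r * u r i) = (\<Sum>j<n. \<Sum>r\<in>I. c r * (w j * u r j))"
    by (simp add: dotp_def sum_distrib_left mult_ac)
  also have "\<dots> = (\<Sum>r\<in>I. \<Sum>j<n. c r * (w j * u r j))" by (rule sum.swap)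
  also have "\<dots> = (\<Sum>r\<in>I. c r * dotp n w (u r))" by (simp add: dotp_def sum_distrib_left)
  finally show ?thesis .
qed

lemma Bessel_inequality:
  assumes u: "orthonormal_family n u"
  shows "(\<Sum>r<n. (dotp n (u r) z)\<^sup>2) \<le> dotp n z z"
proof -
  define c where "c r = dotp n (u r) z" for r
  define y where "y = (\<lambda>i. \<Sum>r<n. c r * u r i)"
  have yz: "dotp n z y = (\<Sum>r<n. (c r)\<^sup>2)"
    unfolding y_def dotp_sum_right by (simp add: c_def power2_eq_square dotp_commute[of n z])
  have "dotp n y y = (\<Sum>r<n. c r * dotp n y (u r))" unfolding y_def by (rule dotp_sum_right)
  also have "\<dots> = (\<Sum>r<n. c r * c r)"
  proof (intro sum.cong refl arg_cong2[where f="(*)"])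
    fix r assume r: "r \<in> {..<n}"
    have "dotp n y (u r) = (\<Sum>s<n. c s * dotp n (u r) (u s))"
      unfolding dotp_commute[of n y] unfolding y_def by (rule dotp_sum_right)
    also have "\<dots> = (\<Sum>s<n. if s = r then c s else 0)"
      using u r unfolding orthonormal_family_dotp by (intro sum.cong) auto
    also have "\<dots> = c r" using r by simp
    finally show "dotp n y (u r) = c r" .
  qed
  finally have yy: "dotp n y y = (\<Sum>r<n. (c r)\<^sup>2)" by (simp add: power2_eq_square)
  have "0 \<le> dotp n (\<lambda>i. z i - y i) (\<lambda>i. z i - y i)" by simp
  also have "\<dots> = dotp n z z - 2 * dotp n z y + dotp n y y"
    unfolding dotp_linear by (simp add: dotp_commute[of n y z])
  finally show ?thesis using yz yy by (simp add: c_def)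
qed

definition is_svd :: "nat \<Rightarrow> (nat \<Rightarrow> nat \<Rightarrow> real) \<Rightarrow> (nat \<Rightarrow> real) \<Rightarrow> (nat \<Rightarrow> nat \<Rightarrow> real) \<Rightarrow> (nat \<Rightarrow> nat \<Rightarrow> real) \<Rightarrow> bool" where
  "is_svd n A \<sigma> u v \<longleftrightarrow> orthonormal_family n u \<and> orthonormal_family n v \<and> (\<forall>r<n. 0 \<le> \<sigma> r) \<and>
      (\<forall>i<n. \<forall>j<n. A i j = (\<Sum>r<n. \<sigma> r * u r i * v r j))"

lemma svd_bf:
  assumes "is_svd n A \<sigma> u v"
  shows "bf n A x y = (\<Sum>r<n. \<sigma> r * (dotp n x (u r) * dotp n y (v r)))"
proof -
  have "bf n A x y = (\<Sum>i<n. \<Sum>j<n. \<Sum>r<n. \<sigma> r * ((x i * u r i) * (y j * v r j)))"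
    using assms by (simp add: bf_def is_svd_def sum_distrib_left sum_distrib_right mult_ac)
  also have "\<dots> = (\<Sum>i<n. \<Sum>r<n. \<Sum>j<n. \<sigma> r * ((x i * u r i) * (y j * v r j)))"
    by (intro sum.cong refl sum.swap)
  also have "\<dots> = (\<Sum>r<n. \<Sum>i<n. \<Sum>j<n. \<sigma> r * ((x i * u r i) * (y j * v r j)))" by (rule sum.swap)
  also have "\<dots> = (\<Sum>r<n. \<sigma> r * (dotp n x (u r) * dotp n y (v r)))"
  proof (rule sum.cong[OF refl])
    fix r
    have "dotp n x (u r) * dotp n y (v r) = (\<Sum>i<n. \<Sum>j<n. (x i * u r i) * (y j * v r j))"
      unfolding dotp_def sum_product ..
    then show "(\<Sum>i<n. \<Sum>j<n. \<sigma> r * ((x i * u r i) * (y j * v r j))) = \<sigma> r * (dotp n x (u r) * dotp n y (v r))"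
      by (simp only: sum_distrib_left)
  qed
  finally show ?thesis .
qed

text \<open>Used in both directions, it makes the definite description in
  \<open>nuclear_norm\<close> meaningful. Testing \<open>A\<close> on the singular vectors of the
  first decomposition returns its singular values; expanded in the second, each
  \<open>\<sigma>' s\<close> gets a coefficient at most 1 by Bessel's inequality.\<close>

lemma svd_sum_le:
  assumes 1: "is_svd n A \<sigma> u v" and 2: "is_svd n A \<sigma>' u' v'"
  shows "(\<Sum>r<n. \<sigma> r) \<le> (\<Sum>r<n. \<sigma>' r)"
proof -
  have uv: "orthonormal_family n u" "orthonormal_family n v" using 1 by (auto simp: is_svd_def)
  have "(\<Sum>r<n. \<sigma> r) = (\<Sum>r<n. bf n A (u r) (v r))"
  proof (rule sum.cong[OF refl])
    fix r assume r: "r \<in> {..<n}"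
    have "bf n A (u r) (v r) = (\<Sum>s<n. \<sigma> s * (dotp n (u r) (u s) * dotp n (v r) (v s)))" by (rule svd_bf[OF 1])
    also have "\<dots> = (\<Sum>s<n. if s = r then \<sigma> s else 0)"
      using uv r unfolding orthonormal_family_dotp by (intro sum.cong) auto
    also have "\<dots> = \<sigma> r" using r by simp
    finally show "\<sigma> r = bf n A (u r) (v r)" by simp
  qed
  also have "\<dots> = (\<Sum>r<n. \<Sum>s<n. \<sigma>' s * (dotp n (u r) (u' s) * dotp n (v r) (v' s)))"
    unfolding svd_bf[OF 2] ..
  also have "\<dots> = (\<Sum>s<n. \<Sum>r<n. \<sigma>' s * (dotp n (u r) (u' s) * dotp n (v r) (v' s)))" by (rule sum.swap)
  also have "\<dots> \<le> (\<Sum>s<n. \<sigma>' s)"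
  proof (rule sum_mono)
    fix s assume s: "s \<in> {..<n}"
    have n1: "dotp n (u' s) (u' s) = 1" "dotp n (v' s) (v' s) = 1"
      using 2 s by (auto simp: is_svd_def orthonormal_family_dotp)
    have "(\<Sum>r<n. dotp n (u r) (u' s) * dotp n (v r) (v' s)) \<le> (\<Sum>r<n. ((dotp n (u r) (u' s))\<^sup>2 + (dotp n (v r) (v' s))\<^sup>2) / 2)"
    proof (rule sum_mono)
      fix r
      show "dotp n (u r) (u' s) * dotp n (v r) (v' s) \<le> ((dotp n (u r) (u' s))\<^sup>2 + (dotp n (v r) (v' s))\<^sup>2) / 2"
        using sum_squares_bound[of "dotp n (u r) (u' s)" "dotp n (v r) (v' s)"] by simp
    qed
    also have "\<dots> = ((\<Sum>r<n. (dotp n (u r) (u' s))\<^sup>2) + (\<Sum>r<n. (dotp n (v r) (v' s))\<^sup>2)) / 2"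
      by (simp only: sum.distrib sum_divide_distrib[symmetric])
    also have "\<dots> \<le> (1 + 1) / 2"
      using Bessel_inequality[OF uv(1), of "u' s"] Bessel_inequality[OF uv(2), of "v' s"] n1
      by (intro divide_right_mono add_mono) auto
    finally have "(\<Sum>r<n. dotp n (u r) (u' s) * dotp n (v r) (v' s)) \<le> 1" by simp
    then have "\<sigma>' s * (\<Sum>r<n. dotp n (u r) (u' s) * dotp n (v r) (v' s)) \<le> \<sigma>' s * 1"
      using 2 s by (intro mult_left_mono) (auto simp: is_svd_def)
    then show "(\<Sum>r<n. \<sigma>' s * (dotp n (u r) (u' s) * dotp n (v r) (v' s))) \<le> \<sigma>' s"
      by (simp only: sum_distrib_left mult_1_right)
  qed
  finally show ?thesis .
qed

lemma nuclear_norm_eq: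
  assumes "is_svd n A \<sigma> u v"
  shows "nuclear_norm n A = (\<Sum>r<n. \<sigma> r)"
proof -
  have "nuclear_norm n A = (THE s. \<exists>\<sigma> u v. is_svd n A \<sigma> u v \<and> s = (\<Sum>r<n. \<sigma> r))"
    by (simp add: nuclear_norm_def is_svd_def conj_assoc)
  also have "\<dots> = (\<Sum>r<n. \<sigma> r)"
    using assms svd_sum_le by (intro the_equality) (auto intro: antisym)
  finally show ?thesis .
qed

lemma orthonormal_family_std: "orthonormal_family n (\<lambda>r j. if j = r then 1 else 0)"
proof -
  have "(\<Sum>j<n. (if j = r then 1 else 0) * (if j = s then 1 else 0)) = (if r = s then 1 else (0::real))" if "r < n" for r s
  proof -
    have "(\<Sum>j<n. (if j = r then 1 else 0) * (if j = s then 1 else 0)) = (\<Sum>j<n. if j = r then (if r = s then 1 else 0) else (0::real))"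
      by (intro sum.cong) auto
    then show ?thesis using that by simp
  qed
  then show ?thesis by (auto simp: orthonormal_family_def)
qed

text \<open>The reflection exchanging \<open>u k\<close> and \<open>e\<close> fixes the earlier members.\<close>

lemma orthonormal_family_replace:
  assumes u: "orthonormal_family n u" and k: "k < n"
    and e: "dotp n e e = 1" "\<And>i. i < k \<Longrightarrow> dotp n (u i) e = 0"
  obtains u' where "orthonormal_family n u'" "\<And>i j. i < k \<Longrightarrow> u' i j = u i j" "\<And>j. j < n \<Longrightarrow> u' k j = e j"
proof -
  define w where "w = (\<lambda>j. u k j - e j)"
  define d where "d = dotp n w w"
  have uo: "dotp n (u r) (u s) = (if r = s then 1 else 0)" if "r < n" "s < n" for r s
    using u that by (simp add: orthonormal_family_dotp)
  have wu: "dotp n w (u k) = 1 - dotp n (u k) e"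
    unfolding w_def dotp_linear using uo[OF k k] by (simp add: dotp_commute[of n e "u k"])
  \<comment> \<open>This makes the reflection coefficient \<open>t k\<close> below equal to 1, so
    that \<open>u k\<close> is sent to \<open>u k - w\<close>, which is \<open>e\<close>.\<close>
  have d2: "d = 2 * dotp n w (u k)"
    unfolding d_def wu unfolding w_def dotp_linear using uo[OF k k] e(1) by (simp add: dotp_commute[of n e "u k"])
  show ?thesis
  proof (cases "d = 0")
    case True
    then have "w j = 0" if "j < n" for j using square_le_dotp[OF that, of w] by (simp add: d_def)
    then show ?thesis using that[of u] u by (auto simp: w_def)
  next
    case False
    define t where "t r = 2 * dotp n w (u r) / d" for r
    define u' where "u' r = (\<lambda>j. u r j - t r * w j)" for r
    have "dotp n (u' r) (u' s) = dotp n (u r) (u s)" for r s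
    proof -
      have "dotp n (u' r) (u' s) = dotp n (u r) (u s) - t s * dotp n w (u r) - t r * dotp n w (u s) + t r * t s * d"
        unfolding u'_def dotp_linear d_def by (simp add: dotp_commute[of n "u r" w] algebra_simps)
      also have "t r * t s * d = t r * (2 * dotp n w (u s))" using False by (simp add: t_def)
      also have "t s * dotp n w (u r) = t r * dotp n w (u s)" by (simp add: t_def)
      finally show ?thesis by simp
    qed
    then have "orthonormal_family n u'" using u by (simp add: orthonormal_family_dotp)
    moreover have "u' i j = u i j" if "i < k" for i j
    proof -
      have "dotp n w (u i) = 0"
        unfolding w_def dotp_linear using uo[of k i] e(2)[OF that] that k by (simp add: dotp_commute[of n e "u i"])
      then show ?thesis by (simp add: u'_def t_def)
    qed
    moreover have "t k = 1" using False d2 by (simp add: t_def)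
    then have "u' k j = e j" for j by (simp add: u'_def w_def)
    ultimately show ?thesis using that by blast
  qed
qed

text \<open>On the span of the orthogonal vectors \<open>p\<close>, \<open>q\<close>, with squared
  norms a and b, the matrix has as eigenvalues the roots of t^2 - b t - a b. They have opposite
  signs, so the nuclear norm is their difference, the square root of the discriminant.\<close>

lemma nuclear_norm_rank_two:
  assumes pq: "dotp n p q = 0" and p: "dotp n p p > 0"
    and Z: "\<And>i j. i < n \<Longrightarrow> j < n \<Longrightarrow> Z i j = p i * q j + q i * p j + q i * q j"
  shows "nuclear_norm n Z = sqrt ((dotp n q q)\<^sup>2 + 4 * dotp n p p * dotp n q q)"
proof (cases "dotp n q q = 0")
  case True
  then have "q i = 0" if "i < n" for i using square_le_dotp[OF that, of q] by simp
  then have "is_svd n Z (\<lambda>_. 0) (\<lambda>r j. if j = r then 1 else 0) (\<lambda>r j. if j = r then 1 else 0)"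
    using orthonormal_family_std Z by (simp add: is_svd_def)
  from nuclear_norm_eq[OF this] show ?thesis using True by simp
next
  case False
  define a b where "a = dotp n p p" and "b = dotp n q q"
  have a: "a > 0" using p by (simp add: a_def)
  have b: "b > 0" using False dotp_self_nonneg[of n q] unfolding b_def by linarith
  have n2: "n \<ge> 2"
  proof (rule ccontr)
    assume "\<not> n \<ge> 2"
    then consider "n = 0" | "n = 1" by linarith
    then show False
    proof cases
      case 1 then show False using p by (simp add: dotp_def)
    next
      case 2 then show False using pq a b by (auto simp: dotp_def a_def b_def)
    qed
  qed
  define s where "s = sqrt (b\<^sup>2 + 4 * a * b)"
  have s2: "s\<^sup>2 = b\<^sup>2 + 4 * a * b" using a b by (simp add: s_def)
  have s: "s > b"
  proof -
    have "sqrt (b\<^sup>2) < s" unfolding s_def using a b by (intro real_sqrt_less_mono) simp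
    then show ?thesis using b by simp
  qed
  define x where "x = (b + s) / 2"
  define y where "y = (b - s) / 2"
  have xy: "x + y = b" "x - y = s" "x > 0" "y < 0" using s b by (auto simp: x_def y_def field_simps)
  have xym: "x * y = - (a * b)" using s2 by (simp add: x_def y_def field_simps power2_eq_square)
  have norm: "dotp n (\<lambda>i. b * p i + c * q i) (\<lambda>i. b * p i + d * q i) = b * (a * b + c * d)" for c d
    unfolding dotp_linear using pq by (simp add: dotp_commute[of n q p] a_def b_def algebra_simps)
  \<comment> \<open>An eigenvector for the root t is b p + t q, and its squared norm is b |t|
    s.\<close>
  define f where "f = (\<lambda>i. 1 / sqrt (b * x * s) * (b * p i + x * q i))"
  define g where "g = (\<lambda>i. 1 / sqrt (b * (- y) * s) * (b * p i + y * q i))"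
  have s0: "s > 0" and y0: "0 < - y" using s b xy by auto
  have bs: "b * x * s > 0" "b * (- y) * s > 0" by (intro mult_pos_pos b xy s0 y0)+
  have ff: "dotp n f f = 1"
  proof -
    have "dotp n f f = 1 / (b * x * s) * (b * (a * b + x * x))"
      unfolding f_def dotp_scale norm using bs by (simp add: power_divide)
    also have "a * b + x * x = x * s" using xym xy(2) by (simp add: algebra_simps flip: xy(2))
    also have "1 / (b * x * s) * (b * (x * s)) = 1" using b xy(3) s0 by simp
    finally show ?thesis .
  qed
  have gg: "dotp n g g = 1"
  proof -
    have "dotp n g g = 1 / (b * (- y) * s) * (b * (a * b + y * y))"
      unfolding g_def dotp_scale norm using bs by (simp add: power_divide)
    also have "a * b + y * y = (- y) * s" using xym xy(2) by (simp add: algebra_simps flip: xy(2))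
    also have "1 / (b * (- y) * s) * (b * ((- y) * s)) = 1" using b y0 s0 by simp
    finally show ?thesis .
  qed
  have fg: "dotp n f g = 0"
  proof -
    have "dotp n f g = 1 / sqrt (b * x * s) * (1 / sqrt (b * (- y) * s) * (b * (a * b + x * y)))"
      unfolding f_def g_def by (simp only: dotp_linear(3,6) norm)
    then show ?thesis using xym by simp
  qed
  obtain u1 where u1: "orthonormal_family n u1" "\<And>j. j < n \<Longrightarrow> u1 0 j = f j"
    using orthonormal_family_replace[OF orthonormal_family_std[of n], of 0 f] ff n2 by auto
  have "dotp n (u1 0) g = dotp n f g" using u1(2) by (simp add: dotp_def)
  then have g0: "dotp n (u1 i) g = 0" if "i < 1" for i using fg that by simp
  have "1 < n" using n2 by simp
  then obtain u where u: "orthonormal_family n u" "\<And>i j. i < 1 \<Longrightarrow> u i j = u1 i j" "\<And>j. j < n \<Longrightarrow> u 1 j = g j"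
    using orthonormal_family_replace[OF u1(1) _ gg g0] by blast
  \<comment> \<open>The right singular vector of the negative eigenvalue is reversed, so that its
    singular value is positive.\<close>
  define v where "v r = (\<lambda>j. (if r = 1 then - 1 else 1) * u r j)" for r :: nat
  have v: "orthonormal_family n v"
    unfolding orthonormal_family_dotp
  proof (intro allI impI)
    fix r t assume rt: "r < n" "t < n"
    have "dotp n (v r) (v t) = (if r = 1 then - 1 else 1) * ((if t = 1 then - 1 else 1) * dotp n (u r) (u t))"
      unfolding v_def by (simp only: dotp_linear(3,6))
    then show "dotp n (v r) (v t) = (if r = t then 1 else 0)"
      using u(1) rt by (auto simp: orthonormal_family_dotp)
  qed
  define \<sigma> where "\<sigma> r = (if r = 0 then x else if r = 1 then - y else 0)" for r :: nat
  have two: "(\<Sum>r<n. F r) = F 0 + F 1" if "\<And>r. r < n \<Longrightarrow> r \<noteq> 0 \<Longrightarrow> r \<noteq> 1 \<Longrightarrow> F r = 0" for F :: "nat \<Rightarrow> real"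
  proof -
    have "(\<Sum>r<n. F r) = (\<Sum>r\<in>{0, 1}. F r)" using n2 that by (intro sum.mono_neutral_right) auto
    then show ?thesis by simp
  qed
  have "is_svd n Z \<sigma> u v" unfolding is_svd_def
  proof (intro conjI allI impI u(1) v)
    fix r show "0 \<le> \<sigma> r" using xy by (simp add: \<sigma>_def)
  next
    fix i j assume ij: "i < n" "j < n"
    have "(\<Sum>r<n. \<sigma> r * u r i * v r j) = x * (f i * f j) + y * (g i * g j)"
      using ij u(2,3) u1(2) by (subst two) (auto simp: \<sigma>_def v_def)
    also have "x * (f i * f j) = 1 / (b * s) * ((b * p i + x * q i) * (b * p j + x * q j))"
      using bs xy b s by (simp add: f_def real_sqrt_mult[symmetric])
    also have "y * (g i * g j) = - (1 / (b * s) * ((b * p i + y * q i) * (b * p j + y * q j)))"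
    proof -
      have "g i * g j = 1 / (b * (- y) * s) * ((b * p i + y * q i) * (b * p j + y * q j))"
        using bs by (simp add: g_def)
      then show ?thesis using xy b s by (simp add: field_simps)
    qed
    also have "1 / (b * s) * ((b * p i + x * q i) * (b * p j + x * q j)) + - (1 / (b * s) * ((b * p i + y * q i) * (b * p j + y * q j)))
      = 1 / (b * s) * (b * (x - y) * (p i * q j + q i * p j) + (x + y) * (x - y) * (q i * q j))"
      by (simp add: algebra_simps diff_divide_distrib add_divide_distrib)
    also have "\<dots> = Z i j" unfolding xy Z[OF ij] using b s by (simp add: field_simps)
    finally show "Z i j = (\<Sum>r<n. \<sigma> r * u r i * v r j)" by simp
  qed
  from nuclear_norm_eq[OF this] have "nuclear_norm n Z = (\<Sum>r<n. \<sigma> r)" .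
  also have "\<dots> = x - y" by (subst two) (auto simp: \<sigma>_def)
  finally show ?thesis by (simp add: xy s_def a_def b_def mult.assoc)
qed

section \<open>Geometry of the minimizer\<close>

lemma dotp_cauchy_schwarz: "(dotp n u v)\<^sup>2 \<le> dotp n u u * dotp n v v"
  unfolding dotp_def using Cauchy_Schwarz_ineq_sum[of u v "{..<n}"] by (simp add: power2_eq_square)

lemma qf_outer_sum:
  fixes R :: nat
  assumes "\<And>i j. i < n \<Longrightarrow> j < n \<Longrightarrow> H i j = e i * g j + g i * e j + (\<Sum>r<R. z r i * z r j)"
  shows "qf n H a = 2 * (dotp n e a * dotp n g a) + (\<Sum>r<R. (dotp n (z r) a)\<^sup>2)"
proof -
  have "qf n H a = (\<Sum>i<n. \<Sum>j<n. (e i * a i) * (g j * a j) + (g i * a i) * (e j * a j) + (\<Sum>r<R. (z r i * a i) * (z r j * a j)))"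
    unfolding qf_def using assms
    by (intro sum.cong) (simp_all add: distrib_left distrib_right sum_distrib_left sum_distrib_right mult_ac)
  also have "\<dots> = dotp n e a * dotp n g a + dotp n g a * dotp n e a + (\<Sum>i<n. \<Sum>j<n. \<Sum>r<R. (z r i * a i) * (z r j * a j))"
    by (simp only: sum.distrib dotp_def sum_product)
  also have "(\<Sum>i<n. \<Sum>j<n. \<Sum>r<R. (z r i * a i) * (z r j * a j)) = (\<Sum>i<n. \<Sum>r<R. \<Sum>j<n. (z r i * a i) * (z r j * a j))"
    by (intro sum.cong refl sum.swap)
  also have "\<dots> = (\<Sum>r<R. \<Sum>i<n. \<Sum>j<n. (z r i * a i) * (z r j * a j))" by (rule sum.swap)
  also have "\<dots> = (\<Sum>r<R. (dotp n (z r) a)\<^sup>2)"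
    by (simp only: dotp_def sum_product power2_eq_square)
  finally show ?thesis by simp
qed

text \<open>The sample does not appear here: a minimizer contributes only positive semidefiniteness
  and \<open>obj\<close>, which holds because x x^T is feasible. The bound on the norm ratio and
  that on lam are combined in \<open>flat\<close>.\<close>

locale descent =
  fixes n k :: nat and \<Omega> :: "nat set" and lam :: real and x :: "nat \<Rightarrow> real" and X :: "nat \<Rightarrow> nat \<Rightarrow> real"
    and p q :: "nat \<Rightarrow> real" and P :: real
  defines "p \<equiv> restrict_vec \<Omega> x" and "q \<equiv> (\<lambda>i. x i - p i)" and "P \<equiv> sqrt (dotp n p p)"
  assumes \<Omega>: "\<Omega> \<subseteq> {..<n}" "card \<Omega> = k" and k: "k \<ge> 1" and lam: "lam > 0" and X: "psd n X"
    and obj: "mtrace n X + lam * mnorm1 n X \<le> mtrace n (outer x) + lam * mnorm1 n (outer x)"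
    and p_pos: "dotp n p p > 0"
    and flat: "lam * sqrt (real k) * vnorm1 n p \<le> P"
begin

definition e :: "nat \<Rightarrow> real" where "e = (\<lambda>i. 1 / P * p i)"
text \<open>A Gram factorization of \<open>X\<close>. Splitting each factor into a multiple of
  \<open>e\<close> and a remainder \<open>z r\<close> orthogonal to \<open>e\<close> produces the
  tangent part and the positive part together.\<close>

definition y :: "nat \<Rightarrow> nat \<Rightarrow> real" where "y = (SOME y. \<forall>i<n. \<forall>j<n. X i j = (\<Sum>r<n. y r i * y r j))"
definition \<alpha> :: "nat \<Rightarrow> real" where "\<alpha> r = dotp n e (y r)"
definition z :: "nat \<Rightarrow> nat \<Rightarrow> real" where "z r = (\<lambda>i. y r i - \<alpha> r * e i)"
definition v :: "nat \<Rightarrow> real" where "v = (\<lambda>i. \<Sum>r<n. \<alpha> r * z r i)"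
definition c :: real where "c = (\<Sum>r<n. (\<alpha> r)\<^sup>2) - P\<^sup>2"
text \<open>Half of \<open>c\<close>, since the component along e e^T occurs twice in e g^T + g
  e^T.\<close>

definition g :: "nat \<Rightarrow> real" where "g = (\<lambda>i. c / 2 * e i + v i)"
definition \<tau> :: real where "\<tau> = (\<Sum>r<n. dotp n (z r) (z r))"
definition Z :: "nat \<Rightarrow> nat \<Rightarrow> real" where "Z = (\<lambda>i j. outer x i j - outer p i j)"
definition off :: real where "off = (\<Sum>i<n. \<Sum>j<n. if i \<in> \<Omega> \<and> j \<in> \<Omega> then 0 else \<bar>X i j\<bar>)"
definition \<delta> :: real where "\<delta> = nuclear_norm n Z + lam * mnorm1 n Z"
definition H :: "nat \<Rightarrow> nat \<Rightarrow> real" where "H = (\<lambda>i j. X i j - outer x i j)"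

lemma P: "P > 0" "P\<^sup>2 = dotp n p p"
  using p_pos by (auto simp: P_def)

lemma p_zero: "i \<notin> \<Omega> \<Longrightarrow> p i = 0" and q_zero: "i \<in> \<Omega> \<Longrightarrow> q i = 0" and x_eq: "x i = p i + q i"
  by (auto simp: p_def q_def restrict_vec_def)

lemma pq: "p i * q i = 0" "dotp n p q = 0"
proof -
  have "p i * q i = 0" for i by (cases "i \<in> \<Omega>") (auto simp: p_zero q_zero)
  then show "p i * q i = 0" "dotp n p q = 0" by (auto simp: dotp_def intro!: sum.neutral)
qed

lemma X_eq: "i < n \<Longrightarrow> j < n \<Longrightarrow> X i j = (\<Sum>r<n. y r i * y r j)"
  using someI_ex[OF psd_factorization[OF X]] unfolding y_def[symmetric] by blast

lemma ee: "dotp n e e = 1"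
  unfolding e_def dotp_scale using P p_pos by (simp add: power_divide)

lemma ez: "dotp n e (z r) = 0"
  unfolding z_def dotp_linear using ee by (simp add: \<alpha>_def)

lemma ev: "dotp n e v = 0"
  unfolding v_def dotp_sum_right by (simp add: ez)

lemma eg: "dotp n e g = c / 2"
  unfolding g_def dotp_linear using ee ev by simp

lemma p_e: "p i = P * e i"
  using P by (simp add: e_def)

lemma decomposition:
  assumes "i < n" "j < n"
  shows "X i j - p i * p j = e i * g j + g i * e j + (\<Sum>r<n. z r i * z r j)"
proof -
  have "X i j = (\<Sum>r<n. (\<alpha> r * e i + z r i) * (\<alpha> r * e j + z r j))"
    unfolding X_eq[OF assms] z_def by simp
  also have "\<dots> = (\<Sum>r<n. e i * e j * (\<alpha> r)\<^sup>2 + e i * (\<alpha> r * z r j) + e j * (\<alpha> r * z r i) + z r i * z r j)"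
    by (intro sum.cong refl) (simp add: algebra_simps power2_eq_square)
  also have "\<dots> = e i * e j * (\<Sum>r<n. (\<alpha> r)\<^sup>2) + e i * v j + e j * v i + (\<Sum>r<n. z r i * z r j)"
    unfolding v_def by (simp only: sum.distrib sum_distrib_left)
  finally have 1: "X i j = e i * e j * (\<Sum>r<n. (\<alpha> r)\<^sup>2) + e i * v j + e j * v i + (\<Sum>r<n. z r i * z r j)" .
  have "p i * p j = e i * e j * P\<^sup>2" unfolding p_e[of i] p_e[of j] by (simp add: power2_eq_square mult_ac)
  then show ?thesis unfolding 1 g_def c_def by (simp add: field_simps)
qed

text \<open>Applied to the unit vector \<open>e\<close>, the matrix X - p p^T gives
  \<open>c * e + v\<close>, whose norm is at most the Frobenius norm. In \<open>g\<close> the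
  orthogonal component \<open>v\<close> is the same and the other one is halved.\<close>

lemma gg_le: "dotp n g g \<le> (\<Sum>i<n. \<Sum>j<n. (X i j - p i * p j)\<^sup>2)"
proof -
  have row: "(\<Sum>j<n. (X i j - p i * p j) * e j) = c * e i + v i" if i: "i < n" for i
  proof -
    have "(\<Sum>j<n. (X i j - p i * p j) * e j) = (\<Sum>j<n. e i * (e j * g j) + g i * (e j * e j) + (\<Sum>r<n. z r i * (e j * z r j)))"
      using decomposition[OF i] by (intro sum.cong refl) (simp add: distrib_left distrib_right sum_distrib_left sum_distrib_right mult_ac)
    also have "\<dots> = e i * dotp n e g + g i * dotp n e e + (\<Sum>j<n. \<Sum>r<n. z r i * (e j * z r j))"
      by (simp only: sum.distrib dotp_def sum_distrib_left)
    also have "(\<Sum>j<n. \<Sum>r<n. z r i * (e j * z r j)) = (\<Sum>r<n. \<Sum>j<n. z r i * (e j * z r j))" by (rule sum.swap)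
    also have "\<dots> = (\<Sum>r<n. z r i * dotp n e (z r))" by (simp only: dotp_def sum_distrib_left)
    also have "\<dots> = 0" by (simp add: ez)
    finally have r: "(\<Sum>j<n. (X i j - p i * p j) * e j) = e i * dotp n e g + g i * dotp n e e + 0" .
    show ?thesis unfolding r ee eg by (simp add: g_def)
  qed
  have "dotp n g g = c\<^sup>2 / 4 + dotp n v v"
    unfolding g_def dotp_linear using ee ev by (simp add: dotp_commute[of n v e] power2_eq_square)
  also have "\<dots> \<le> c\<^sup>2 + dotp n v v" by simp
  also have "\<dots> = dotp n (\<lambda>i. c * e i + v i) (\<lambda>i. c * e i + v i)"
    unfolding dotp_linear using ee ev by (simp add: dotp_commute[of n v e] power2_eq_square)
  also have "\<dots> = (\<Sum>i<n. (\<Sum>j<n. (X i j - p i * p j) * e j)\<^sup>2)"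
    unfolding dotp_def using row by (intro sum.cong) (auto simp: power2_eq_square)
  also have "\<dots> \<le> (\<Sum>i<n. \<Sum>j<n. (X i j - p i * p j)\<^sup>2)"
  proof (rule sum_mono)
    fix i
    have "(\<Sum>j<n. (X i j - p i * p j) * e j)\<^sup>2 \<le> (\<Sum>j<n. (X i j - p i * p j)\<^sup>2) * (\<Sum>j<n. (e j)\<^sup>2)"
      by (rule Cauchy_Schwarz_ineq_sum)
    also have "(\<Sum>j<n. (e j)\<^sup>2) = 1" using ee by (simp add: dotp_def power2_eq_square)
    finally show "(\<Sum>j<n. (X i j - p i * p j) * e j)\<^sup>2 \<le> (\<Sum>j<n. (X i j - p i * p j)\<^sup>2)" by simp
  qed
  finally show ?thesis .
qed

lemma Z_eq: "Z i j = p i * q j + q i * p j + q i * q j"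
  by (simp add: Z_def outer_def x_eq algebra_simps)

lemma nuclear_Z: "nuclear_norm n Z = sqrt ((dotp n q q)\<^sup>2 + 4 * dotp n p p * dotp n q q)"
  by (rule nuclear_norm_rank_two[OF pq(2) p_pos]) (rule Z_eq)

text \<open>What the geometric argument uses about the size of \<open>Z\<close> is read off from the
  closed form b^2 + 4 a b of the squared nuclear norm, with a and b the squared norms of
  \<open>p\<close> and \<open>q\<close>.\<close>

lemma nuclear_Z_bounds:
  "dotp n q q \<le> nuclear_norm n Z" "4 * dotp n p p * dotp n q q \<le> (nuclear_norm n Z)\<^sup>2"
  "(\<Sum>i<n. \<Sum>j<n. (Z i j)\<^sup>2) \<le> 3 * (nuclear_norm n Z)\<^sup>2"
proof -
  let ?a = "dotp n p p" and ?b = "dotp n q q"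
  have ab: "0 \<le> ?a * ?b" by simp
  then have sq: "(nuclear_norm n Z)\<^sup>2 = ?b\<^sup>2 + 4 * ?a * ?b" unfolding nuclear_Z by (simp add: mult.assoc)
  show "?b \<le> nuclear_norm n Z" unfolding nuclear_Z using ab by (intro real_le_rsqrt) (simp add: mult.assoc)
  show "4 * ?a * ?b \<le> (nuclear_norm n Z)\<^sup>2" unfolding sq by simp
  have prod: "(\<Sum>i<n. \<Sum>j<n. (s i * t j)\<^sup>2) = dotp n s s * dotp n t t" for s t
    by (simp add: dotp_def sum_product power2_eq_square mult_ac)
  have "(\<Sum>i<n. \<Sum>j<n. (Z i j)\<^sup>2) \<le> (\<Sum>i<n. \<Sum>j<n. 3 * ((p i * q j)\<^sup>2 + (q i * p j)\<^sup>2 + (q i * q j)\<^sup>2))"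
  proof (intro sum_mono)
    fix i j
    have "(r + s + t)\<^sup>2 \<le> 3 * (r\<^sup>2 + s\<^sup>2 + t\<^sup>2)" for r s t :: real
    proof -
      have "0 \<le> (r - s)\<^sup>2 + (s - t)\<^sup>2 + (r - t)\<^sup>2" by simp
      then show ?thesis by (simp add: power2_eq_square algebra_simps)
    qed
    then show "(Z i j)\<^sup>2 \<le> 3 * ((p i * q j)\<^sup>2 + (q i * p j)\<^sup>2 + (q i * q j)\<^sup>2)" unfolding Z_eq .
  qed
  also have "\<dots> = 3 * (?a * ?b + ?b * ?a + ?b * ?b)"
    by (simp only: sum_distrib_left[symmetric] sum.distrib prod)
  also have "\<dots> \<le> 3 * (nuclear_norm n Z)\<^sup>2" unfolding sq using ab by (simp add: power2_eq_square mult.commute)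
  finally show "(\<Sum>i<n. \<Sum>j<n. (Z i j)\<^sup>2) \<le> 3 * (nuclear_norm n Z)\<^sup>2" .
qed

lemma dotp_sgn_le:
  assumes "\<And>i. i \<notin> \<Omega> \<Longrightarrow> s i = 0" "\<And>i. \<bar>s i\<bar> \<le> 1"
  shows "\<bar>dotp n g s\<bar> \<le> sqrt (real k) * sqrt (dotp n g g)"
proof -
  have "dotp n s s = (\<Sum>i\<in>\<Omega>. s i * s i)" unfolding dotp_def
    using \<Omega>(1) assms(1) by (intro sum.mono_neutral_right) auto
  also have "\<dots> \<le> (\<Sum>i\<in>\<Omega>. 1)"
    using assms(2) by (intro sum_mono) (metis abs_square_le_1 power2_eq_square)
  finally have s: "dotp n s s \<le> real k" using \<Omega>(2) by simp
  have "(dotp n g s)\<^sup>2 \<le> dotp n g g * dotp n s s" by (rule dotp_cauchy_schwarz)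
  also have "\<dots> \<le> dotp n g g * real k" using s by (intro mult_left_mono) auto
  finally have "sqrt ((dotp n g s)\<^sup>2) \<le> sqrt (dotp n g g * real k)" by (rule real_sqrt_le_mono)
  then show ?thesis by (simp add: real_sqrt_mult mult.commute)
qed

text \<open>The signs \<open>s\<close> of \<open>p\<close> give the subgradient \<open>s s\<^sup>T\<close>; its pairing with the part of \<open>X\<close>
  orthogonal to \<open>p\<close> is nonnegative because that part is positive semidefinite, so only the part
  tangent to \<open>p\<close> has to be controlled.\<close>

lemma cone_bound: "\<tau> + lam * off \<le> 4 * sqrt (dotp n g g) + \<delta>"
proof -
  define s where "s i = sgn (p i)" for i
  have s0: "s i = 0" if "i \<notin> \<Omega>" for i using p_zero[OF that] by (simp add: s_def)
  have s1: "\<bar>s i\<bar> \<le> 1" for i by (simp add: s_def sgn_if)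
  have sp: "s i * p i = \<bar>p i\<bar>" for i by (simp add: s_def sgn_if)
  have vn: "dotp n p s = vnorm1 n p" using sp by (simp add: dotp_def vnorm1_def mult.commute)
  let ?H = "\<lambda>i j. X i j - p i * p j"
  let ?\<gamma> = "sqrt (dotp n g g)"
  have qH: "qf n ?H s = 2 * (dotp n e s * dotp n g s) + (\<Sum>r<n. (dotp n (z r) s)\<^sup>2)"
    using decomposition by (rule qf_outer_sum)
  have es: "dotp n e s = vnorm1 n p / P" unfolding e_def dotp_linear vn by simp
  \<comment> \<open>\<open>dotp n e s\<close> is the l1 norm of \<open>p\<close> over
    \<open>P\<close>, and pairing \<open>g\<close> with signs costs a factor sqrt k. The assumption
    \<open>flat\<close> says that lam times these two factors is at most 1.\<close>
  have "lam * \<bar>dotp n e s * dotp n g s\<bar> = (vnorm1 n p / P) * lam * \<bar>dotp n g s\<bar>"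
    unfolding es using P by (simp add: abs_mult vnorm1_def sum_nonneg)
  also have "\<dots> \<le> (vnorm1 n p / P) * lam * (sqrt (real k) * ?\<gamma>)"
    using lam P s0 s1 by (intro mult_left_mono dotp_sgn_le) (auto simp: vnorm1_def sum_nonneg)
  also have "\<dots> = (lam * sqrt (real k) * vnorm1 n p) / P * ?\<gamma>" by simp
  also have "\<dots> \<le> P / P * ?\<gamma>" using flat P by (intro mult_right_mono divide_right_mono) auto
  finally have T: "lam * \<bar>dotp n e s * dotp n g s\<bar> \<le> ?\<gamma>" using P by simp
  have "0 \<le> (\<Sum>r<n. (dotp n (z r) s)\<^sup>2)" by (intro sum_nonneg) simp
  then have "- 2 * \<bar>dotp n e s * dotp n g s\<bar> \<le> qf n ?H s" unfolding qH by linarith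
  then have "lam * (- 2 * \<bar>dotp n e s * dotp n g s\<bar>) \<le> lam * qf n ?H s" using lam by (intro mult_left_mono) auto
  then have L: "- 2 * ?\<gamma> \<le> lam * qf n ?H s" using T by linarith
  have n1p: "mnorm1 n (outer p) = qf n (outer p) s"
    unfolding mnorm1_def qf_def outer_def
    by (intro sum.cong refl) (simp add: abs_mult flip: sp)
  \<comment> \<open>On \<Omega> x \<Omega> pairing with signs does not exceed the absolute value;
    elsewhere the signs vanish, and the whole absolute value remains for \<open>off\<close>.\<close>
  have "off + qf n X s \<le> mnorm1 n X"
    unfolding off_def qf_def mnorm1_def sum.distrib[symmetric]
  proof (intro sum_mono)
    fix i j
    show "(if i \<in> \<Omega> \<and> j \<in> \<Omega> then 0 else \<bar>X i j\<bar>) + s i * X i j * s j \<le> \<bar>X i j\<bar>"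
    proof (cases "i \<in> \<Omega> \<and> j \<in> \<Omega>")
      case True
      have "\<bar>s i\<bar> * \<bar>X i j\<bar> * \<bar>s j\<bar> \<le> 1 * \<bar>X i j\<bar> * 1" using s1 by (intro mult_mono) auto
      then have "\<bar>s i * X i j * s j\<bar> \<le> \<bar>X i j\<bar>" by (simp add: abs_mult)
      then show ?thesis using True by simp
    next
      case False
      then show ?thesis using s0 by auto
    qed
  qed
  moreover have "qf n X s = qf n ?H s + qf n (outer p) s"
    by (simp add: qf_def outer_def algebra_simps sum_subtractf)
  ultimately have n1: "off + qf n ?H s + mnorm1 n (outer p) \<le> mnorm1 n X" using n1p by simp
  have n1x: "mnorm1 n (outer x) \<le> mnorm1 n (outer p) + mnorm1 n Z"
    unfolding mnorm1_def sum.distrib[symmetric] Z_def by (intro sum_mono) simp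
  have tr: "mtrace n X = P\<^sup>2 + c + \<tau>"
  proof -
    have "mtrace n X = (\<Sum>i<n. p i * p i + 2 * (e i * g i) + (\<Sum>r<n. z r i * z r i))"
      unfolding mtrace_def
    proof (intro sum.cong refl)
      fix i assume "i \<in> {..<n}"
      then have "i < n" by simp
      from decomposition[OF this this] show "X i i = p i * p i + 2 * (e i * g i) + (\<Sum>r<n. z r i * z r i)"
        by (simp add: mult.commute)
    qed
    also have "\<dots> = dotp n p p + 2 * dotp n e g + (\<Sum>i<n. \<Sum>r<n. z r i * z r i)"
      by (simp only: sum.distrib dotp_def sum_distrib_left)
    also have "(\<Sum>i<n. \<Sum>r<n. z r i * z r i) = (\<Sum>r<n. \<Sum>i<n. z r i * z r i)" by (rule sum.swap)
    finally show ?thesis using P(2) eg by (simp add: \<tau>_def dotp_def)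
  qed
  have trx: "mtrace n (outer x) = P\<^sup>2 + dotp n q q"
  proof -
    have "mtrace n (outer x) = (\<Sum>i<n. p i * p i + 2 * (p i * q i) + q i * q i)"
      unfolding mtrace_def outer_def x_eq by (intro sum.cong refl) (simp add: algebra_simps)
    also have "\<dots> = dotp n p p + dotp n q q" by (simp add: pq(1) sum.distrib dotp_def)
    finally show ?thesis using P(2) by simp
  qed
  have "c = 2 * dotp n e g" using eg by simp
  moreover have "\<bar>dotp n e g\<bar> \<le> ?\<gamma>"
    using dotp_cauchy_schwarz[of n e g] ee real_sqrt_le_mono[of "(dotp n e g)\<^sup>2" "dotp n g g"] by simp
  \<comment> \<open>Half of the factor 4 in the conclusion comes from this trace term, the other
    half from the sign pairing \<open>L\<close>.\<close>
  ultimately have cg: "- 2 * ?\<gamma> \<le> c" by linarith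
  have "lam * (off + qf n ?H s + mnorm1 n (outer p)) \<le> lam * mnorm1 n X"
    using n1 lam by (intro mult_left_mono) auto
  moreover have "lam * mnorm1 n (outer x) \<le> lam * (mnorm1 n (outer p) + mnorm1 n Z)"
    using n1x lam by (intro mult_left_mono) auto
  ultimately show ?thesis
    using obj cg L nuclear_Z_bounds(1) unfolding tr trx \<delta>_def distrib_left by linarith
qed

section \<open>Membership of the normalised error in the good class\<close>

lemma dotp_restrict_le: "dotp n (restrict_vec \<Omega> u) (restrict_vec \<Omega> u) \<le> dotp n u u"
  unfolding dotp_def by (intro sum_mono) (simp add: restrict_vec_def)

lemma e_zero: "i \<notin> \<Omega> \<Longrightarrow> e i = 0"
  by (simp add: e_def p_zero)

lemma \<delta>_bounds: "nuclear_norm n Z \<le> \<delta>" "0 \<le> nuclear_norm n Z" "lam * mnorm1 n Z \<le> \<delta>"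
proof -
  have 0: "0 \<le> nuclear_norm n Z" using nuclear_Z_bounds(1) dotp_self_nonneg[of n q] by linarith
  have 1: "0 \<le> lam * mnorm1 n Z" using lam by (simp add: mnorm1_def sum_nonneg)
  show "nuclear_norm n Z \<le> \<delta>" "0 \<le> nuclear_norm n Z" "lam * mnorm1 n Z \<le> \<delta>" using 0 1 by (auto simp: \<delta>_def)
qed

lemma H_eq: "H i j = (X i j - p i * p j) - Z i j"
  by (simp add: H_def Z_def outer_def)

lemma frob_sq: "(frob n M)\<^sup>2 = (\<Sum>i<n. \<Sum>j<n. (M i j)\<^sup>2)"
  by (simp add: frob_def sum_nonneg)

text \<open>Here 9 rounds up 2 + 2 * 3, from H + Z and the Frobenius bound for \<open>Z\<close>, to
  a perfect square; then 13 = 4 * 3 + 1 by \<open>cone_bound\<close>.\<close>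

lemma g_bound:
  assumes f: "\<delta> < frob n H"
  shows "dotp n g g \<le> 9 * (frob n H)\<^sup>2" "\<tau> + lam * off \<le> 13 * frob n H"
proof -
  define f where "f = frob n H"
  have nf: "nuclear_norm n Z \<le> f" using \<delta>_bounds(1) f by (simp add: f_def)
  have f0: "0 \<le> f" using nf \<delta>_bounds(2) by linarith
  have n2: "(nuclear_norm n Z)\<^sup>2 \<le> f\<^sup>2" using nf \<delta>_bounds(2) by (intro power_mono)
  have "dotp n g g \<le> (\<Sum>i<n. \<Sum>j<n. (X i j - p i * p j)\<^sup>2)" by (rule gg_le)
  also have "\<dots> \<le> (\<Sum>i<n. \<Sum>j<n. 2 * (H i j)\<^sup>2 + 2 * (Z i j)\<^sup>2)"
  proof (intro sum_mono)
    fix i j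
    have "X i j - p i * p j = H i j + Z i j" by (simp add: H_eq)
    moreover have "(H i j + Z i j)\<^sup>2 \<le> 2 * (H i j)\<^sup>2 + 2 * (Z i j)\<^sup>2"
      using sum_squares_bound[of "H i j" "Z i j"] by (simp add: power2_sum)
    ultimately show "(X i j - p i * p j)\<^sup>2 \<le> 2 * (H i j)\<^sup>2 + 2 * (Z i j)\<^sup>2" by simp
  qed
  also have "\<dots> = 2 * f\<^sup>2 + 2 * (\<Sum>i<n. \<Sum>j<n. (Z i j)\<^sup>2)"
    unfolding f_def frob_sq by (simp only: sum.distrib sum_distrib_left)
  also have "\<dots> \<le> 9 * f\<^sup>2" using nuclear_Z_bounds(3) n2 zero_le_power2[of f] by linarith
  finally show 1: "dotp n g g \<le> 9 * (frob n H)\<^sup>2" unfolding f_def .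
  have "sqrt (dotp n g g) \<le> 3 * f" using 1 f0 by (intro real_le_lsqrt) (auto simp: f_def power_mult_distrib)
  then show "\<tau> + lam * off \<le> 13 * frob n H" using cone_bound f unfolding f_def by linarith
qed

lemma qf_H: "qf n H a = 2 * (dotp n e a * dotp n g a) + (\<Sum>r<n. (dotp n (z r) a)\<^sup>2) - (2 * (dotp n p a * dotp n q a) + (dotp n q a)\<^sup>2)"
proof -
  have "qf n H a = qf n (\<lambda>i j. X i j - p i * p j) a - qf n Z a"
    unfolding qf_def H_eq by (simp add: algebra_simps sum_subtractf sum.distrib)
  also have "qf n (\<lambda>i j. X i j - p i * p j) a = 2 * (dotp n e a * dotp n g a) + (\<Sum>r<n. (dotp n (z r) a)\<^sup>2)"
    using decomposition by (rule qf_outer_sum)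
  also have "qf n Z a = 2 * (dotp n p a * dotp n q a) + (\<Sum>r<(1::nat). (dotp n q a)\<^sup>2)"
    by (rule qf_outer_sum) (simp add: Z_eq)
  finally show ?thesis by simp
qed

text \<open>Each product of two linear forms is split by 2 |s t| <= s^2 + t^2, with the division by
  the norm of \<open>H\<close> charged entirely to the factor other than \<open>e\<close>. The bound
  26 is 13 + 1 + 9 + 1 + 1 + 1, one summand per group of squares.\<close>

lemma H_square_domination:
  assumes f: "\<delta> < frob n H"
  shows "\<exists>(R::nat) w. (\<forall>a. \<bar>qf n (\<lambda>i j. H i j / frob n H) a\<bar> \<le> (\<Sum>r<R. (dotp n (w r) a)\<^sup>2)) \<and> (\<Sum>r<R. dotp n (w r) (w r)) \<le> 26"
proof -
  define f where "f = frob n H"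
  have nf: "nuclear_norm n Z < f" using \<delta>_bounds(1) f by (simp add: f_def)
  have f0: "0 < f" using nf \<delta>_bounds(2) by linarith
  define w where "w r = (if r < n then (\<lambda>i. 1 / sqrt f * z r i) else if r = n then e
    else if r = Suc n then (\<lambda>i. 1 / f * g i) else if r = Suc (Suc n) then e
    else if r = Suc (Suc (Suc n)) then (\<lambda>i. P / f * q i) else (\<lambda>i. 1 / sqrt f * q i))" for r
  let ?R = "Suc (Suc (Suc (Suc (Suc n))))"
  have S: "(\<Sum>r<?R. F (w r)) = (\<Sum>r<n. F (\<lambda>i. 1 / sqrt f * z r i)) + F e + F (\<lambda>i. 1 / f * g i) + F e
      + F (\<lambda>i. P / f * q i) + F (\<lambda>i. 1 / sqrt f * q i)" for F :: "(nat \<Rightarrow> real) \<Rightarrow> real"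
  proof -
    have "(\<Sum>r<n. F (w r)) = (\<Sum>r<n. F (\<lambda>i. 1 / sqrt f * z r i))" by (intro sum.cong) (auto simp: w_def)
    moreover have "w n = e" "w (Suc n) = (\<lambda>i. 1 / f * g i)" "w (Suc (Suc n)) = e"
      "w (Suc (Suc (Suc n))) = (\<lambda>i. P / f * q i)" "w (Suc (Suc (Suc (Suc n)))) = (\<lambda>i. 1 / sqrt f * q i)"
      by (simp_all add: w_def)
    ultimately show ?thesis by (simp only: sum.lessThan_Suc)
  qed
  have "\<bar>qf n (\<lambda>i j. H i j / f) a\<bar> \<le> (\<Sum>r<?R. (dotp n (w r) a)\<^sup>2)" for a
  proof -
    define E G Q where "E = dotp n e a" and "G = dotp n g a" and "Q = dotp n q a"
    define s where "s = (\<Sum>r<n. (dotp n (z r) a)\<^sup>2)"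
    have s0: "0 \<le> s" unfolding s_def by (intro sum_nonneg) simp
    have pa: "dotp n p a = P * E" unfolding E_def e_def dotp_linear using P by simp
    have "qf n (\<lambda>i j. H i j / f) a = qf n H a / f"
      by (simp add: qf_def sum_divide_distrib)
    also have "\<dots> = 2 * (E * (G / f)) + s / f - (2 * (E * (P / f * Q)) + Q\<^sup>2 / f)"
      unfolding qf_H pa E_def[symmetric] G_def[symmetric] Q_def[symmetric] s_def[symmetric]
      by (simp add: diff_divide_distrib add_divide_distrib mult_ac)
    finally have q: "qf n (\<lambda>i j. H i j / f) a = 2 * (E * (G / f)) + s / f - (2 * (E * (P / f * Q)) + Q\<^sup>2 / f)" .
    have am: "\<bar>2 * (s * t)\<bar> \<le> s\<^sup>2 + t\<^sup>2" for s t :: real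
      using sum_squares_bound[of "\<bar>s\<bar>" "\<bar>t\<bar>"] by (simp add: abs_mult)
    have "\<bar>2 * (E * (G / f))\<bar> \<le> E\<^sup>2 + (G / f)\<^sup>2" by (rule am)
    moreover have "\<bar>2 * (E * (P / f * Q))\<bar> \<le> E\<^sup>2 + (P / f * Q)\<^sup>2" by (rule am)
    moreover have "0 \<le> s / f" "0 \<le> Q\<^sup>2 / f" using s0 f0 by auto
    ultimately have "\<bar>qf n (\<lambda>i j. H i j / f) a\<bar> \<le> s / f + E\<^sup>2 + (G / f)\<^sup>2 + E\<^sup>2 + (P / f * Q)\<^sup>2 + Q\<^sup>2 / f"
      unfolding q by linarith
    also have "\<dots> = (\<Sum>r<?R. (dotp n (w r) a)\<^sup>2)"
      unfolding S[of "\<lambda>u. (dotp n u a)\<^sup>2"] dotp_linear E_def G_def Q_def s_def using f0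
      by (simp add: power_mult_distrib power_divide sum_divide_distrib)
    finally show ?thesis .
  qed
  moreover have "(\<Sum>r<?R. dotp n (w r) (w r)) \<le> 26"
  proof -
    have "(\<Sum>r<?R. dotp n (w r) (w r)) = \<tau> / f + 1 + dotp n g g / f\<^sup>2 + 1 + P\<^sup>2 * dotp n q q / f\<^sup>2 + dotp n q q / f"
      unfolding S[of "\<lambda>u. dotp n u u"] dotp_scale \<tau>_def using f0 ee
      by (simp add: power_divide sum_divide_distrib)
    also have "\<dots> \<le> 13 + 1 + 9 + 1 + 1 + 1"
    proof (intro add_mono order_refl)
      have "0 \<le> lam * off" using lam by (auto simp: off_def intro!: mult_nonneg_nonneg sum_nonneg)
      then have "\<tau> \<le> 13 * f" using g_bound(2)[OF f] by (simp add: f_def)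
      then show "\<tau> / f \<le> 13" using f0 by (simp add: divide_le_eq)
      show "dotp n g g / f\<^sup>2 \<le> 9" using g_bound(1)[OF f] f0 by (simp add: f_def divide_le_eq)
      have "4 * P\<^sup>2 * dotp n q q \<le> (nuclear_norm n Z)\<^sup>2" using nuclear_Z_bounds(2) P(2) by simp
      also have "\<dots> \<le> f\<^sup>2" using nf \<delta>_bounds(2) by (intro power_mono) auto
      finally have "4 * (P\<^sup>2 * dotp n q q) \<le> f\<^sup>2" by simp
      moreover have "0 \<le> P\<^sup>2 * dotp n q q" by simp
      ultimately have "P\<^sup>2 * dotp n q q \<le> f\<^sup>2" by linarith
      then show "P\<^sup>2 * dotp n q q / f\<^sup>2 \<le> 1" using f0 by (simp add: divide_le_eq)
      show "dotp n q q / f \<le> 1" using nuclear_Z_bounds(1) nf f0 by (simp add: divide_le_eq)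
    qed
    finally show ?thesis by simp
  qed
  ultimately show ?thesis unfolding f_def by blast
qed

text \<open>On \<Omega> x \<Omega> the decomposition leaves forms in vectors supported in \<Omega>,
  where the sparse bound \<open>b\<close> applies. The entries of \<open>X\<close> elsewhere and
  those of \<open>Z\<close> are paired through \<open>w\<close>, because lam times their l1 norms is
  controlled. The factor of \<open>b\<close> is 2 * 5 + 13 = 23, that of \<open>w / lam\<close> is
  13 + 1.\<close>

lemma H_pairing_bound:
  assumes f: "\<delta> < frob n H"
    and W: "\<And>i j. i < n \<Longrightarrow> j < n \<Longrightarrow> W i j = W j i" "\<And>i j. i < n \<Longrightarrow> j < n \<Longrightarrow> \<bar>W i j\<bar> \<le> w"
    and sp: "\<And>u. ksparse n k u \<Longrightarrow> \<bar>qf n W u\<bar> \<le> b * dotp n u u"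
  shows "\<bar>\<Sum>i<n. \<Sum>j<n. W i j * H i j\<bar> \<le> 23 * (w / lam + b) * frob n H"
proof -
  define f where "f = frob n H"
  have nf: "nuclear_norm n Z < f" using \<delta>_bounds(1) f by (simp add: f_def)
  have f0: "0 < f" using nf \<delta>_bounds(2) by linarith
  have supp: "\<bar>qf n W u\<bar> \<le> b * dotp n u u" if "\<forall>i. i \<notin> \<Omega> \<longrightarrow> u i = 0" for u
    using sp[of u] \<Omega> that unfolding ksparse_def by blast
  have b0: "0 \<le> b"
  proof -
    have "0 \<le> \<bar>qf n W e\<bar>" by simp
    also have "\<dots> \<le> b * dotp n e e" using e_zero by (intro supp) auto
    finally show ?thesis using ee by simp
  qed
  have n1: "0 < n" using \<Omega> k by (auto simp: card_gt_0_iff Suc_le_eq)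
  have w0: "0 \<le> w" using W(2)[OF n1 n1] by linarith
  define gr where "gr = restrict_vec \<Omega> g"
  define zr where "zr r = restrict_vec \<Omega> (z r)" for r
  have off_part: "\<bar>\<Sum>i<n. \<Sum>j<n. if i \<in> \<Omega> \<and> j \<in> \<Omega> then 0 else W i j * X i j\<bar> \<le> w * off"
    unfolding off_def sum_distrib_left
  proof (intro order_trans[OF sum_abs] sum_mono)
    fix i j assume "i \<in> {..<n}" "j \<in> {..<n}"
    then show "\<bar>if i \<in> \<Omega> \<and> j \<in> \<Omega> then 0 else W i j * X i j\<bar> \<le> w * (if i \<in> \<Omega> \<and> j \<in> \<Omega> then 0 else \<bar>X i j\<bar>)"
      using W(2) by (auto simp: abs_mult intro!: mult_right_mono)
  qed
  have Z_part: "\<bar>\<Sum>i<n. \<Sum>j<n. W i j * Z i j\<bar> \<le> w * mnorm1 n Z"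
    unfolding mnorm1_def sum_distrib_left
    using W(2) by (intro order_trans[OF sum_abs] sum_mono) (auto simp: abs_mult intro!: mult_right_mono)
  have "(\<Sum>i<n. \<Sum>j<n. if i \<in> \<Omega> \<and> j \<in> \<Omega> then W i j * (X i j - p i * p j) else 0)
     = (\<Sum>i<n. \<Sum>j<n. e i * W i j * gr j + gr i * W i j * e j + (\<Sum>r<n. zr r i * W i j * zr r j))"
  proof (intro sum.cong refl)
    fix i j assume "i \<in> {..<n}" "j \<in> {..<n}"
    then have ij: "i < n" "j < n" by auto
    show "(if i \<in> \<Omega> \<and> j \<in> \<Omega> then W i j * (X i j - p i * p j) else 0)
        = e i * W i j * gr j + gr i * W i j * e j + (\<Sum>r<n. zr r i * W i j * zr r j)"
    proof (cases "i \<in> \<Omega> \<and> j \<in> \<Omega>")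
      case True
      then show ?thesis unfolding decomposition[OF ij]
        by (simp add: gr_def zr_def restrict_vec_def distrib_left sum_distrib_left mult_ac)
    next
      case False
      then show ?thesis using e_zero by (auto simp: gr_def zr_def restrict_vec_def)
    qed
  qed
  also have "\<dots> = bf n W e gr + bf n W gr e + (\<Sum>i<n. \<Sum>j<n. \<Sum>r<n. zr r i * W i j * zr r j)"
    by (simp only: sum.distrib bf_def)
  also have "(\<Sum>i<n. \<Sum>j<n. \<Sum>r<n. zr r i * W i j * zr r j) = (\<Sum>i<n. \<Sum>r<n. \<Sum>j<n. zr r i * W i j * zr r j)"
    by (intro sum.cong refl sum.swap)
  also have "\<dots> = (\<Sum>r<n. \<Sum>i<n. \<Sum>j<n. zr r i * W i j * zr r j)" by (rule sum.swap)
  also have "\<dots> = (\<Sum>r<n. qf n W (zr r))" by (simp only: qf_def)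
  also have "bf n W gr e = bf n W e gr" using W(1) by (rule bf_commute)
  finally have on_eq: "(\<Sum>i<n. \<Sum>j<n. if i \<in> \<Omega> \<and> j \<in> \<Omega> then W i j * (X i j - p i * p j) else 0)
     = bf n W e gr + bf n W e gr + (\<Sum>r<n. qf n W (zr r))" .
  \<comment> \<open>Polarization bounds by a sum of squared norms, so \<open>gr\<close> is first
    scaled to a size comparable with the unit vector \<open>e\<close>: (1 + 9) / 2 = 5.\<close>
  have "\<bar>bf n W e (\<lambda>i. 1 / f * gr i)\<bar> \<le> b * (dotp n e e + dotp n (\<lambda>i. 1 / f * gr i) (\<lambda>i. 1 / f * gr i)) / 2"
    by (rule bf_polarization_bound[where \<Omega>=\<Omega>]) (use W(1) supp e_zero in \<open>auto simp: gr_def restrict_vec_def\<close>)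
  also have "\<dots> \<le> b * (1 + 9) / 2"
  proof (intro divide_right_mono mult_left_mono add_mono b0)
    have "dotp n (\<lambda>i. 1 / f * gr i) (\<lambda>i. 1 / f * gr i) = dotp n gr gr / f\<^sup>2"
      unfolding dotp_scale by (simp add: power_divide)
    also have "\<dots> \<le> (9 * f\<^sup>2) / f\<^sup>2"
      using dotp_restrict_le[of g] g_bound(1)[OF f] unfolding gr_def f_def by (intro divide_right_mono) auto
    finally show "dotp n (\<lambda>i. 1 / f * gr i) (\<lambda>i. 1 / f * gr i) \<le> 9" using f0 by simp
  qed (auto simp: ee)
  finally have "\<bar>bf n W e (\<lambda>i. 1 / f * gr i)\<bar> \<le> 5 * b" by simp
  then have "\<bar>bf n W e gr\<bar> / f \<le> 5 * b" using f0 unfolding bf_linear by (simp add: abs_mult)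
  then have bfb: "\<bar>bf n W e gr\<bar> \<le> 5 * b * f" using f0 by (simp add: divide_le_eq)
  have "\<bar>\<Sum>r<n. qf n W (zr r)\<bar> \<le> (\<Sum>r<n. b * dotp n (z r) (z r))"
  proof (intro order_trans[OF sum_abs] sum_mono)
    fix r
    have "\<bar>qf n W (zr r)\<bar> \<le> b * dotp n (zr r) (zr r)" by (rule supp) (simp add: zr_def restrict_vec_def)
    also have "\<dots> \<le> b * dotp n (z r) (z r)" unfolding zr_def by (intro mult_left_mono dotp_restrict_le b0)
    finally show "\<bar>qf n W (zr r)\<bar> \<le> b * dotp n (z r) (z r)" .
  qed
  then have qfb: "\<bar>\<Sum>r<n. qf n W (zr r)\<bar> \<le> b * \<tau>" by (simp only: \<tau>_def sum_distrib_left)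
  have off0: "0 \<le> off" unfolding off_def by (intro sum_nonneg) auto
  have \<tau>0: "0 \<le> \<tau>" unfolding \<tau>_def by (intro sum_nonneg) simp
  have cone: "\<tau> + lam * off \<le> 13 * f" using g_bound(2)[OF f] by (simp add: f_def)
  have lo0: "0 \<le> lam * off" using lam off0 by simp
  have "b * \<tau> \<le> b * (13 * f)" using cone lo0 b0 by (intro mult_left_mono) auto
  with qfb have qfb': "\<bar>\<Sum>r<n. qf n W (zr r)\<bar> \<le> b * (13 * f)" by linarith
  have "w * off = w / lam * (lam * off)" using lam by simp
  also have "\<dots> \<le> w / lam * (13 * f)" using cone \<tau>0 w0 lam by (intro mult_left_mono) auto
  finally have offb: "w * off \<le> w / lam * (13 * f)" .
  have "w * mnorm1 n Z = w / lam * (lam * mnorm1 n Z)" using lam by simp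
  also have "\<dots> \<le> w / lam * f" using \<delta>_bounds(3) f w0 lam by (intro mult_left_mono) (auto simp: f_def)
  finally have Zb: "w * mnorm1 n Z \<le> w / lam * f" .
  have "(\<Sum>i<n. \<Sum>j<n. W i j * H i j)
    = (\<Sum>i<n. \<Sum>j<n. (if i \<in> \<Omega> \<and> j \<in> \<Omega> then W i j * (X i j - p i * p j) else 0)
        + (if i \<in> \<Omega> \<and> j \<in> \<Omega> then 0 else W i j * X i j) - W i j * Z i j)"
  proof (intro sum.cong refl)
    fix i j
    have "p i * p j = 0" if "\<not> (i \<in> \<Omega> \<and> j \<in> \<Omega>)" using that p_zero by auto
    then show "W i j * H i j = (if i \<in> \<Omega> \<and> j \<in> \<Omega> then W i j * (X i j - p i * p j) else 0)
        + (if i \<in> \<Omega> \<and> j \<in> \<Omega> then 0 else W i j * X i j) - W i j * Z i j"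
      unfolding H_eq by (cases "i \<in> \<Omega> \<and> j \<in> \<Omega>") (auto simp: algebra_simps)
  qed
  also have "\<dots> = (bf n W e gr + bf n W e gr + (\<Sum>r<n. qf n W (zr r)))
      + (\<Sum>i<n. \<Sum>j<n. if i \<in> \<Omega> \<and> j \<in> \<Omega> then 0 else W i j * X i j) - (\<Sum>i<n. \<Sum>j<n. W i j * Z i j)"
    unfolding on_eq[symmetric] by (simp only: sum.distrib sum_subtractf)
  finally have split: "(\<Sum>i<n. \<Sum>j<n. W i j * H i j) = (bf n W e gr + bf n W e gr + (\<Sum>r<n. qf n W (zr r)))
      + (\<Sum>i<n. \<Sum>j<n. if i \<in> \<Omega> \<and> j \<in> \<Omega> then 0 else W i j * X i j) - (\<Sum>i<n. \<Sum>j<n. W i j * Z i j)" .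
  have arith: "\<bar>(s + s + t) + o' - z'\<bar> \<le> 2 * s' + t' + o'' + z''"
    if "\<bar>s\<bar> \<le> s'" "\<bar>t\<bar> \<le> t'" "\<bar>o'\<bar> \<le> o''" "\<bar>z'\<bar> \<le> z''" for s t o' z' s' t' o'' z'' :: real
    using that by linarith
  have "\<bar>\<Sum>i<n. \<Sum>j<n. W i j * H i j\<bar> \<le> 2 * (5 * b * f) + b * (13 * f) + w / lam * (13 * f) + w / lam * f"
    unfolding split by (rule arith[OF bfb qfb' order_trans[OF off_part offb] order_trans[OF Z_part Zb]])
  also have "\<dots> = 14 * (w / lam * f) + 23 * (b * f)" by simp
  also have "\<dots> \<le> 23 * (w / lam * f) + 23 * (b * f)"
    using w0 lam f0 by (intro add_right_mono mult_right_mono) auto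
  also have "\<dots> = 23 * (w / lam + b) * f" by (simp add: algebra_simps)
  finally show ?thesis unfolding f_def .
qed

lemma normalized_H_good:
  assumes f: "\<delta> < frob n H"
  shows "(\<lambda>i j. H i j / frob n H) \<in> good_matrices n k lam 26 23"
proof -
  have f0: "0 < frob n H" using f \<delta>_bounds(1,2) by linarith
  have sym: "H i j = H j i" if "i < n" "j < n" for i j
    using X that unfolding H_def psd_def outer_def by (simp add: mult.commute)
  have "(\<Sum>i<n. \<Sum>j<n. (H i j / frob n H)\<^sup>2) = (\<Sum>i<n. \<Sum>j<n. (H i j)\<^sup>2) / (frob n H)\<^sup>2"
    by (simp add: power_divide sum_divide_distrib)
  also have "\<dots> = 1" unfolding frob_sq[symmetric] using f0 by simp
  finally have 1: "(\<Sum>i<n. \<Sum>j<n. (H i j / frob n H)\<^sup>2) = 1" .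
  have 2: "\<bar>\<Sum>i<n. \<Sum>j<n. W i j * (H i j / frob n H)\<bar> \<le> 23 * (w / lam + b)"
    if "\<forall>i<n. \<forall>j<n. W i j = W j i" "\<forall>i<n. \<forall>j<n. \<bar>W i j\<bar> \<le> w"
      "\<forall>u. ksparse n k u \<longrightarrow> \<bar>qf n W u\<bar> \<le> b * dotp n u u" for W w b
  proof -
    have "\<bar>\<Sum>i<n. \<Sum>j<n. W i j * H i j\<bar> \<le> 23 * (w / lam + b) * frob n H"
      by (rule H_pairing_bound[OF f]) (use that in auto)
    moreover have "(\<Sum>i<n. \<Sum>j<n. W i j * (H i j / frob n H)) = (\<Sum>i<n. \<Sum>j<n. W i j * H i j) / frob n H"
      by (simp add: sum_divide_distrib)
    ultimately show ?thesis using f0 by (simp add: abs_divide divide_le_eq)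
  qed
  have 3: "\<forall>i<n. \<forall>j<n. H i j / frob n H = H j i / frob n H" using sym by simp
  show ?thesis unfolding good_matrices_def mem_Collect_eq
    by (intro conjI 1 3 H_square_domination[OF f] allI impI 2) blast+
qed

lemma error_dichotomy:
  "frob n (\<lambda>i j. X i j - outer x i j)
     \<le> nuclear_norm n (\<lambda>i j. outer x i j - outer (restrict_vec \<Omega> x) i j)
       + lam * mnorm1 n (\<lambda>i j. outer x i j - outer (restrict_vec \<Omega> x) i j) \<or>
   (\<lambda>i j. (X i j - outer x i j) / frob n (\<lambda>i j. X i j - outer x i j)) \<in> good_matrices n k lam 26 23"
  using normalized_H_good unfolding H_def \<delta>_def Z_def p_def by linarith

lemma error_budget_nonneg:
  "0 \<le> nuclear_norm n (\<lambda>i j. outer x i j - outer (restrict_vec \<Omega> x) i j)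
       + lam * mnorm1 n (\<lambda>i j. outer x i j - outer (restrict_vec \<Omega> x) i j)"
  using \<delta>_bounds(1,2) unfolding \<delta>_def Z_def p_def by linarith

end

section \<open>Recovery\<close>

lemma vnorm2_le_vnorm1: "vnorm2 n u \<le> vnorm1 n u"
  unfolding vnorm2_def vnorm1_def
  using L2_set_le_sum_abs[of u "{..<n}"] by (simp add: L2_set_def)

lemma vnorm2_dotp: "vnorm2 n u = sqrt (dotp n u u)"
  by (simp add: vnorm2_def dotp_def power2_eq_square)

lemma meas_op_qf: "meas_op n a M i = qf n M (a i)"
  by (simp add: meas_op_def qf_def)

lemma qf_outer: "qf n (outer x) a = (\<Sum>j<n. a j * x j)\<^sup>2"
  by (simp add: qf_def outer_def power2_eq_square sum_product mult_ac)

lemma psd_outer: "psd n (outer x)"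
  unfolding psd_def using qf_outer[of n x] by (simp add: qf_def outer_def mult.commute)

text \<open>The summand 1 in the constant serves the case in which the approximation error already
  dominates, and 2 / q the case in which the lower bound for the measurements applies. The sparsity
  is \<open>min k n\<close>, the actual size of a best support.\<close>

lemma recovery_from_lower_bound:
  assumes q: "q > 0" and k: "k \<ge> 1" "n \<ge> 1" and lam: "0 < lam" "lam \<le> \<rho> / sqrt (real k)" and \<rho>: "\<rho> > 0" and m: "m \<ge> 1"
    and lower: "\<And>H. H \<in> good_matrices n (min k n) lam 26 23 \<Longrightarrow> q * m \<le> (\<Sum>i<m. \<bar>qf n H (a i)\<bar>)"
  shows "recovery_event n k m \<rho> lam (1 + 2 / q) a"
  unfolding recovery_event_def
proof (intro allI impI)
  fix x \<Omega> eps1 and \<eta> :: "nat \<Rightarrow> real" and X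
  assume supp: "best_k_support n k x \<Omega>"
    and ratio: "\<rho> \<le> vnorm2 n (restrict_vec \<Omega> x) / vnorm1 n (restrict_vec \<Omega> x)"
    and eps: "0 \<le> eps1" "(\<Sum>i<m. \<bar>\<eta> i\<bar>) \<le> eps1"
    and min: "is_minimizer n m lam a (\<lambda>i. (\<Sum>j<n. a i j * x j)\<^sup>2 + \<eta> i) eps1 X"
  let ?p = "restrict_vec \<Omega> x"
  have v1: "vnorm1 n ?p > 0"
  proof -
    have "0 \<le> vnorm1 n ?p" by (simp add: vnorm1_def sum_nonneg)
    \<comment> \<open>A vanishing denominator would make the ratio 0 by convention, contrary to
      \<rho> > 0.\<close>
    moreover have "vnorm1 n ?p \<noteq> 0" using ratio \<rho> by auto
    ultimately show ?thesis by simp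
  qed
  have v2: "\<rho> * vnorm1 n ?p \<le> vnorm2 n ?p" using ratio v1 by (simp add: le_divide_eq)
  have "0 < \<rho> * vnorm1 n ?p" using \<rho> v1 by simp
  then have v2p: "vnorm2 n ?p > 0" using v2 by linarith
  have feas: "feasible n m a (\<lambda>i. (\<Sum>j<n. a i j * x j)\<^sup>2 + \<eta> i) eps1 (outer x)"
    unfolding feasible_def meas_op_qf qf_outer using psd_outer eps(2) by simp
  have fX: "psd n X" "(\<Sum>i<m. \<bar>(\<Sum>j<n. a i j * x j)\<^sup>2 + \<eta> i - qf n X (a i)\<bar>) \<le> eps1"
    using min unfolding is_minimizer_def feasible_def meas_op_qf by auto
  have D: "descent n (min k n) \<Omega> lam x X"
  proof
    show "\<Omega> \<subseteq> {..<n}" "card \<Omega> = min k n" using supp by (auto simp: best_k_support_def)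
    show "1 \<le> min k n" using k by simp
    show "0 < lam" by fact
    show "psd n X" by fact
    show "mtrace n X + lam * mnorm1 n X \<le> mtrace n (outer x) + lam * mnorm1 n (outer x)"
      using min feas unfolding is_minimizer_def by blast
    show "0 < dotp n ?p ?p" using v2p unfolding vnorm2_dotp by simp
    have sk: "sqrt (real k) > 0" using k by simp
    have "lam * sqrt (real (min k n)) \<le> (\<rho> / sqrt (real k)) * sqrt (real k)"
      using lam \<rho> by (intro mult_mono) auto
    also have "\<dots> = \<rho>" using sk by simp
    finally have "lam * sqrt (real (min k n)) * vnorm1 n ?p \<le> \<rho> * vnorm1 n ?p" using v1 by (intro mult_right_mono) auto
    then show "lam * sqrt (real (min k n)) * vnorm1 n ?p \<le> sqrt (dotp n ?p ?p)" using v2 unfolding vnorm2_dotp by linarith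
  qed
  let ?H = "\<lambda>i j. X i j - outer x i j"
  let ?f = "frob n ?H"
  let ?\<delta> = "nuclear_norm n (\<lambda>i j. outer x i j - outer ?p i j) + lam * mnorm1 n (\<lambda>i j. outer x i j - outer ?p i j)"
  have \<delta>0: "0 \<le> ?\<delta>" by (rule descent.error_budget_nonneg[OF D])
  have ep: "0 \<le> eps1 / real m" using eps by simp
  show "?f \<le> (1 + 2 / q) * (?\<delta> + eps1 / real m)"
  proof (cases "?f \<le> ?\<delta>")
    case True
    have "?\<delta> + eps1 / real m \<le> (1 + 2 / q) * (?\<delta> + eps1 / real m)"
      using \<delta>0 ep q by (simp add: distrib_right)
    then show ?thesis using True ep by linarith
  next
    case False
    then have f0: "?f > 0" using \<delta>0 by linarith
    have "(\<lambda>i j. ?H i j / ?f) \<in> good_matrices n (min k n) lam 26 23"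
      using descent.error_dichotomy[OF D] False by blast
    from lower[OF this] have "q * m \<le> (\<Sum>i<m. \<bar>qf n (\<lambda>i j. ?H i j / ?f) (a i)\<bar>)" .
    also have "\<dots> = (\<Sum>i<m. \<bar>qf n ?H (a i)\<bar>) / ?f"
    proof -
      have "qf n (\<lambda>i j. ?H i j / ?f) u = qf n ?H u / ?f" for u by (simp add: qf_def sum_divide_distrib)
      then show ?thesis using f0 by (simp add: sum_divide_distrib)
    qed
    also have "(\<Sum>i<m. \<bar>qf n ?H (a i)\<bar>) \<le> (\<Sum>i<m. \<bar>(\<Sum>j<n. a i j * x j)\<^sup>2 + \<eta> i - qf n X (a i)\<bar> + \<bar>\<eta> i\<bar>)"
    proof (rule sum_mono)
      fix i
      have "qf n ?H (a i) = qf n X (a i) - (\<Sum>j<n. a i j * x j)\<^sup>2"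
        unfolding qf_outer[symmetric] by (simp add: qf_def algebra_simps sum_subtractf)
      then show "\<bar>qf n ?H (a i)\<bar> \<le> \<bar>(\<Sum>j<n. a i j * x j)\<^sup>2 + \<eta> i - qf n X (a i)\<bar> + \<bar>\<eta> i\<bar>" by linarith
    qed
    also have "\<dots> \<le> 2 * eps1" using fX(2) eps(2) by (simp add: sum.distrib)
    finally have "q * m \<le> 2 * eps1 / ?f" using f0 by (simp add: divide_right_mono)
    then have "?f * (q * m) \<le> 2 * eps1" using f0 by (simp add: field_simps)
    moreover have "q * m > 0" using q m by simp
    ultimately have "?f \<le> 2 * eps1 / (q * m)" by (simp only: pos_le_divide_eq)
    also have "\<dots> = 2 / q * (eps1 / m)" by simp
    also have "\<dots> \<le> (1 + 2 / q) * (?\<delta> + eps1 / real m)"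
      using \<delta>0 ep q by (intro mult_mono) auto
    finally show ?thesis .
  qed
qed

text \<open>A measurable \<open>E\<close> inside the recovery event carries the probability bound,
  because the recovery event itself quantifies over uncountably many signals, noises and
  minimizers.\<close>

theorem theorem4:
  fixes D :: "real measure"
  assumes "subgaussian_entry_law D"
  shows "\<exists>C0 C1 C2 c0 :: real. C0 > 0 \<and> C1 > 0 \<and> C2 > 0 \<and> c0 > 0 \<and>
    (\<forall>n k m :: nat. \<forall>\<rho> lam :: real.
       n \<ge> 1 \<longrightarrow> \<rho> > 0 \<longrightarrow> 1 / real n \<le> lam \<longrightarrow> lam \<le> \<rho> / sqrt (real k) \<longrightarrow>
       real m > C2 * ln (real n) / lam\<^sup>2 \<longrightarrow>
       (\<exists>E \<in> sets (sample_space m n D).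
          E \<subseteq> {w \<in> space (sample_space m n D).
                  recovery_event n k m \<rho> lam C1 (\<lambda>i j. w (i, j))} \<and>
          measure (sample_space m n D) E \<ge> 1 - C0 * exp (- c0 * real m)))"
proof -
  obtain s0 where s0: "subgaussian_law D s0" and \<mu>4: "(\<integral>t. t ^ 4 \<partial>D) > 1"
    using subgaussian_entry_law_imp[OF assms] .
  interpret subgaussian_law D s0 by (rule s0)
  obtain q c0 C3 :: real where q: "q > 0" and c0: "c0 > 0" and C3: "C3 > 0"
    and lower: "\<forall>n k m lam. n \<ge> 1 \<longrightarrow> k \<ge> 1 \<longrightarrow> k \<le> n \<longrightarrow> 0 < lam \<longrightarrow> lam \<le> 1 \<longrightarrow> real k * lam\<^sup>2 \<le> 1 \<longrightarrow>
       C3 * (1 + ln (real n)) / lam\<^sup>2 \<le> real m \<longrightarrow>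
       (\<exists>E\<in>sets (iid m (N n)). 1 - exp (- c0 * m) \<le> measure (iid m (N n)) E \<and>
         (\<forall>x\<in>E. \<forall>H\<in>good_matrices n k lam 26 23. q * m \<le> (\<Sum>i<m. \<bar>qf n H (x i)\<bar>)))"
    using uniform_lower_bound[OF \<mu>4, of 26 23, OF zero_less_numeral zero_less_numeral] .
  have key: "\<exists>E \<in> sets (sample_space m n D).
          E \<subseteq> {w \<in> space (sample_space m n D). recovery_event n k m \<rho> lam (1 + 2 / q) (\<lambda>i j. w (i, j))} \<and>
          measure (sample_space m n D) E \<ge> 1 - exp (c0 * C3) * exp (- c0 * real m)"
    if n: "n \<ge> 1" and \<rho>: "\<rho> > 0" and lam: "1 / real n \<le> lam" "lam \<le> \<rho> / sqrt (real k)"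
      and m: "real m > 3 * C3 * ln (real n) / lam\<^sup>2" for n k m :: nat and \<rho> lam :: real
  proof -
    let ?S = "sample_space m n D" and ?P = "iid m (N n)"
    interpret S: prob_space ?S unfolding sample_space_def by (intro prob_space_PiM prob)
    have "0 < 1 / real n" using n by simp
    then have lam0: "lam > 0" using lam(1) by linarith
    have k: "k \<ge> 1"
    proof (rule ccontr)
      assume "\<not> k \<ge> 1"
      then have "k = 0" by simp
      \<comment> \<open>For k = 0 the upper bound on lam is \<rho> / 0 = 0.\<close>
      then show False using lam(2) lam0 by simp
    qed
    have lnn: "0 \<le> ln (real n)" using n by simp
    have m1: "m \<ge> 1"
    proof -
      have "0 \<le> 3 * C3 * ln (real n) / lam\<^sup>2" using C3 lnn by simp
      then show ?thesis using m by linarith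
    qed
    \<comment> \<open>The lower bound needs 1 + ln n where the hypothesis supplies 3 ln n. This is
      enough for n >= 2, since ln 2 >= 2 / 3, so the case \<open>small\<close> leaves only n =
      1.\<close>
    consider (rho) "\<rho> > 1" | (small) "real m < C3 * (1 + ln (real n)) / lam\<^sup>2"
      | (main) "\<rho> \<le> 1" "C3 * (1 + ln (real n)) / lam\<^sup>2 \<le> real m" by linarith
    then show ?thesis
    proof cases
      case rho
      have "recovery_event n k m \<rho> lam (1 + 2 / q) a" for a
      proof -
        have "vnorm2 n u / vnorm1 n u \<le> 1" for u
          using vnorm2_le_vnorm1[of n u] by (cases "vnorm1 n u = 0") (auto simp: divide_le_eq_1 vnorm1_def order_less_le sum_nonneg)
        then have "\<not> \<rho> \<le> vnorm2 n u / vnorm1 n u" for u using rho by (meson not_le order_le_less_trans)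
        then show ?thesis unfolding recovery_event_def by blast
      qed
      then show ?thesis by (intro bexI[of _ "space ?S"]) (auto simp: S.prob_space)
    next
      case small
      have "n = 1"
      proof (rule ccontr)
        assume "n \<noteq> 1"
        then have "real n \<ge> 2" using n by simp
        then have "ln 2 \<le> ln (real n)" by (intro ln_mono) auto
        then have "1 + ln (real n) \<le> 3 * ln (real n)" using ln2_ge_two_thirds by linarith
        then have "C3 * (1 + ln (real n)) / lam\<^sup>2 \<le> C3 * (3 * ln (real n)) / lam\<^sup>2"
          using C3 by (intro divide_right_mono mult_left_mono) auto
        also have "\<dots> = 3 * C3 * ln (real n) / lam\<^sup>2" by simp
        finally show False using small m by linarith
      qed
      then have "1 \<le> lam" using lam(1) by simp
      then have "1 \<le> lam\<^sup>2" by (rule one_le_power)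
      then have "C3 / lam\<^sup>2 \<le> C3" using C3 by (simp add: divide_le_eq mult_le_cancel_left1)
      then have "real m \<le> C3" using small \<open>n = 1\<close> by simp
      then have "c0 * real m \<le> c0 * C3" using c0 by simp
      \<comment> \<open>The factor \<open>exp (c0 * C3)\<close> is chosen for this case: for m <=
        \<open>C3\<close> the claimed probability is at most 0, and the empty event
        suffices.\<close>
      then have "1 \<le> exp (c0 * C3) * exp (- c0 * real m)" by (simp add: exp_add[symmetric])
      then show ?thesis by (intro bexI[of _ "{}"]) auto
    next
      case main
      let ?k = "min k n"
      have k1: "1 \<le> ?k" "?k \<le> n" using k n by auto
      have sk: "1 \<le> sqrt (real k)" using k by simp
      have "\<rho> / sqrt (real k) \<le> 1 / sqrt (real k)" using main(1) by (intro divide_right_mono) auto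
      then have "lam \<le> 1 / sqrt (real k)" using lam(2) by linarith
      then have lk: "lam * sqrt (real k) \<le> 1" using sk by (simp add: le_divide_eq)
      have "lam \<le> lam * sqrt (real k)" using lam0 sk by simp
      then have l1: "lam \<le> 1" using lk by linarith
      have "real ?k * lam\<^sup>2 \<le> real k * lam\<^sup>2" by (intro mult_right_mono) auto
      also have "\<dots> = (lam * sqrt (real k))\<^sup>2" by (simp add: power_mult_distrib)
      also have "\<dots> \<le> 1" using lk lam0 by (simp add: power_le_one)
      finally have kl: "real ?k * lam\<^sup>2 \<le> 1" .
      obtain E where E: "E \<in> sets ?P" "1 - exp (- c0 * m) \<le> measure ?P E"
        "\<And>x H. x \<in> E \<Longrightarrow> H \<in> good_matrices n ?k lam 26 23 \<Longrightarrow> q * m \<le> (\<Sum>i<m. \<bar>qf n H (x i)\<bar>)"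
        using lower[rule_format, OF n k1 lam0 l1 kl main(2)] by blast
      define E' where "E' = sample_rows m n -` E \<inter> space ?S"
      have E': "E' \<in> sets ?S" unfolding E'_def using E(1) by (rule measurable_sets[OF measurable_sample_rows])
      have "measure ?P E = measure (distr ?S ?P (sample_rows m n)) E" unfolding distr_sample_rows[OF prob m1 n] ..
      also have "\<dots> = measure ?S E'" unfolding E'_def by (rule measure_distr[OF measurable_sample_rows E(1)])
      finally have ms: "1 - exp (- c0 * m) \<le> measure ?S E'" using E(2) by simp
      have "exp (- c0 * m) \<le> exp (c0 * C3) * exp (- c0 * m)" using c0 C3 by simp
      then have "1 - exp (c0 * C3) * exp (- c0 * real m) \<le> measure ?S E'" using ms by linarith
      moreover have "recovery_event n k m \<rho> lam (1 + 2 / q) (\<lambda>i j. w (i, j))" if w: "w \<in> E'" for w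
      proof (rule recovery_from_lower_bound[OF q k n lam0 lam(2) \<rho> m1])
        fix H assume H: "H \<in> good_matrices n ?k lam 26 23"
        have "sample_rows m n w \<in> E" using w by (simp add: E'_def)
        from E(3)[OF this H] have "q * m \<le> (\<Sum>i<m. \<bar>qf n H (sample_rows m n w i)\<bar>)" .
        also have "\<dots> = (\<Sum>i<m. \<bar>qf n H (\<lambda>j. w (i, j))\<bar>)"
          by (intro sum.cong refl arg_cong[where f=abs]) (simp add: qf_def sample_rows_def)
        finally show "q * m \<le> (\<Sum>i<m. \<bar>qf n H (\<lambda>j. w (i, j))\<bar>)" .
      qed
      moreover have "E' \<subseteq> space ?S" by (auto simp: E'_def)
      ultimately show ?thesis using E' by blast
    qed
  qed
  show ?thesis
  proof (rule exI[of _ "exp (c0 * C3)"], rule exI[of _ "1 + 2 / q"], rule exI[of _ "3 * C3"], rule exI[of _ c0],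
      intro conjI allI impI)
    show "0 < exp (c0 * C3)" by simp
    show "0 < 1 + 2 / q" using q by (simp add: add_pos_pos)
    show "0 < 3 * C3" "0 < c0" using C3 c0 by simp_all
  qed (rule key)
qed


end
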